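(* Let $\Lambda$ be a multiset of nonnegative integers containing $0$ exactly once, with multiplicities $\lambda_i$ and $\Lambda(z)=\sum_i\lambda_iz^i$, and suppose that for some integer $m\ge1$, $\lambda_{2k-1}=0$ for $1\le k\le m$ while $\lambda_2>0$ and $\lambda_{2m+1}>0$. Let $\beta=\frac{\lambda_3\pi}{2\sqrt3\,\lambda_2^{3/2}}$ and $\rho=\frac{3\lambda_2}{e\pi^2}$. If $m=1$, then \[ [z^n]\sum_{k\ge0}\prod_{1\le j\le k}\bigl(1-\Lambda(z)^{-j}\bigr)=c\,e^{\beta\sqrt n}\rho^{\frac12n}n^{\frac12n+1}\bigl(1+O(n^{-1/2})\bigr),\quad c=\frac{3\sqrt6}{\pi^2}e^{\frac{\pi^2}{6}\left(\frac{\lambda_4}{\lambda_2^2}-\frac12-\frac{7\lambda_3^2}{8\lambda_2^3}\right)}. \] If $m\ge2$, then \[ [z^n]\sum_{k\ge0}\prod_{1\le j\le k}\bigl(1-\Lambda(z)^{-j}\bigr)=\begin{cases}c'e^{\beta\sqrt n}\rho^{\frac12n}n^{\frac12n+1}\bigl(1+O(n^{-1/2})\bigr),& n\text{ even},\\ c_me^{\beta\sqrt n}\rho^{\frac12n}n^{\frac12n-m+\frac52}\bigl(1+O(n^{-1/2})\bigr),& n\text{ odd},\end{cases} \] where $c'=\frac{6\sqrt6}{\pi^2}e^{\frac{\pi^2}{6}\left(\frac{\lambda_4}{\lambda_2^2}-\frac12\right)}$ and $c_m=\frac{\sqrt2\,\pi^{2m-3}}{3^{m-2}}\cdot\frac{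\lambda_{2m+1}}{\lambda_2^{m+1/2}}e^{\frac{\pi^2}{6}\left(\frac{\lambda_4}{\lambda_2^2}-\frac12\right)}$.
   Context: $\lambda_i$ is the (finite) multiplicity of value $i$ in $\Lambda$, $\lambda_0=1$. The coefficient $[z^n]\sum_{k\ge0}\prod_{1\le j\le k}(1-\Lambda(z)^{-j})$ is the number of $\Lambda$-Fishburn matrices of size $n$, i.e. upper-triangular square matrices with entries from $\Lambda$ (a value $i$ chosen in $\lambda_i$ distinguishable ways), no zero row and no zero column, with entry sum $n$.
   Formalization: Λ(z) is additionally assumed to have positive radius of convergence (λ_n at most exponential in n); with no growth bound the claim fails, e.g. m=1, λ_2=λ_3=1, λ_n=n^{n^2} for n≥4, where the 1×1 matrix (n) alone exceeds the main term. *)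

theory Defs
  imports
    "HOL-Analysis.Analysis"
    "HOL-Computational_Algebra.Computational_Algebra"
    "HOL-Library.Landau_Symbols"
begin

text \<open>
  A multiset of nonnegative integers is given by its multiplicity function
  \<open>\<lambda> :: nat \<Rightarrow> nat\<close>; it may have infinite support, so the type of (finite)
  multisets from the library does not apply.
\<close>

definition multiset_gf :: "(nat \<Rightarrow> nat) \<Rightarrow> real fps" where
  "multiset_gf l = Abs_fps (\<lambda>i. real (l i))"

text \<open>
  The infinite sum is a limit in the \<open>X\<close>-adic metric on formal power series, in which it
  converges as soon as \<open>L\<close> has constant coefficient 1 (lemma \<open>fishburn_gf_sums\<close>).
\<close>

definition fishburn_gf :: "real fps \<Rightarrow> real fps" where
  "fishburn_gf L = (\<Sum>k. \<Prod>j=1..k. (1 - inverse (L ^ j)))"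

lemma fishburn_summand_nth_eq_0:
  fixes L :: "real fps"
  assumes "fps_nth L 0 = 1" and "n < k"
  shows "fps_nth (\<Prod>j=1..k. (1 - inverse (L ^ j))) n = 0"
  using assms(2)
proof (induction k arbitrary: n)
  case 0
  then show ?case by simp
next
  case (Suc k)
  have *: "fps_nth (1 - inverse (L ^ Suc k)) 0 = 0"
    using assms(1) by (simp add: fps_nth_power_0 del: power_Suc)
  have "fps_nth (\<Prod>j=1..k. (1 - inverse (L ^ j))) i * fps_nth (1 - inverse (L ^ Suc k)) (n - i) = 0"
    if "i \<le> n" for i
  proof (cases "i < k")
    case True
    then show ?thesis using Suc.IH by simp
  next
    case False
    with that Suc.prems have "n - i = 0" by simp
    then show ?thesis using * by simp
  qed
  then have "fps_nth ((\<Prod>j=1..k. (1 - inverse (L ^ j))) * (1 - inverse (L ^ Suc k))) n = 0"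
    unfolding fps_mult_nth by (intro sum.neutral) simp
  then show ?case by (simp del: power_Suc)
qed

lemma fishburn_gf_sums:
  fixes L :: "real fps"
  assumes "fps_nth L 0 = 1"
  shows "(\<lambda>k. \<Prod>j=1..k. (1 - inverse (L ^ j))) sums fishburn_gf L"
proof -
  let ?P = "\<lambda>k. \<Prod>j=1..k. (1 - inverse (L ^ j))"
  define S where "S = Abs_fps (\<lambda>n. \<Sum>k\<le>n. fps_nth (?P k) n)"
  have "(\<lambda>N. \<Sum>k<N. ?P k) \<longlonglongrightarrow> S"
  proof (rule tendsto_fpsI)
    fix n
    have "fps_nth (\<Sum>k<N. ?P k) n = fps_nth S n" if "N > n" for N
      unfolding S_def fps_sum_nth fps_nth_Abs_fps
      by (rule sum.mono_neutral_right)
         (use that fishburn_summand_nth_eq_0[OF assms, of n] in \<open>auto simp flip: not_less\<close>)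
    then show "\<forall>\<^sub>F N in sequentially. fps_nth (\<Sum>k<N. ?P k) n = fps_nth S n"
      by (rule eventually_mono[OF eventually_gt_at_top[of n]])
  qed
  then have "?P sums S" by (simp add: sums_def)
  then show ?thesis
    unfolding fishburn_gf_def by (simp add: sums_iff)
qed

end

theory Submission
  imports
    Defs
    "HOL-Complex_Analysis.Complex_Analysis"
    "HOL-Probability.Distributions"
    "HOL-Real_Asymp.Real_Asymp"
begin

text \<open>
  Write \<open>L = e\<^sup>w\<close>. Then the series is Zagier's \<open>\<Sum>k. (q; q)\<^sub>k\<close> at \<open>q = e\<^sup>-\<^sup>w\<close>, and Zagier's strange identity
  expands it as \<open>e\<^bsup>w/24\<^esup>\<close> times a power series in \<open>w\<close> whose coefficients are regularised sums
  of \<open>\<chi> n * n\<^bsup>2j+1\<^esup>\<close> with the even character \<open>\<chi>\<close> modulo 12. These sums are read off from the poles of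
  the generating function of \<open>\<chi>\<close>; up to a negligible error the two poles \<open>\<plusminus>i\<pi>/6\<close> nearest to the origin
  turn them into Gaussian moments. With \<open>v = sqrt w\<close>, the \<open>n\<close>-th coefficient therefore becomes the integral
  over the real line of \<open>p\<^sup>2 exp (- \<pi>\<^sup>2p\<^sup>2/6)\<close> against the \<open>n\<close>-th coefficient of \<open>e\<^bsup>w/24\<^esup> / (1 - p v)\<close>, up to
  the factor \<open>sqrt (2\<pi>)\<close>.

  For large positive \<open>p\<close> the latter coefficient is dominated by the pole at the small solution \<open>\<zeta>\<close> of
  \<open>p * v \<zeta> = 1\<close>. Substituting \<open>u = 1/\<zeta>\<close> gives an integral of \<open>u\<^sup>n\<^sup>+\<^sup>2 exp (- A u\<^sup>2 + B u)\<close>, to which Laplace's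
  method applies. The half-line of negative \<open>p\<close> contributes the same with \<open>z\<close> replaced by \<open>-z\<close> and the
  sign \<open>(-1)\<^sup>n\<close>. If \<open>\<lambda>\<^sub>3 > 0\<close>, it is exponentially smaller. If \<open>\<lambda>\<^sub>3 = 0\<close>, the two contributions are equal to
  leading order, so they add up for even \<open>n\<close>, and for odd \<open>n\<close> they cancel except for the effect of
  the first odd coefficient \<open>\<lambda>\<^bsub>2m+1\<^esub>\<close>.
\<close>

section \<open>Zagier's strange identity\<close>

text \<open>The theta side of the strange identity exists only as a regularised sum, so the identity
  is characterised rather than summed. An extra parameter a, inserted as x = q^a, gives two
  functions with the same inhomogeneous recurrence from a to a + 1, and polynomial dependence of the
  coefficients on a makes its solution unique. The sum of interest sits at a = 0, where both
  functions vanish, hence a derivative in a.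

  The main term grows like n^(n/2) up to exponential factors, so every error of the form C D^n is
  free: the pole of the kernel may be extracted in a small fixed disc, and bounded p needs only a
  crude bound. The remaining poles of the character series are the exception. Their bound also has
  order n^(n/2), and the rates a/12 and 3a/(e pi^2), with a = \<open>l 2\<close>, must be compared.

  For odd n and m >= 2 the two half-lines differ only by a relative amount of order n^(3/2 - m), no
  larger than the error n^(-1/2) known for each of them. Therefore the integrands are subtracted
  before Laplace's method is applied, not the resulting asymptotics.\<close>

text \<open>
  Throughout, \<open>q = e\<^sup>-\<^sup>X\<close>, so \<open>qpow c\<close> is the power \<open>q\<^sup>c\<close> with a real exponent.
\<close>

definition qpow :: "real \<Rightarrow> real fps" where
  "qpow c = fps_exp (- c)"

lemma qpow_0 [simp]: "qpow 0 = 1"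
  by (simp add: qpow_def)

lemma qpow_add: "qpow (a + b) = qpow a * qpow b"
  by (simp add: qpow_def flip: fps_exp_add_mult)

lemma qpow_mult_of_nat: "qpow (of_nat n * a) = qpow a ^ n"
  by (simp add: qpow_def fps_exp_power_mult)

lemma qpow_nth: "fps_nth (qpow c) j = (- c) ^ j / fact j"
  by (simp add: qpow_def)

section \<open>Power series whose coefficients are polynomials in a parameter\<close>

definition pol_fps :: "(real \<Rightarrow> real fps) \<Rightarrow> bool" where
  "pol_fps h \<longleftrightarrow> (\<forall>j. \<exists>p. \<forall>a. fps_nth (h a) j = poly p a)"

lemma pcompose_power: "pcompose (p ^ n) q = pcompose p q ^ n"
  for p :: "'a :: comm_semiring_1 poly"
  by (induction n) (simp_all add: pcompose_mult pcompose_1)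

lemma pol_fps_const: "pol_fps (\<lambda>a. c)"
  unfolding pol_fps_def by (metis poly_const_conv)

lemma pol_fps_diff:
  assumes "pol_fps g" "pol_fps h"
  shows "pol_fps (\<lambda>a. g a - h a)"
  using assms unfolding pol_fps_def by (metis fps_sub_nth poly_diff)

lemma polyfun_sum:
  assumes "\<And>i. i \<in> I \<Longrightarrow> \<exists>p. \<forall>a::real. f i a = poly p a"
  shows "\<exists>p. \<forall>a. (\<Sum>i\<in>I. f i a) = poly p a"
proof -
  from assms obtain p where "\<And>i a. i \<in> I \<Longrightarrow> f i a = poly (p i) a"
    by metis
  then have "\<forall>a. (\<Sum>i\<in>I. f i a) = poly (\<Sum>i\<in>I. p i) a"
    by (simp add: poly_sum)
  then show ?thesis by blast
qed

lemma pol_fps_mult: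
  assumes "pol_fps g" "pol_fps h"
  shows "pol_fps (\<lambda>a. g a * h a)"
  unfolding pol_fps_def fps_mult_nth
proof (intro allI polyfun_sum)
  fix j i
  obtain p q where "\<forall>a. fps_nth (g a) i = poly p a" "\<forall>a. fps_nth (h a) (j - i) = poly q a"
    using assms unfolding pol_fps_def by blast
  then have "\<forall>a. fps_nth (g a) i * fps_nth (h a) (j - i) = poly (p * q) a"
    by simp
  then show "\<exists>p. \<forall>a. fps_nth (g a) i * fps_nth (h a) (j - i) = poly p a" ..
qed

lemma pol_fps_prod:
  assumes "\<And>i. i \<in> I \<Longrightarrow> pol_fps (f i)"
  shows "pol_fps (\<lambda>a. \<Prod>i\<in>I. f i a)"
  using assms by (induction I rule: infinite_finite_induct) (auto intro: pol_fps_const pol_fps_mult)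

lemma pol_fps_qpow: "pol_fps (\<lambda>a. qpow (a * c + d))"
  unfolding pol_fps_def
proof
  fix j
  have "\<forall>a. fps_nth (qpow (a * c + d)) j = poly (smult (1 / fact j) ([:- d, - c:] ^ j)) a"
    by (simp add: qpow_nth poly_power algebra_simps)
  then show "\<exists>p. \<forall>a. fps_nth (qpow (a * c + d)) j = poly p a" ..
qed

text \<open>Two unit steps give period 2, so p takes the value p(0) at infinitely many points and is
  constant; a constant equal to its own negative is 0.\<close>

lemma poly_antiperiodic_eq_0:
  fixes p :: "real poly"
  assumes "\<And>a. poly p a = - poly p (a + 1)"
  shows "p = 0"
proof -
  define r where "r = p - [:poly p 0:]"
  have *: "poly p (real (2 * n)) = poly p 0" for n
  proof (induction n)
    case (Suc n)
    have "poly p (real (2 * n)) = poly p (real (2 * Suc n))"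
      using assms[of "real (2 * n)"] assms[of "real (2 * n) + 1"] by (simp add: add_ac)
    with Suc show ?case by simp
  qed simp
  have "range (\<lambda>n. real (2 * n)) \<subseteq> {x. poly r x = 0}"
    using * by (auto simp: r_def)
  moreover have "infinite (range (\<lambda>n. real (2 * n)))"
    by (rule range_inj_infinite) (auto simp: inj_def)
  ultimately have "r = 0"
    using poly_roots_finite[of r] finite_subset by blast
  then have "p = [:poly p 0:]" by (simp add: r_def)
  then obtain c where c: "p = [:c:]" ..
  with assms[of 0] show ?thesis by simp
qed

text \<open>The factor \<open>qpow\<close> has constant coefficient 1. By induction the lower
  coefficients of d vanish, so at index j the recurrence reads d_j(a) = - d_j(a + 1), where d_j is a
  polynomial. Applied to the difference of two solutions, this is uniqueness for the inhomogeneous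
  recurrence.\<close>

lemma pol_fps_unique:
  assumes "pol_fps d" and rec: "\<And>a. d a = - (qpow (3 * a + 2) * d (a + 1))"
  shows "d a = 0"
proof -
  have "\<forall>a. fps_nth (d a) j = 0" for j
  proof (induction j rule: less_induct)
    case (less j)
    obtain p where p: "\<And>a. fps_nth (d a) j = poly p a"
      using assms(1) unfolding pol_fps_def by metis
    have "poly p a = - poly p (a + 1)" for a
    proof -
      have "fps_nth (qpow (3 * a + 2) * d (a + 1)) j
          = (\<Sum>i=0..j. fps_nth (qpow (3 * a + 2)) i * fps_nth (d (a + 1)) (j - i))"
        by (simp add: fps_mult_nth)
      also have "\<dots> = (\<Sum>i\<in>{0}. fps_nth (qpow (3 * a + 2)) i * fps_nth (d (a + 1)) (j - i))"
        using less by (intro sum.mono_neutral_right) auto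
      finally show ?thesis
        using p[of a] p[of "a + 1"] arg_cong[OF rec[of a], of "\<lambda>f. fps_nth f j"] by (simp add: qpow_nth)
    qed
    then have "p = 0" by (rule poly_antiperiodic_eq_0)
    then show ?case by (simp add: p)
  qed
  then show ?thesis by (simp add: fps_eq_iff)
qed

section \<open>The q-series and its recurrence in the parameter a\<close>

lemma qprod_telescope:
  fixes x q :: "'a :: comm_ring_1"
  defines "P \<equiv> \<lambda>n. \<Prod>i=1..n. 1 - x * q ^ i"
  shows "q ^ 2 * x ^ 3 * (\<Sum>n<M. (q * x) ^ n * P (Suc n)) =
    x * ((\<Sum>n<Suc M. x ^ n * P n) - 1) - ((\<Sum>n<Suc (Suc M). x ^ n * P n) - 1 - x * (1 - x * q))"
proof (induction M)
  case 0
  show ?case by (simp add: P_def)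
next
  case (Suc M)
  have P: "P (Suc (Suc M)) = P (Suc M) * (1 - x * q ^ (M + 2))"
    by (simp add: P_def)
  \<comment> \<open>The difference on the right is x^(M+2) P(M+1) (1 - (1 - x q^(M+2))). The three
    sums have M, M + 1 and M + 2 terms, which makes the identity exact without any limit.\<close>
  have "q ^ 2 * x ^ 3 * ((q * x) ^ M * P (Suc M)) = x * (x ^ Suc M * P (Suc M)) - x ^ Suc (Suc M) * P (Suc (Suc M))"
    unfolding P by (simp add: algebra_simps power_mult_distrib power_add numeral_eq_Suc)
  then have "q ^ 2 * x ^ 3 * (\<Sum>n<Suc M. (q * x) ^ n * P (Suc n)) =
      q ^ 2 * x ^ 3 * (\<Sum>n<M. (q * x) ^ n * P (Suc n)) +
      (x * (x ^ Suc M * P (Suc M)) - x ^ Suc (Suc M) * P (Suc (Suc M)))"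
    by (simp add: distrib_left)
  also have "\<dots> = x * ((\<Sum>n<Suc (Suc M). x ^ n * P n) - 1) -
      ((\<Sum>n<Suc (Suc (Suc M)). x ^ n * P n) - 1 - x * (1 - x * q))"
    unfolding Suc.IH by (simp add: algebra_simps)
  finally show ?case .
qed

text \<open>With x = q^a this is x^n (xq; q)_n. At a = 0 it is (q; q)_n, the summand of the series
  in question; the parameter a makes a recurrence possible.\<close>

definition qterm :: "real \<Rightarrow> nat \<Rightarrow> real fps" where
  "qterm a n = qpow (real n * a) * (\<Prod>i=1..n. 1 - qpow (a + real i))"

text \<open>The n-th term has order at least n, since each of its n factors 1 - q^(a+i) lacks a
  constant coefficient; the cut-off n <= j is therefore exact in coefficient j.\<close>

definition qsum :: "real \<Rightarrow> real fps" where
  "qsum a = Abs_fps (\<lambda>j. \<Sum>n\<le>j. fps_nth (qterm a n) j)"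

lemma fps_nth_mult_prod_eq_0:
  fixes f :: "nat \<Rightarrow> 'a :: comm_ring_1 fps"
  assumes "\<And>i. fps_nth (f i) 0 = 0" "j < n"
  shows "fps_nth (g * (\<Prod>i=1..n. f i)) j = 0"
  using assms(2)
proof (induction n arbitrary: j)
  case (Suc n)
  have "fps_nth (g * (\<Prod>i=1..n. f i)) i * fps_nth (f (Suc n)) (j - i) = 0" if "i \<le> j" for i
  proof (cases "i < n")
    case True
    then show ?thesis using Suc.IH by simp
  next
    case False
    with that Suc.prems have "j - i = 0" by simp
    then show ?thesis using assms(1) by simp
  qed
  then have "fps_nth ((g * (\<Prod>i=1..n. f i)) * f (Suc n)) j = 0"
    unfolding fps_mult_nth[of "g * _"] by (intro sum.neutral) simp
  then show ?case by (simp add: mult_ac)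
qed simp

lemma qterm_nth_eq_0: "j < n \<Longrightarrow> fps_nth (qterm a n) j = 0"
  unfolding qterm_def by (rule fps_nth_mult_prod_eq_0) (simp_all add: qpow_nth)

lemma qsum_nth: "j < M \<Longrightarrow> fps_nth (\<Sum>n<M. qterm a n) j = fps_nth (qsum a) j"
  unfolding qsum_def fps_sum_nth fps_nth_Abs_fps
  by (rule sum.mono_neutral_right) (auto simp: not_le qterm_nth_eq_0 intro: leI)

lemma fps_mult_nth_cong:
  assumes "\<And>i. i \<le> j \<Longrightarrow> fps_nth g i = fps_nth h i"
  shows "fps_nth (f * g) j = fps_nth (f * h) j"
  using assms by (simp add: fps_mult_nth)

lemma qsum_rec:
  "(1 - qpow a) * qsum a = 1 - qpow (2 * a + 1) - qpow (3 * a + 2) * ((1 - qpow (a + 1)) * qsum (a + 1))"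
proof (rule fps_ext)
  fix j
  define x q where "x = qpow a" and "q = qpow 1"
  \<comment> \<open>This is enough for all three partial sums to agree with the full series in
    coefficient j.\<close>
  define M where "M = Suc j"
  define P where "P = (\<lambda>n. \<Prod>i=1..n. 1 - x * q ^ i)"
  have x: "qpow (a + real i) = x * q ^ i" for i
    using qpow_mult_of_nat[of i 1] by (simp add: qpow_add x_def q_def)
  have t0: "qterm a n = x ^ n * P n" for n
    by (simp add: qterm_def x P_def qpow_mult_of_nat x_def[symmetric])
  have P_Suc: "P (Suc n) = P n * (1 - x * q ^ Suc n)" for n
    by (simp add: P_def)
  \<comment> \<open>The product for a + 1 starts with 1 - x q^2; the factor 1 - q x supplies the one
    missing in front.\<close>
  have "(1 - q * x) * (\<Prod>i=1..n. 1 - x * q ^ Suc i) = P (Suc n)" for n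
    by (induction n) (simp_all add: P_Suc[of "Suc _"] mult_ac, simp add: P_def mult_ac)
  moreover have x': "qpow (a + 1 + real i) = x * q ^ Suc i" for i
    using x[of "Suc i"] by (simp add: add_ac)
  ultimately have t1: "(1 - q * x) * qterm (a + 1) n = (q * x) ^ n * P (Suc n)" for n
    unfolding qterm_def qpow_mult_of_nat x'
    by (simp add: qpow_add x_def q_def mult_ac)
  have q1: "qpow (a + 1) = q * x" "qpow (2 * a + 1) = q * x ^ 2" "qpow (3 * a + 2) = q ^ 2 * x ^ 3"
    using qpow_mult_of_nat[of 2 a] qpow_mult_of_nat[of 3 a] qpow_mult_of_nat[of 2 1]
    by (simp_all add: qpow_add x_def q_def mult_ac)
  have "q ^ 2 * x ^ 3 * ((1 - q * x) * (\<Sum>n<M. qterm (a + 1) n)) =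
     x * ((\<Sum>n<Suc M. qterm a n) - 1) - ((\<Sum>n<Suc (Suc M). qterm a n) - 1 - x * (1 - x * q))"
    unfolding t0 sum_distrib_left[of "1 - q * x"] t1 P_def by (rule qprod_telescope)
  then have "x * (\<Sum>n<Suc M. qterm a n) - (\<Sum>n<Suc (Suc M). qterm a n)
       = q ^ 2 * x ^ 3 * ((1 - q * x) * (\<Sum>n<M. qterm (a + 1) n)) - 1 + q * x ^ 2"
    by (simp add: algebra_simps power2_eq_square)
  then have "fps_nth (x * (\<Sum>n<Suc M. qterm a n)) j - fps_nth (\<Sum>n<Suc (Suc M). qterm a n) j
     = fps_nth (q ^ 2 * x ^ 3 * ((1 - q * x) * (\<Sum>n<M. qterm (a + 1) n))) j - fps_nth 1 j + fps_nth (q * x ^ 2) j"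
    by (metis fps_add_nth fps_sub_nth)
  moreover have "fps_nth (x * (\<Sum>n<Suc M. qterm a n)) j = fps_nth (x * qsum a) j"
    by (intro fps_mult_nth_cong qsum_nth) (simp add: M_def)
  moreover have "fps_nth (\<Sum>n<Suc (Suc M). qterm a n) j = fps_nth (qsum a) j"
    by (intro qsum_nth) (simp add: M_def)
  moreover have "fps_nth (q ^ 2 * x ^ 3 * ((1 - q * x) * (\<Sum>n<M. qterm (a + 1) n))) j
       = fps_nth (q ^ 2 * x ^ 3 * ((1 - q * x) * qsum (a + 1))) j"
    by (intro fps_mult_nth_cong qsum_nth) (simp add: M_def)
  ultimately show "fps_nth ((1 - qpow a) * qsum a) j =
     fps_nth (1 - qpow (2 * a + 1) - qpow (3 * a + 2) * ((1 - qpow (a + 1)) * qsum (a + 1))) j"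
    unfolding q1 x_def[symmetric] by (simp add: algebra_simps)
qed

lemma pol_fps_qsum: "pol_fps qsum"
  unfolding pol_fps_def qsum_def fps_nth_Abs_fps
proof (intro allI polyfun_sum)
  fix j n
  have "pol_fps (\<lambda>a. qpow (a * real n + 0) * (\<Prod>i=1..n. 1 - qpow (a * 1 + real i)))"
    by (intro pol_fps_mult pol_fps_prod pol_fps_diff pol_fps_const pol_fps_qpow)
  then show "\<exists>p. \<forall>a. fps_nth (qterm a n) j = poly p a"
    by (simp add: pol_fps_def qterm_def mult.commute)
qed

section \<open>Regularised character sums\<close>

text \<open>
  With \<open>\<chi>\<close> the character modulo 12 taking the values \<open>1, -1, -1, 1\<close> at \<open>1, 5, 7, 11\<close>, this is the
  expansion of \<open>\<Sum>n. \<chi> n * e\<^sup>n\<^sup>X\<close>, summed as a geometric series; hence \<open>chi_sum p\<close> is the Abel sum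
  of \<open>\<chi> n * p n\<close>, and \<open>chi_exp r g\<close> that of \<open>\<chi> n * r n * q\<^bsup>g n\<^esup>\<close>.
\<close>

definition chi_egf :: "real fps" where
  "chi_egf = (fps_exp 1 - fps_exp 5) * inverse (1 + fps_exp 6)"

lemma chi_egf_eq: "fps_exp 6 * chi_egf = fps_exp 1 - fps_exp 5 - chi_egf"
proof -
  have "(1 + fps_exp 6) * inverse (1 + fps_exp 6 :: real fps) = 1"
    by (subst mult.commute, rule inverse_mult_eq_1) simp
  then have "(1 + fps_exp 6) * chi_egf = fps_exp 1 - fps_exp 5"
    by (simp add: chi_egf_def mult.left_commute)
  then show ?thesis by (simp add: algebra_simps)
qed

definition chi_sum :: "real poly \<Rightarrow> real" where
  "chi_sum p = (\<Sum>k\<le>degree p. coeff p k * fact k * fps_nth chi_egf k)"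

lemma chi_sum_altdef: "degree p \<le> d \<Longrightarrow> chi_sum p = (\<Sum>k\<le>d. coeff p k * fact k * fps_nth chi_egf k)"
  unfolding chi_sum_def by (rule sum.mono_neutral_left) (auto simp: coeff_eq_0)

lemma chi_sum_add: "chi_sum (p + q) = chi_sum p + chi_sum q"
proof -
  define d where "d = max (degree p) (degree q)"
  have "degree p \<le> d" "degree q \<le> d" "degree (p + q) \<le> d"
    by (auto simp: d_def degree_add_le_max)
  then show ?thesis
    by (simp add: chi_sum_altdef[of _ d] algebra_simps sum.distrib)
qed

lemma chi_sum_smult: "chi_sum (smult c p) = c * chi_sum p"
proof -
  have "degree (smult c p) \<le> degree p" by simp
  then show ?thesis
    by (simp add: chi_sum_altdef[of _ "degree p"] sum_distrib_left mult_ac del: degree_smult_eq)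
qed

lemma chi_sum_sum: "chi_sum (\<Sum>i\<in>I. f i) = (\<Sum>i\<in>I. chi_sum (f i))"
  by (induction I rule: infinite_finite_induct) (auto simp: chi_sum_add, auto simp: chi_sum_def)

lemma chi_sum_monom: "chi_sum (monom c k) = c * fact k * fps_nth chi_egf k"
  unfolding chi_sum_altdef[OF degree_monom_le] by (simp add: if_distrib if_distribR cong: if_cong)

text \<open>Since \<chi>(n + 6) = - \<chi>(n), the shifted sum is minus the original one without its
  terms at n = 1 and n = 5, where \<chi> is 1 and -1. For the regularised sum this is the
  coefficientwise content of \<open>chi_egf_eq\<close>, checked on powers of the argument.\<close>

lemma chi_sum_shift: "chi_sum (pcompose p [:6, 1:]) = poly p 1 - poly p 5 - chi_sum p"
proof -
  have mon: "chi_sum ([:6, 1:] ^ k) = 1 - 5 ^ k - fact k * fps_nth chi_egf k" for k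
  proof -
    have "degree ([:6, 1:] ^ k :: real poly) \<le> k"
      by (simp add: degree_power_eq)
    then have "chi_sum ([:6, 1:] ^ k) = (\<Sum>i\<le>k. real (k choose i) * 6 ^ (k - i) * fact i * fps_nth chi_egf i)"
      by (simp add: chi_sum_altdef[of _ k] coeff_linear_poly_power)
    also have "\<dots> = fact k * (\<Sum>i\<le>k. 6 ^ (k - i) / fact (k - i) * fps_nth chi_egf i)"
      by (auto simp: sum_distrib_left binomial_fact intro!: sum.cong)
    also have "(\<Sum>i\<le>k. 6 ^ (k - i) / fact (k - i) * fps_nth chi_egf i) = fps_nth (chi_egf * fps_exp 6) k"
      by (simp add: fps_mult_nth atMost_atLeast0 mult_ac)
    also have "\<dots> = 1 / fact k - 5 ^ k / fact k - fps_nth chi_egf k"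
      using arg_cong[OF chi_egf_eq, of "\<lambda>f. fps_nth f k"] by (simp add: mult.commute)
    finally show ?thesis by (simp add: right_diff_distrib)
  qed
  have "chi_sum (pcompose p [:6, 1:]) = chi_sum (\<Sum>k\<le>degree p. smult (coeff p k) ([:6, 1:] ^ k))"
  proof -
    have "pcompose p [:6, 1:] = (\<Sum>k\<le>degree p. smult (coeff p k) ([:6, 1:] ^ k))"
      by (subst (1) poly_as_sum_of_monoms[symmetric])
         (simp add: pcompose_sum monom_altdef pcompose_smult pcompose_power pcompose_pCons flip: smult_monom[of _ 1])
    then show ?thesis by simp
  qed
  also have "\<dots> = (\<Sum>k\<le>degree p. coeff p k * (1 - 5 ^ k - fact k * fps_nth chi_egf k))"
    by (simp add: chi_sum_sum chi_sum_smult mon)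
  also have "\<dots> = poly p 1 - poly p 5 - chi_sum p"
    by (simp add: poly_altdef chi_sum_def algebra_simps sum_subtractf sum.distrib)
  finally show ?thesis .
qed

definition chi_exp :: "real poly \<Rightarrow> real poly \<Rightarrow> real fps" where
  "chi_exp r g = Abs_fps (\<lambda>j. (-1) ^ j / fact j * chi_sum (r * g ^ j))"

text \<open>The binomial theorem for (g + c)^j is the Cauchy product with the exponential series of
  q^c.\<close>

lemma chi_exp_add_const: "chi_exp r (g + [:c:]) = qpow c * chi_exp r g"
proof (rule fps_ext)
  fix j
  have "chi_sum (r * (g + [:c:]) ^ j) = chi_sum (\<Sum>i\<le>j. smult (real (j choose i) * c ^ (j - i)) (r * g ^ i))"
    by (intro arg_cong[of _ _ chi_sum])
       (simp add: binomial_ring sum_distrib_left poly_const_pow mult_ac of_nat_poly)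
  also have "\<dots> = (\<Sum>i\<le>j. real (j choose i) * c ^ (j - i) * chi_sum (r * g ^ i))"
    by (simp add: chi_sum_sum chi_sum_smult)
  finally have "fps_nth (chi_exp r (g + [:c:])) j
     = (\<Sum>i\<le>j. (-1) ^ j / fact j * (real (j choose i) * c ^ (j - i) * chi_sum (r * g ^ i)))"
    by (simp only: chi_exp_def fps_nth_Abs_fps sum_distrib_left)
  also have "\<dots> = (\<Sum>i\<le>j. ((-1) ^ i / fact i * chi_sum (r * g ^ i)) * ((- c) ^ (j - i) / fact (j - i)))"
  proof (rule sum.cong[OF refl], goal_cases)
    case (1 i)
    then have "(-1 :: real) ^ j = (-1) ^ i * (-1) ^ (j - i)" by (simp flip: power_add)
    with 1 show ?case
      by (simp add: binomial_fact field_simps power_minus[of c])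
  qed
  also have "\<dots> = fps_nth (chi_exp r g * qpow c) j"
    by (simp add: fps_mult_nth atMost_atLeast0 chi_exp_def qpow_nth)
  finally show "fps_nth (chi_exp r (g + [:c:])) j = fps_nth (qpow c * chi_exp r g) j"
    by (simp add: mult.commute)
qed

lemma chi_exp_shift:
  "chi_exp 1 (pcompose g [:6, 1:]) = qpow (poly g 1) - qpow (poly g 5) - chi_exp 1 g"
proof (rule fps_ext)
  fix j
  have "chi_sum (pcompose g [:6, 1:] ^ j) = poly g 1 ^ j - poly g 5 ^ j - chi_sum (g ^ j)"
    using chi_sum_shift[of "g ^ j"] by (simp add: pcompose_power poly_power)
  then show "fps_nth (chi_exp 1 (pcompose g [:6, 1:])) j
     = fps_nth (qpow (poly g 1) - qpow (poly g 5) - chi_exp 1 g) j"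
    by (simp add: chi_exp_def qpow_nth power_minus[of "poly g _"] right_diff_distrib diff_divide_distrib)
qed

lemma chi_exp_line_nth:
  "fps_nth (chi_exp 1 (smult a r + g)) j
     = (\<Sum>i\<le>j. (-1) ^ j / fact j * real (j choose i) * chi_sum (r ^ i * g ^ (j - i)) * a ^ i)"
proof -
  have "chi_sum ((smult a r + g) ^ j) = chi_sum (\<Sum>i\<le>j. smult (real (j choose i) * a ^ i) (r ^ i * g ^ (j - i)))"
    by (intro arg_cong[of _ _ chi_sum])
       (simp add: binomial_ring sum_distrib_left smult_power mult_ac of_nat_poly)
  then show ?thesis
    by (simp add: chi_exp_def chi_sum_sum chi_sum_smult sum_distrib_left mult_ac flip: sum_divide_distrib)
qed

lemma pol_fps_chi_exp: "pol_fps (\<lambda>a. chi_exp 1 (smult a r + g))"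
  unfolding pol_fps_def chi_exp_line_nth
  by (intro allI polyfun_sum) (metis poly_monom)

text \<open>For n prime to 6, (n^2 - 1)/24 runs through the generalised pentagonal numbers. With x =
  q^a, the combination a (n - 1)/2 + (n^2 - 1)/24 is the exponent of x^((n-1)/2)
  q^((n^2-1)/24).\<close>

abbreviation lin_part :: "real poly" where "lin_part \<equiv> [:- 1 / 2, 1 / 2:]"
abbreviation pent :: "real poly" where "pent \<equiv> [:- 1 / 24, 0, 1 / 24:]"

text \<open>Both sides solve the recurrence of \<open>qsum_rec\<close>: at n = 1 and n = 5, the two
  terms lost in the shift by 6, the exponent is 0 and 2a + 1, which produces 1 - q^(2a+1).
  Uniqueness does the rest.\<close>

lemma qsum_eq_chi_exp: "(1 - qpow a) * qsum a = chi_exp 1 (smult a lin_part + pent)"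
proof -
  define d where "d = (\<lambda>a. (1 - qpow a) * qsum a - chi_exp 1 (smult a lin_part + pent))"
  have "pol_fps d"
    unfolding d_def
    using pol_fps_qpow[of 1 0] by (intro pol_fps_diff pol_fps_mult pol_fps_const pol_fps_chi_exp pol_fps_qsum) simp
  moreover have "d a = - (qpow (3 * a + 2) * d (a + 1))" for a
  proof -
    \<comment> \<open>Replacing n by n + 6 adds 3 to (n - 1)/2 and n/2 + 3/2 to (n^2 - 1)/24. The
      n/2 is absorbed into a + 1 at the price of 1/2, which leaves 3a + 2.\<close>
    have "pcompose (smult a lin_part + pent) [:6, 1:] = (smult (a + 1) lin_part + pent) + [:3 * a + 2:]"
      by (simp add: pcompose_pCons field_simps)
    with chi_exp_shift[of "smult a lin_part + pent"] chi_exp_add_const[of 1 "smult (a + 1) lin_part + pent" "3 * a + 2"]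
    have "qpow (3 * a + 2) * chi_exp 1 (smult (a + 1) lin_part + pent)
       = 1 - qpow (2 * a + 1) - chi_exp 1 (smult a lin_part + pent)"
      (is "?lhs = ?rhs") by (simp only: poly_add) (simp add: eq_diff_eq)
    have "d a = ?rhs - qpow (3 * a + 2) * ((1 - qpow (a + 1)) * qsum (a + 1))"
      by (simp only: d_def qsum_rec[of a] diff_diff_eq add_ac)
    also have "\<dots> = - (qpow (3 * a + 2) * d (a + 1))"
      by (simp only: d_def right_diff_distrib \<open>?lhs = ?rhs\<close> minus_diff_eq)
    finally show ?thesis .
  qed
  ultimately have "d a = 0" by (rule pol_fps_unique)
  then show ?thesis by (simp add: d_def)
qed

text \<open>
  Differentiating \<open>qsum_eq_chi_exp\<close> in \<open>a\<close> at \<open>0\<close> removes the factor \<open>1 - q\<^sup>a\<close>.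
\<close>

lemma qsum_0_nth: "fps_nth (qsum 0) j = - fps_nth (chi_exp lin_part pent) j"
proof -
  \<comment> \<open>The index is j + 1 because 1 - q^a = aX - ... has derivative X at a = 0: only i
    = 1 survives, and coefficient j of \<open>qsum 0\<close> moves up by one.\<close>
  define f where "f = (\<lambda>a. fps_nth ((1 - qpow a) * qsum a) (Suc j))"
  have "((\<lambda>a. fps_nth (1 - qpow a) i * fps_nth (qsum a) (Suc j - i)) has_real_derivative
      (if i = 1 then fps_nth (qsum 0) j else 0)) (at 0)" for i
  proof -
    obtain p where p: "\<And>a. fps_nth (qsum a) (Suc j - i) = poly p a"
      using pol_fps_qsum unfolding pol_fps_def by metis
    have "(\<lambda>a. fps_nth (1 - qpow a) i) = (\<lambda>a. if i = 0 then 0 else - ((- a) ^ i / fact i))"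
      by (auto simp: qpow_nth)
    then have "((\<lambda>a. fps_nth (1 - qpow a) i) has_real_derivative (if i = 1 then 1 else 0)) (at 0)"
      by (cases "i = 0") (auto intro!: derivative_eq_intros)
    from DERIV_mult[OF this poly_DERIV[of p]] show ?thesis
      unfolding p[symmetric] by (cases "i = 1") (simp_all add: qpow_nth)
  qed
  then have "(f has_real_derivative (\<Sum>i=0..Suc j. if i = 1 then fps_nth (qsum 0) j else 0)) (at 0)"
    unfolding f_def fps_mult_nth by (intro DERIV_sum)
  then have D1: "(f has_real_derivative fps_nth (qsum 0) j) (at 0)"
    by (simp del: sum.cl_ivl_Suc)
  define c where "c = (\<lambda>i. (-1) ^ Suc j / fact (Suc j) * real (Suc j choose i) * chi_sum (lin_part ^ i * pent ^ (Suc j - i)))"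
  have "((\<lambda>a. c i * a ^ i) has_real_derivative (if i = 1 then c 1 else 0)) (at 0)" for i
    by (auto intro!: derivative_eq_intros)
  then have "((\<lambda>a. \<Sum>i\<le>Suc j. c i * a ^ i) has_real_derivative (\<Sum>i\<le>Suc j. if i = 1 then c 1 else 0)) (at 0)"
    by (intro DERIV_sum)
  moreover have "(\<lambda>a. \<Sum>i\<le>Suc j. c i * a ^ i) = f"
    unfolding f_def qsum_eq_chi_exp chi_exp_line_nth c_def by simp
  ultimately have "(f has_real_derivative c 1) (at 0)"
    by (simp del: sum.atMost_Suc)
  with D1 have "fps_nth (qsum 0) j = c 1"
    by (rule DERIV_unique)
  then show ?thesis
    by (simp add: c_def chi_exp_def)
qed

text \<open>The series is - sinh(2X)/cosh(3X), an odd function: replacing X by -X and clearing with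
  e^(6X) reverses its sign. Thus the regularised sums of \<chi>(n) n^k vanish for even k.\<close>

lemma chi_egf_nth_even:
  assumes "even k"
  shows "fps_nth chi_egf k = 0"
proof -
  define N where "N = fps_const (-1 :: real) * fps_X"
  have "(1 + fps_exp 6) * chi_egf = fps_exp 1 - fps_exp 5"
    using chi_egf_eq by (simp add: algebra_simps)
  then have "((1 + fps_exp 6) * chi_egf) oo N = (fps_exp 1 - fps_exp 5) oo N" by simp
  then have "(1 + fps_exp (-6)) * (chi_egf oo N) = fps_exp (-1) - fps_exp (-5)"
    by (simp add: fps_compose_mult_distrib fps_compose_add_distrib fps_compose_sub_distrib N_def del: fps_const_minus fps_const_neg)
  then have "fps_exp 6 * ((1 + fps_exp (-6)) * (chi_egf oo N)) = fps_exp 6 * (fps_exp (-1) - fps_exp (-5))"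
    by simp
  then have "(1 + fps_exp 6) * (chi_egf oo N) = fps_exp 5 - fps_exp 1"
    by (simp add: algebra_simps flip: fps_exp_add_mult mult.assoc)
  then have "(1 + fps_exp 6) * ((chi_egf oo N) + chi_egf) = 0"
    by (simp add: distrib_left distrib_right chi_egf_eq)
  moreover have "fps_nth (1 + fps_exp 6 :: real fps) 0 \<noteq> fps_nth 0 0" by simp
  then have "(1 + fps_exp 6 :: real fps) \<noteq> 0" by metis
  ultimately have "chi_egf oo N = - chi_egf"
    by (simp add: eq_neg_iff_add_eq_0)
  then have "(-1) ^ k * fps_nth chi_egf k = - fps_nth chi_egf k"
    by (simp only: N_def fps_compose_linear fps_eq_iff fps_nth_Abs_fps fps_neg_nth)
  with assms show ?thesis by simp
qed

text \<open>The coefficients are T_j/(24^j j!) with Glaisher's numbers T_j = 1, 23, 1681, ..., where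
  sin(2x)/(2 cos(3x)) is the sum of T_j x^(2j+1)/(2j+1)!.\<close>

definition glaisher_fps :: "real fps" where
  "glaisher_fps = Abs_fps (\<lambda>j. - ((- 1 / 24) ^ j * fact (2 * j + 1) / (2 * fact j)) * fps_nth chi_egf (2 * j + 1))"

text \<open>The constant -1/24 of the exponent leaves as e^(X/24). Of the weight (n - 1)/2 only n/2
  contributes, because the regularised sums of even powers vanish.\<close>

lemma qsum_0_eq: "qsum 0 = fps_exp (1 / 24) * glaisher_fps"
proof -
  define u where "u = monom (1 / 24 :: real) 2"
  have "qsum 0 = - chi_exp lin_part (u + [:- 1 / 24:])"
    by (simp add: fps_eq_iff qsum_0_nth u_def monom_altdef numeral_2_eq_2)
  also have "\<dots> = fps_exp (1 / 24) * (- chi_exp lin_part u)"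
    unfolding chi_exp_add_const by (simp add: qpow_def)
  also have "- chi_exp lin_part u = glaisher_fps"
  proof (rule fps_ext)
    fix j
    have lin: "lin_part = monom (1 / 2) 1 + monom (- 1 / 2) 0"
      by (simp add: monom_altdef)
    have "lin_part * u ^ j = monom ((1 / 24) ^ j / 2) (2 * j + 1) + monom (- ((1 / 24) ^ j / 2)) (2 * j)"
      unfolding lin u_def monom_power distrib_right mult_monom by (simp add: add.commute mult.commute)
    then have "chi_sum (lin_part * u ^ j) = (1 / 24) ^ j / 2 * fact (2 * j + 1) * fps_nth chi_egf (2 * j + 1)"
      using chi_egf_nth_even[of "2 * j"] by (simp only: chi_sum_add chi_sum_monom) simp
    then show "fps_nth (- chi_exp lin_part u) j = fps_nth glaisher_fps j"
      by (simp only: chi_exp_def glaisher_fps_def fps_nth_Abs_fps fps_neg_nth)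
        (simp add: power_divide power_minus[of "1 / 24"] mult_ac)
  qed
  finally show ?thesis .
qed

section \<open>The substitution q = 1/L\<close>

lemma fishburn_gf_nth:
  assumes "fps_nth L 0 = 1"
  shows "fps_nth (fishburn_gf L) N = (\<Sum>k\<le>N. fps_nth (\<Prod>j=1..k. (1 - inverse (L ^ j))) N)"
proof -
  let ?P = "\<lambda>k. \<Prod>j=1..k. (1 - inverse (L ^ j))"
  have "(\<lambda>M. \<Sum>k<M. ?P k) \<longlonglongrightarrow> fishburn_gf L"
    using fishburn_gf_sums[OF assms] by (simp add: sums_def)
  then have "\<forall>\<^sub>F M in sequentially. fps_nth (\<Sum>k<M. ?P k) N = fps_nth (fishburn_gf L) N"
    by (simp add: tendsto_fps_iff)
  then have "\<forall>\<^sub>F M in sequentially. fps_nth (\<Sum>k<M. ?P k) N = fps_nth (fishburn_gf L) N \<and> M > N"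
    using eventually_gt_at_top eventually_conj by blast
  then obtain M where M: "fps_nth (\<Sum>k<M. ?P k) N = fps_nth (fishburn_gf L) N" "M > N"
    by (auto dest!: eventually_happens)
  have "fps_nth (\<Sum>k<M. ?P k) N = (\<Sum>k\<le>N. fps_nth (?P k) N)"
    unfolding fps_sum_nth using M(2) fishburn_summand_nth_eq_0[OF assms, of N]
    by (intro sum.mono_neutral_right) (auto simp: not_le)
  with M show ?thesis by simp
qed

lemma fps_exp_compose_ln:
  fixes L :: "real fps"
  assumes "fps_nth L 0 = 1"
  shows "fps_exp 1 oo (fps_ln 1 oo (L - 1)) = L"
proof -
  have "(fps_exp 1 - 1) oo fps_ln 1 = (fps_X :: real fps)"
    unfolding fps_ln_fps_exp_inv[of 1, simplified] by (rule fps_inv_right) auto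
  then have "fps_exp 1 oo fps_ln 1 = 1 + (fps_X :: real fps)"
    by (simp add: fps_compose_sub_distrib algebra_simps)
  moreover have "fps_exp 1 oo (fps_ln 1 oo (L - 1)) = (fps_exp 1 oo fps_ln 1) oo (L - 1)"
    using assms by (intro fps_compose_assoc) auto
  ultimately show ?thesis
    using assms by (simp add: fps_compose_add_distrib)
qed

text \<open>Inserting w for X turns q^i into L^(-i) and the term of \<open>qsum\<close> at a = 0
  into the Fishburn summand. The first N + 1 terms determine coefficient N on both sides.\<close>

lemma fishburn_gf_exp:
  fixes w :: "real fps"
  assumes "fps_nth w 0 = 0"
  shows "fishburn_gf (fps_exp 1 oo w) = (fps_exp (1 / 24) oo w) * (glaisher_fps oo w)"
proof -
  have E: "fps_exp (- real i) oo w = inverse ((fps_exp 1 oo w) ^ i)" for i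
  proof -
    have "fps_exp (- real i) oo w = inverse (fps_exp 1 ^ i) oo w"
      by (simp add: fps_exp_neg fps_exp_power_mult)
    also have "\<dots> = inverse ((fps_exp 1 oo w) ^ i)"
      using assms by (simp add: fps_inverse_compose fps_compose_power fps_nth_power_0)
    finally show ?thesis .
  qed
  have P: "qterm 0 n oo w = (\<Prod>i=1..n. 1 - inverse ((fps_exp 1 oo w) ^ i))" for n
    using assms by (simp add: qterm_def fps_compose_prod_distrib fps_compose_sub_distrib qpow_def E)
  have "fishburn_gf (fps_exp 1 oo w) = qsum 0 oo w"
  proof (rule fps_ext)
    fix N
    have "fps_nth (qsum 0 oo w) N = (\<Sum>i=0..N. (\<Sum>n\<le>N. fps_nth (qterm 0 n) i) * fps_nth (w ^ i) N)"
      unfolding fps_compose_nth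
    proof (rule sum.cong[OF refl], goal_cases)
      case (1 i)
      then show ?case using qsum_nth[of i "Suc N" 0] by (simp add: fps_sum_nth lessThan_Suc_atMost)
    qed
    also have "\<dots> = (\<Sum>n\<le>N. fps_nth (qterm 0 n oo w) N)"
      unfolding fps_compose_nth sum_distrib_right by (rule sum.swap)
    also have "\<dots> = fps_nth (fishburn_gf (fps_exp 1 oo w)) N"
      unfolding P by (rule fishburn_gf_nth[symmetric]) simp
    finally show "fps_nth (fishburn_gf (fps_exp 1 oo w)) N = fps_nth (qsum 0 oo w) N" by simp
  qed
  then show ?thesis
    using assms by (simp add: qsum_0_eq fps_compose_mult_distrib)
qed

section \<open>Poles of the generating function of the character modulo 12\<close>

definition cfps :: "real fps \<Rightarrow> complex fps" where
  "cfps f = Abs_fps (\<lambda>n. of_real (fps_nth f n))"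

lemma cfps_nth [simp]: "fps_nth (cfps f) n = of_real (fps_nth f n)"
  by (simp add: cfps_def)

lemma cfps_mult: "cfps (f * g) = cfps f * cfps g"
  by (simp add: fps_eq_iff fps_mult_nth)

lemma exp_pi_sixth: "exp (\<i> * of_real (pi / 6)) = Complex (sqrt 3 / 2) (1 / 2)"
proof -
  have "exp (\<i> * of_real (pi / 6)) = cis (pi / 6)" by (simp add: cis_conv_exp)
  then show ?thesis by (simp add: complex_eq_iff cos_30 sin_30)
qed

lemma exp_minus_pi_sixth: "exp (- (\<i> * of_real (pi / 6))) = Complex (sqrt 3 / 2) (- 1 / 2)"
proof -
  have "exp (- (\<i> * of_real (pi / 6))) = cis (- (pi / 6))" by (simp add: cis_conv_exp)
  then show ?thesis by (simp add: complex_eq_iff cos_30 sin_30)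
qed

text \<open>The zeros are the odd multiples of i pi/6. The radius 3/2 is below the next modulus
  pi/2, because pi > 3, and above 1, which later makes coefficients bounded.\<close>

lemma one_plus_exp_6_eq_0:
  fixes z :: complex
  assumes "1 + exp (6 * z) = 0" "norm z < 3 / 2"
  shows "z = \<i> * of_real (pi / 6) \<or> z = - (\<i> * of_real (pi / 6))"
proof -
  have "exp (6 * z) = exp (\<i> * of_real pi)"
    using assms(1) by (simp add: add_eq_0_iff)
  then obtain n :: int where n: "6 * z = \<i> * of_real pi + of_int (2 * n) * of_real pi * \<i>"
    unfolding exp_eq by auto
  have "z = \<i> * of_real ((2 * of_int n + 1) * pi / 6)"
  proof -
    have "z = (6 * z) / 6" by simp
    then show ?thesis unfolding n by (simp add: algebra_simps add_divide_distrib)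
  qed
  then have "norm z = \<bar>(2 * of_int n + 1) * pi / 6\<bar>"
    by (simp only: norm_mult norm_ii norm_of_real mult_1)
  then have "\<bar>2 * of_int n + 1\<bar> * pi < (9 :: real)"
    using assms(2) by (simp add: abs_mult)
  moreover have "3 * pi > 9" using pi_gt3 by simp
  ultimately have "\<bar>2 * of_int n + 1\<bar> * pi < 3 * pi" by linarith
  then have "\<bar>2 * of_int n + 1\<bar> < (3 :: real)" using pi_gt_zero by (simp only: mult_less_cancel_right_pos)
  then have "n = 0 \<or> n = -1" by linarith
  then have "(2 * of_int n + 1) * pi / 6 = pi / 6 \<or> (2 * of_int n + 1) * pi / 6 = - (pi / 6)"
    by auto
  then show ?thesis
    using \<open>z = \<i> * of_real ((2 * of_int n + 1) * pi / 6)\<close> by (metis mult_minus_right of_real_minus)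
qed

text \<open>Multiplication by z^2 + c^2 cancels the simple poles at ic and -ic, so h extends
  holomorphically to |z| < 3/2. Summability at z = 1 bounds its coefficients. The second claim is
  the value at p = ic divided by p, the even coefficients being 0.\<close>

lemma chi_egf_pole_part:
  defines "c \<equiv> pi / 6"
  defines "h \<equiv> chi_egf * (fps_X ^ 2 + fps_const (c ^ 2))"
  shows "\<exists>C. \<forall>k. \<bar>fps_nth h k\<bar> \<le> C"
    and "(\<lambda>i. (-1) ^ i * fps_nth h (2 * i + 1) * c ^ (2 * i)) sums (- (sqrt 3 / 3))"
proof -
  define p where "p = \<i> * of_real c"
  define N where "N = (\<lambda>z::complex. exp z - exp (5 * z))"
  define D where "D = (\<lambda>z::complex. 1 + exp (6 * z))"
  \<comment> \<open>The zeros p and -p of D are divided out one after the other; at each of them the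
    quotient is completed by a derivative and stays holomorphic. Then D = D2 (z^2 + c^2), and D2
    turns out to have no zero in the disc.\<close>
  define D1 where "D1 = (\<lambda>z. if z = p then deriv D p else (D z - D p) / (z - p))"
  define D2 where "D2 = (\<lambda>z. if z = - p then deriv D1 (- p) else (D1 z - D1 (- p)) / (z - (- p)))"
  define B where "B = ball (0 :: complex) (3 / 2)"
  have p0: "p \<noteq> 0" "- p \<noteq> p" by (auto simp: p_def c_def complex_eq_iff)
  have pB: "p \<in> B" "- p \<in> B" using pi_less_4 by (auto simp: p_def B_def c_def norm_mult)
  have e6: "exp (6 * p) = -1" "exp (6 * (- p)) = -1"
    by (simp_all add: p_def c_def exp_minus)
  have Dp: "D p = 0" "D (- p) = 0" using e6 by (simp_all add: D_def)
  have derD: "(D has_field_derivative 6 * exp (6 * z)) (at z)" for z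
    unfolding D_def by (auto intro!: derivative_eq_intros)
  have holD: "D holomorphic_on B" unfolding D_def by (intro holomorphic_intros)
  have holD1: "D1 holomorphic_on B"
    unfolding D1_def by (rule pole_lemma_open[OF holD]) (simp add: B_def)
  have holD2: "D2 holomorphic_on B"
    unfolding D2_def by (rule pole_lemma_open[OF holD1]) (simp add: B_def)
  have derDp: "deriv D p = - 6" using DERIV_imp_deriv[OF derD[of p]] e6 by simp
  have D1m: "D1 (- p) = 0" using p0 by (simp add: D1_def Dp)
  have D12: "D1 z = D2 z * (z + p)" for z
  proof (cases "z = - p")
    case False
    then have "z + p \<noteq> 0" by (simp add: eq_neg_iff_add_eq_0)
    then show ?thesis by (simp add: D2_def False D1m)
  qed (simp add: D1m)
  have DD1: "D z = D1 z * (z - p)" for z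
    by (simp add: D1_def Dp)
  have fact: "D z = D2 z * (z\<^sup>2 + of_real (c\<^sup>2))" for z
    unfolding DD1[of z] D12[of z] by (simp add: p_def algebra_simps power2_eq_square)
  have D2p: "D2 p = - 3 / p"
  proof -
    have "D2 p * (p + p) = - 6" using D12[of p] derDp by (simp add: D1_def)
    then have "D2 p * p = -3" by (simp add: algebra_simps)
    then show ?thesis using p0 by (simp add: field_simps)
  qed
  \<comment> \<open>A zero of D2 at -p would be a double zero of D, but D'(-p) = -6.\<close>
  have D2m: "D2 (- p) \<noteq> 0"
  proof
    assume "D2 (- p) = 0"
    then have "deriv D1 (- p) = 0" by (simp add: D2_def)
    moreover have "(D1 has_field_derivative deriv D1 (- p)) (at (- p))"
      using holD1 pB holomorphic_derivI by (metis B_def open_ball)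
    ultimately have "((\<lambda>z. D1 z * (z - p)) has_field_derivative 0 * (- p - p) + 1 * D1 (- p)) (at (- p))"
      by (intro DERIV_mult) (auto intro!: derivative_eq_intros)
    moreover have "(\<lambda>z. D1 z * (z - p)) = D" by (rule ext) (simp only: DD1)
    ultimately have "(D has_field_derivative 0) (at (- p))"
      using D1m by (simp only:) simp
    with derD[of "- p"] have "6 * exp (6 * (- p)) = 0" by (rule DERIV_unique)
    then show False by simp
  qed
  have D2_nz: "D2 z \<noteq> 0" if "z \<in> B" for z
  proof
    assume "D2 z = 0"
    then have "D z = 0" by (simp add: fact)
    then have "z = p \<or> z = - p"
      using one_plus_exp_6_eq_0[of z] that by (auto simp: D_def B_def p_def c_def)
    with D2p D2m p0 \<open>D2 z = 0\<close> show False by auto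
  qed
  define H where "H = (\<lambda>z. N z / D2 z)"
  have holH: "H holomorphic_on eball 0 (ereal (3 / 2))"
    unfolding H_def N_def eball_ereal B_def[symmetric]
    by (intro holomorphic_intros holD2) (use D2_nz in auto)
  define Hf where "Hf = fps_expansion H 0"
  have rad: "fps_conv_radius Hf \<ge> ereal (3 / 2)"
    unfolding Hf_def by (rule conv_radius_fps_expansion[OF holH])
  have Hexp: "H has_fps_expansion Hf"
    unfolding has_fps_expansion_def
  proof
    show "0 < fps_conv_radius Hf" using rad by (rule less_le_trans[rotated]) simp
    have "eventually (\<lambda>z. z \<in> B) (nhds 0)"
      by (intro eventually_nhds_in_open) (auto simp: B_def)
    then show "\<forall>\<^sub>F z in nhds 0. eval_fps Hf z = H z"
      by eventually_elim (simp add: Hf_def B_def eval_fps_expansion'[OF holH])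
  qed
  have e1: "(\<lambda>z. N z * (z ^ 2 + of_real (c ^ 2))) has_fps_expansion
      (fps_exp 1 - fps_exp 5) * (fps_X ^ 2 + fps_const (of_real (c ^ 2)))"
    unfolding N_def by (intro fps_expansion_intros)
  have e2: "(\<lambda>z. H z * D z) has_fps_expansion Hf * (1 + fps_exp 6)"
    unfolding D_def by (intro fps_expansion_intros Hexp)
  have e3: "eventually (\<lambda>z. H z * D z = N z * (z ^ 2 + of_real (c ^ 2))) (nhds 0)"
  proof -
    have "eventually (\<lambda>z. z \<in> B) (nhds 0)"
      by (intro eventually_nhds_in_open) (auto simp: B_def)
    then show ?thesis
      by eventually_elim (use D2_nz fact in \<open>simp add: H_def\<close>)
  qed
  have eq: "Hf * (1 + fps_exp 6) = (fps_exp 1 - fps_exp 5) * (fps_X ^ 2 + fps_const (of_real (c ^ 2)))"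
    by (rule fps_expansion_unique_complex[OF e2 has_fps_expansion_cong[OF e3 refl, THEN iffD2, OF e1]])
  have ce: "cfps (1 + fps_exp 6) = 1 + fps_exp 6" "cfps (fps_exp 1 - fps_exp 5) = fps_exp 1 - fps_exp 5"
    "cfps (fps_X ^ 2 + fps_const (c ^ 2)) = fps_X ^ 2 + fps_const (of_real (c ^ 2))"
    by (auto simp: fps_eq_iff fps_X_power_nth)
  have "chi_egf * (1 + fps_exp 6) = fps_exp 1 - fps_exp 5"
    using chi_egf_eq by (simp add: algebra_simps)
  moreover have "cfps h * (1 + fps_exp 6) = cfps (chi_egf * (1 + fps_exp 6)) * cfps (fps_X ^ 2 + fps_const (c ^ 2))"
    by (simp only: h_def ce(1)[symmetric] cfps_mult mult_ac)
  ultimately have "cfps h * (1 + fps_exp 6) = Hf * (1 + fps_exp 6)"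
    by (simp only: eq ce)
  moreover have "fps_nth (1 + fps_exp 6 :: complex fps) 0 \<noteq> fps_nth 0 0" by simp
  then have "(1 + fps_exp 6 :: complex fps) \<noteq> 0" by metis
  ultimately have Hfh: "Hf = cfps h" by simp
  have "summable (\<lambda>k. fps_nth Hf k * 1 ^ k)"
    by (rule summable_fps) (use rad in \<open>auto intro: less_le_trans[rotated]\<close>)
  then have "summable (\<lambda>k. complex_of_real (fps_nth h k))" by (simp add: Hfh)
  then have "bounded (range (\<lambda>k. complex_of_real (fps_nth h k)))"
    by (intro convergent_imp_bounded) (use summable_LIMSEQ_zero convergentI in blast)
  then show "\<exists>C. \<forall>k. \<bar>fps_nth h k\<bar> \<le> C"
    by (auto simp: bounded_iff)
  have pn: "norm p < 3 / 2" using pB by (simp add: B_def)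
  have "(\<lambda>k. fps_nth Hf k * p ^ k) sums eval_fps Hf p"
    by (rule sums_eval_fps) (use rad pn in \<open>auto intro: less_le_trans[rotated]\<close>)
  also have "eval_fps Hf p = H p"
    unfolding Hf_def using eval_fps_expansion'[OF holH, of p] pn by simp
  \<comment> \<open>N(p) = 2 cos(pi/6) = sqrt 3, because e^(5p) = - e^(-p), and D2(p) = D'(p)/(2p) =
    -3/p.\<close>
  also have "H p = - (sqrt 3 / 3) * p"
  proof -
    have "exp (5 * p) = exp (6 * p) * exp (- p)" by (simp flip: exp_add)
    then have "N p = exp p + exp (- p)" by (simp only: N_def e6) simp
    also have "\<dots> = of_real (sqrt 3)"
      unfolding p_def c_def exp_pi_sixth exp_minus_pi_sixth by (simp add: complex_eq_iff)
    finally show ?thesis by (simp add: H_def D2p)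
  qed
  finally have "(\<lambda>k. fps_nth Hf k * p ^ k) sums (- (sqrt 3 / 3) * p)" .
  moreover have "fps_nth Hf k * p ^ k = 0" if "k \<notin> range (\<lambda>i. 2 * i + 1)" for k
  proof -
    have "even k"
      using that by (metis oddE rangeI)
    then have "fps_nth h k = 0"
      by (simp add: h_def distrib_left fps_X_power_mult_right_nth chi_egf_nth_even)
    then show ?thesis by (simp add: Hfh)
  qed
  ultimately have "(\<lambda>i. fps_nth Hf (2 * i + 1) * p ^ (2 * i + 1)) sums (- (sqrt 3 / 3) * p)"
    by (subst sums_mono_reindex[of "\<lambda>i. 2 * i + 1"]) (auto simp: strict_mono_def)
  then have "(\<lambda>i. (fps_nth Hf (2 * i + 1) * p ^ (2 * i + 1)) / p) sums (- (sqrt 3 / 3) * p / p)"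
    by (rule sums_divide)
  moreover have "(fps_nth Hf (2 * i + 1) * p ^ (2 * i + 1)) / p
       = of_real ((-1) ^ i * fps_nth h (2 * i + 1) * c ^ (2 * i))" for i
  proof -
    have "p ^ 2 = of_real (- (c ^ 2))" by (simp add: p_def power_mult_distrib)
    then have "p ^ (2 * i) = of_real ((- (c ^ 2)) ^ i)" by (simp only: power_mult of_real_power)
    also have "(- (c ^ 2)) ^ i = (-1) ^ i * c ^ (2 * i)"
      by (subst power_minus) (simp add: power_mult)
    finally show ?thesis using p0 by (simp add: Hfh)
  qed
  ultimately have "(\<lambda>i. complex_of_real ((-1) ^ i * fps_nth h (2 * i + 1) * c ^ (2 * i))) sums (of_real (- (sqrt 3 / 3)))"
    using p0 by simp
  then show "(\<lambda>i. (-1) ^ i * fps_nth h (2 * i + 1) * c ^ (2 * i)) sums (- (sqrt 3 / 3))"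
    by (simp only: sums_of_real_iff)
qed

text \<open>Dividing h by X^2 + c^2 turns the coefficients, scaled by c^(2j+2), into partial sums of
  the series in \<open>chi_egf_pole_part\<close>, up to sign. Its value is the contribution of the
  two nearest poles; its tail is O(c^(2j+2)), which becomes O(1) once the scaling is undone.\<close>

lemma chi_egf_asymp:
  "\<exists>C. \<forall>j. \<bar>(-1) ^ (j + 1) * fps_nth chi_egf (2 * j + 1) - sqrt 3 / 3 * (6 / pi) ^ (2 * j + 2)\<bar> \<le> C"
proof -
  define c where "c = pi / 6"
  define h where "h = chi_egf * (fps_X ^ 2 + fps_const (c ^ 2))"
  obtain C where C: "\<And>k. \<bar>fps_nth h k\<bar> \<le> C"
    using chi_egf_pole_part(1) unfolding h_def c_def by blast
  define g where "g = (\<lambda>i. (-1) ^ (i + 1) * fps_nth h (2 * i + 1) * c ^ (2 * i))"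
  have g: "g sums (sqrt 3 / 3)"
    using sums_minus[OF chi_egf_pole_part(2)] unfolding g_def h_def c_def by simp
  have c: "0 < c" "c \<le> 2 / 3" using pi_less_4 by (auto simp: c_def)
  then have c2: "c\<^sup>2 < 1" by (simp add: abs_square_less_1)
  define t where "t = (\<lambda>j. (-1) ^ (j + 1) * fps_nth chi_egf (2 * j + 1))"
  have tg: "t j * c ^ (2 * j + 2) = (\<Sum>i\<le>j. g i)" for j
  proof (induction j)
    case 0
    have "fps_nth h 1 = c ^ 2 * fps_nth chi_egf 1"
      by (simp add: h_def distrib_left fps_X_power_mult_right_nth)
    then show ?case by (simp add: t_def g_def power2_eq_square)
  next
    case (Suc j)
    have "fps_nth h (2 * Suc j + 1) = c ^ 2 * fps_nth chi_egf (2 * Suc j + 1) + fps_nth chi_egf (2 * j + 1)"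
      by (simp add: h_def distrib_left fps_X_power_mult_right_nth)
    then have "t (Suc j) * c ^ (2 * Suc j + 2) = t j * c ^ (2 * j + 2) + g (Suc j)"
      by (simp add: t_def g_def algebra_simps power2_eq_square)
    with Suc show ?case by simp
  qed
  have gb: "\<bar>g i\<bar> \<le> C * (c\<^sup>2) ^ i" for i
    using C[of "2 * i + 1"] c by (simp add: g_def abs_mult power_mult mult_right_mono)
  have "\<bar>t j - sqrt 3 / 3 * (6 / pi) ^ (2 * j + 2)\<bar> \<le> C / (1 - c\<^sup>2)" for j
  proof -
    have geo: "(\<lambda>i. C * (c\<^sup>2) ^ (i + Suc j)) sums (C * (c\<^sup>2) ^ Suc j * (1 / (1 - c\<^sup>2)))"
      using sums_mult[OF geometric_sums[of "c\<^sup>2"], of "C * (c\<^sup>2) ^ Suc j"] c2 c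
      by (simp add: power_add mult_ac)
    have tail: "(\<lambda>i. g (i + Suc j)) sums (sqrt 3 / 3 - (\<Sum>i\<le>j. g i))"
      using sums_split_initial_segment[OF g, of "Suc j"] by (simp add: lessThan_Suc_atMost)
    have "\<bar>sqrt 3 / 3 - (\<Sum>i\<le>j. g i)\<bar> \<le> C * (c\<^sup>2) ^ Suc j * (1 / (1 - c\<^sup>2))"
    proof -
      have "norm (\<Sum>i. g (i + Suc j)) \<le> (\<Sum>i. C * (c\<^sup>2) ^ (i + Suc j))"
        using gb[of "_ + Suc j"] geo by (intro norm_suminf_le) (simp_all only: real_norm_def sums_iff)
      then show ?thesis using tail geo by (simp add: sums_iff)
    qed
    then have "\<bar>t j * c ^ (2 * j + 2) - sqrt 3 / 3\<bar> \<le> (C / (1 - c\<^sup>2)) * c ^ (2 * j + 2)"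
    proof -
      assume *: "\<bar>sqrt 3 / 3 - (\<Sum>i\<le>j. g i)\<bar> \<le> C * (c\<^sup>2) ^ Suc j * (1 / (1 - c\<^sup>2))"
      have "(c\<^sup>2) ^ Suc j = c ^ (2 * j + 2)" unfolding power_mult[symmetric] by simp
      with * show ?thesis unfolding tg by (simp only: abs_minus_commute) (simp add: mult_ac)
    qed
    moreover have "t j * c ^ (2 * j + 2) - sqrt 3 / 3 = (t j - sqrt 3 / 3 * (6 / pi) ^ (2 * j + 2)) * c ^ (2 * j + 2)"
    proof -
      have "(6 / pi) ^ (2 * j + 2) * c ^ (2 * j + 2) = 1"
        by (simp add: c_def flip: power_mult_distrib)
      then show ?thesis by (simp only: left_diff_distrib mult.assoc mult_1_right)
    qed
    moreover have "c ^ (2 * j + 2) > 0" using c by simp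
    ultimately show ?thesis
      by (simp only: abs_mult abs_of_pos mult_le_cancel_right_pos)
  qed
  then show ?thesis unfolding t_def by blast
qed

section \<open>Weighted coefficient norms of power series\<close>

text \<open>An upper bound for the weighted norm, the sum of |f_i| r^i, stated through partial sums
  so that no convergence has to be supposed. These norms are submultiplicative, so algebraic
  identities of series carry analytic bounds along.\<close>

definition fps_l1 :: "real \<Rightarrow> real fps \<Rightarrow> real \<Rightarrow> bool" where
  "fps_l1 r f M \<longleftrightarrow> (\<forall>n. (\<Sum>i\<le>n. \<bar>fps_nth f i\<bar> * r ^ i) \<le> M)"

lemma fps_l1_nonneg: "fps_l1 r f M \<Longrightarrow> 0 \<le> M"
  unfolding fps_l1_def by (drule spec[of _ 0]) auto

lemma fps_l1_mono: "fps_l1 r f M \<Longrightarrow> M \<le> M' \<Longrightarrow> fps_l1 r f M'"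
  unfolding fps_l1_def by (meson order_trans)

lemma fps_l1_nth:
  assumes "fps_l1 r f M" "0 < r"
  shows "\<bar>fps_nth f n\<bar> \<le> M / r ^ n"
proof -
  have "\<bar>fps_nth f n\<bar> * r ^ n \<le> (\<Sum>i\<le>n. \<bar>fps_nth f i\<bar> * r ^ i)"
    using assms(2) by (intro member_le_sum) auto
  also have "\<dots> \<le> M" using assms(1) by (simp add: fps_l1_def)
  finally show ?thesis using assms(2) by (simp add: field_simps)
qed

lemma fps_l1_add:
  assumes "fps_l1 r f M" "fps_l1 r g M'" "0 \<le> r"
  shows "fps_l1 r (f + g) (M + M')"
  unfolding fps_l1_def
proof
  fix n
  have "(\<Sum>i\<le>n. \<bar>fps_nth (f + g) i\<bar> * r ^ i) \<le> (\<Sum>i\<le>n. \<bar>fps_nth f i\<bar> * r ^ i + \<bar>fps_nth g i\<bar> * r ^ i)"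
    unfolding distrib_right[symmetric] using assms(3) by (intro sum_mono mult_right_mono) auto
  also have "\<dots> \<le> M + M'"
    using assms unfolding fps_l1_def sum.distrib by (intro add_mono) auto
  finally show "(\<Sum>i\<le>n. \<bar>fps_nth (f + g) i\<bar> * r ^ i) \<le> M + M'" .
qed

lemma fps_l1_mult:
  assumes "fps_l1 r f M" "fps_l1 r g M'" "0 \<le> r"
  shows "fps_l1 r (f * g) (M * M')"
  unfolding fps_l1_def
proof
  fix n
  have "(\<Sum>k\<le>n. \<bar>fps_nth (f * g) k\<bar> * r ^ k)
      \<le> (\<Sum>k\<le>n. \<Sum>i\<le>k. (\<bar>fps_nth f i\<bar> * r ^ i) * (\<bar>fps_nth g (k - i)\<bar> * r ^ (k - i)))"
  proof (rule sum_mono)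
    fix k
    have "\<bar>fps_nth (f * g) k\<bar> * r ^ k \<le> (\<Sum>i\<le>k. \<bar>fps_nth f i * fps_nth g (k - i)\<bar>) * r ^ k"
      using assms(3) by (auto simp: fps_mult_nth atMost_atLeast0 intro!: mult_right_mono)
    also have "\<dots> = (\<Sum>i\<le>k. (\<bar>fps_nth f i\<bar> * r ^ i) * (\<bar>fps_nth g (k - i)\<bar> * r ^ (k - i)))"
    proof (unfold sum_distrib_right, rule sum.cong[OF refl])
      fix i assume "i \<in> {..k}"
      then have "r ^ k = r ^ i * r ^ (k - i)" by (simp flip: power_add)
      then show "\<bar>fps_nth f i * fps_nth g (k - i)\<bar> * r ^ k
          = (\<bar>fps_nth f i\<bar> * r ^ i) * (\<bar>fps_nth g (k - i)\<bar> * r ^ (k - i))"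
        by (simp add: abs_mult)
    qed
    finally show "\<bar>fps_nth (f * g) k\<bar> * r ^ k
        \<le> (\<Sum>i\<le>k. (\<bar>fps_nth f i\<bar> * r ^ i) * (\<bar>fps_nth g (k - i)\<bar> * r ^ (k - i)))" .
  qed
  also have "\<dots> = (\<Sum>(i, j)\<in>{(i, j). i + j \<le> n}. (\<bar>fps_nth f i\<bar> * r ^ i) * (\<bar>fps_nth g j\<bar> * r ^ j))"
    by (subst sum.triangle_reindex_eq) simp
  also have "\<dots> \<le> (\<Sum>(i, j)\<in>{..n} \<times> {..n}. (\<bar>fps_nth f i\<bar> * r ^ i) * (\<bar>fps_nth g j\<bar> * r ^ j))"
    using assms(3) by (intro sum_mono2) auto
  also have "\<dots> = (\<Sum>i\<le>n. \<bar>fps_nth f i\<bar> * r ^ i) * (\<Sum>j\<le>n. \<bar>fps_nth g j\<bar> * r ^ j)"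
    by (simp add: sum_product sum.cartesian_product)
  also have "\<dots> \<le> M * M'"
    using assms fps_l1_nonneg[OF assms(1)] unfolding fps_l1_def
    by (intro mult_mono) (auto intro!: sum_nonneg)
  finally show "(\<Sum>k\<le>n. \<bar>fps_nth (f * g) k\<bar> * r ^ k) \<le> M * M'" .
qed

lemma fps_l1_const: "fps_l1 r (fps_const c) \<bar>c\<bar>"
proof -
  have "(\<Sum>i\<le>n. \<bar>fps_nth (fps_const c) i\<bar> * r ^ i) = \<bar>c\<bar>" for n
    by (subst sum.remove[of _ 0]) auto
  then show ?thesis by (simp add: fps_l1_def)
qed

lemma fps_l1_power:
  assumes "fps_l1 r f M" "0 \<le> r"
  shows "fps_l1 r (f ^ k) (M ^ k)"
proof (induction k)
  case 0
  show ?case using fps_l1_const[of r 1] by simp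
qed (use assms in \<open>auto intro: fps_l1_mult\<close>)

text \<open>A series of order at least k gains the factor (s/r)^k when the radius shrinks to s. With
  k = 1 the norm becomes as small as desired; with k = 3 the quadratic term is isolated in
  \<open>fps_l1_quadratic\<close>.\<close>

lemma fps_l1_shrink:
  assumes "fps_l1 r f M" "\<And>i. i < k \<Longrightarrow> fps_nth f i = 0" "0 \<le> s" "s \<le> r" "0 < r"
  shows "fps_l1 s f (M * (s / r) ^ k)"
  unfolding fps_l1_def
proof
  fix n
  have "(\<Sum>i\<le>n. \<bar>fps_nth f i\<bar> * s ^ i) \<le> (\<Sum>i\<le>n. \<bar>fps_nth f i\<bar> * r ^ i * (s / r) ^ k)"
  proof (rule sum_mono)
    fix i
    show "\<bar>fps_nth f i\<bar> * s ^ i \<le> \<bar>fps_nth f i\<bar> * r ^ i * (s / r) ^ k"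
    proof (cases "i < k")
      case False
      have "s ^ i = r ^ i * (s / r) ^ i" using assms(5) by (simp add: power_divide)
      also have "\<dots> \<le> r ^ i * (s / r) ^ k"
        using assms(3,4,5) False by (intro mult_left_mono power_decreasing) auto
      finally show ?thesis by (simp add: mult_left_mono mult.assoc)
    qed (simp add: assms(2))
  qed
  also have "\<dots> \<le> M * (s / r) ^ k"
    using assms unfolding fps_l1_def sum_distrib_right[symmetric] by (intro mult_right_mono) auto
  finally show "(\<Sum>i\<le>n. \<bar>fps_nth f i\<bar> * s ^ i) \<le> M * (s / r) ^ k" .
qed

lemma fps_l1_small:
  assumes "fps_l1 r f M" "fps_nth f 0 = 0" "0 < r" "0 < e"
  obtains s where "0 < s" "s \<le> r" "\<And>t. 0 < t \<Longrightarrow> t \<le> s \<Longrightarrow> fps_l1 t f e"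
proof
  define s where "s = min r (r * e / (M + 1))"
  have M: "0 \<le> M" using assms(1) by (rule fps_l1_nonneg)
  show "0 < s" "s \<le> r" using assms(3,4) M by (auto simp: s_def)
  fix t assume t: "0 < t" "t \<le> s"
  then have "fps_l1 t f (M * (t / r) ^ 1)"
    using assms(1,2,3) \<open>s \<le> r\<close> by (intro fps_l1_shrink) auto
  moreover have "M * (t / r) ^ 1 \<le> e"
  proof -
    have "t / r \<le> e / (M + 1)" using t assms(3) M by (simp add: s_def field_simps)
    then have "M * (t / r) \<le> M * (e / (M + 1))" using M by (rule mult_left_mono)
    also have "\<dots> \<le> e" using M assms(4) by (simp add: field_simps)
    finally show ?thesis by simp
  qed
  ultimately show "fps_l1 t f e" by (rule fps_l1_mono)
qed

text \<open>The geometric series in 1/2 bounds the sum. The condition on the outer coefficients is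
  met by the geometric, exponential, logarithmic and square-root series alike, so that one lemma
  serves them all.\<close>

lemma fps_l1_compose:
  assumes c: "\<And>k. \<bar>fps_nth c k\<bar> \<le> 1" and y: "fps_nth y 0 = 0" "fps_l1 r y (1 / 2)" and r: "0 \<le> r"
  shows "fps_l1 r (c oo y) 2"
  unfolding fps_l1_def
proof
  fix n
  have "(\<Sum>k\<le>n. \<bar>fps_nth (c oo y) k\<bar> * r ^ k) \<le> (\<Sum>k\<le>n. (\<Sum>i\<le>n. \<bar>fps_nth (y ^ i) k\<bar>) * r ^ k)"
  proof (rule sum_mono)
    fix k assume k: "k \<in> {..n}"
    have "\<bar>fps_nth (c oo y) k\<bar> \<le> (\<Sum>i\<le>k. \<bar>fps_nth c i * fps_nth (y ^ i) k\<bar>)"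
      by (simp add: fps_compose_nth atMost_atLeast0)
    also have "\<dots> \<le> (\<Sum>i\<le>k. 1 * \<bar>fps_nth (y ^ i) k\<bar>)"
      unfolding abs_mult using c by (intro sum_mono mult_right_mono) auto
    also have "\<dots> \<le> (\<Sum>i\<le>n. \<bar>fps_nth (y ^ i) k\<bar>)"
      using k by (auto intro!: sum_mono2)
    finally show "\<bar>fps_nth (c oo y) k\<bar> * r ^ k \<le> (\<Sum>i\<le>n. \<bar>fps_nth (y ^ i) k\<bar>) * r ^ k"
      using r by (intro mult_right_mono) auto
  qed
  also have "\<dots> = (\<Sum>i\<le>n. \<Sum>k\<le>n. \<bar>fps_nth (y ^ i) k\<bar> * r ^ k)"
    unfolding sum_distrib_right by (rule sum.swap)
  also have "\<dots> \<le> (\<Sum>i\<le>n. (1 / 2) ^ i)"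
    using fps_l1_power[OF y(2) r] by (intro sum_mono) (auto simp: fps_l1_def)
  also have "\<dots> = 2 - (1 / 2 :: real) ^ n"
    by (induction n) auto
  also have "\<dots> \<le> 2" by simp
  finally show "(\<Sum>k\<le>n. \<bar>fps_nth (c oo y) k\<bar> * r ^ k) \<le> 2" .
qed

lemma fps_inverse_one_minus:
  fixes y :: "real fps"
  assumes "fps_nth y 0 = 0"
  shows "inverse (1 - y) = Abs_fps (\<lambda>_. 1) oo y"
proof -
  define c :: "real fps" where "c = Abs_fps (\<lambda>_. 1)"
  have "(1 - fps_X) * c = 1"
    unfolding c_def by (simp add: fps_eq_iff left_diff_distrib)
  then have "((1 - fps_X) * c) oo y = 1" by simp
  then have "(1 - y) * (c oo y) = 1"
    by (simp add: fps_compose_mult_distrib fps_compose_sub_distrib assms)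
  then show ?thesis
    using fps_inverse_unique c_def by blast
qed

lemma fps_l1_inverse:
  assumes y: "fps_nth y 0 = 0" "fps_l1 r y (1 / 2)" and r: "0 \<le> r"
  shows "fps_l1 r (inverse (1 - y)) 2"
  unfolding fps_inverse_one_minus[OF y(1)] by (intro fps_l1_compose y r) simp

lemma fps_l1_summable:
  assumes "fps_l1 r f M" "\<bar>x\<bar> \<le> r"
  shows "summable (\<lambda>i. \<bar>fps_nth f i * x ^ i\<bar>)" "(\<Sum>i. \<bar>fps_nth f i * x ^ i\<bar>) \<le> M"
proof -
  have b: "(\<Sum>i<n. \<bar>fps_nth f i * x ^ i\<bar>) \<le> M" for n
  proof -
    have "(\<Sum>i<n. \<bar>fps_nth f i * x ^ i\<bar>) \<le> (\<Sum>i<n. \<bar>fps_nth f i\<bar> * r ^ i)"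
      unfolding abs_mult power_abs using assms(2)
      by (intro sum_mono mult_left_mono power_mono) auto
    also have "\<dots> \<le> (\<Sum>i\<le>n. \<bar>fps_nth f i\<bar> * r ^ i)"
      using assms(2) by (intro sum_mono2) auto
    also have "\<dots> \<le> M" using assms(1) by (simp add: fps_l1_def)
    finally show ?thesis .
  qed
  show "summable (\<lambda>i. \<bar>fps_nth f i * x ^ i\<bar>)"
    by (rule bounded_imp_summable[where B = M]) (use b[of "Suc _"] in \<open>auto simp: lessThan_Suc_atMost\<close>)
  then show "(\<Sum>i. \<bar>fps_nth f i * x ^ i\<bar>) \<le> M"
    using b by (rule suminf_le_const)
qed

lemma fps_l1_conv_radius:
  assumes "fps_l1 r f M" "0 < r"
  shows "ereal r \<le> fps_conv_radius f"
proof -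
  have "summable (\<lambda>i. fps_nth f i * r ^ i)"
    using fps_l1_summable(1)[OF assms(1), of r] assms(2) by (metis abs_of_pos order_refl summable_rabs_cancel)
  then have "ereal (norm r) \<le> conv_radius (fps_nth f)"
    by (rule conv_radius_geI)
  then show ?thesis using assms(2) by (simp add: fps_conv_radius_def)
qed

lemma fps_l1_exists:
  assumes "fps_conv_radius f > 0"
  obtains r M where "0 < r" "fps_l1 r f M"
proof -
  obtain r where r: "0 < r" "ereal r < fps_conv_radius f"
    using ereal_dense2[OF assms] by (auto simp: zero_ereal_def)
  have s: "summable (\<lambda>i. norm (fps_nth f i * r ^ i))"
    by (rule norm_summable_fps) (use r in auto)
  have "fps_l1 r f (\<Sum>i. norm (fps_nth f i * r ^ i))"
    unfolding fps_l1_def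
  proof
    fix n
    have "(\<Sum>i\<le>n. \<bar>fps_nth f i\<bar> * r ^ i) = (\<Sum>i\<le>n. norm (fps_nth f i * r ^ i))"
      using r by (simp add: abs_mult)
    also have "\<dots> \<le> (\<Sum>i. norm (fps_nth f i * r ^ i))"
      by (intro sum_le_suminf s) auto
    finally show "(\<Sum>i\<le>n. \<bar>fps_nth f i\<bar> * r ^ i) \<le> (\<Sum>i. norm (fps_nth f i * r ^ i))" .
  qed
  with r(1) show ?thesis by (rule that)
qed

lemma fps_l1_compose_exists:
  assumes "\<And>k. \<bar>fps_nth c k\<bar> \<le> 1" "fps_nth y 0 = 0" "0 < r" "fps_l1 r y M"
  obtains s where "0 < s" "s \<le> r" "fps_l1 s (c oo y) 2"
proof -
  obtain s where s: "0 < s" "s \<le> r" "\<And>t. 0 < t \<Longrightarrow> t \<le> s \<Longrightarrow> fps_l1 t y (1 / 2)"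
    using fps_l1_small[OF assms(4,2,3), of "1 / 2"] by auto
  then have "fps_l1 s (c oo y) 2"
    using assms by (intro fps_l1_compose) auto
  with s show ?thesis by (intro that)
qed

lemma abs_half_gbinomial_le: "\<bar>(1 / 2 :: real) gchoose k\<bar> \<le> 1"
proof (induction k)
  case (Suc k)
  have "(1 / 2 :: real) gchoose Suc k = ((1 / 2) gchoose k) * ((1 / 2 - real k) / real (Suc k))"
    using gbinomial_mult_1[of "1 / 2 :: real" k] by (simp add: field_simps)
  moreover have "\<bar>(1 / 2 - real k) / real (Suc k)\<bar> \<le> 1"
    by (simp add: abs_le_iff field_simps)
  ultimately show ?case
    using Suc by (simp only: abs_mult) (intro mult_le_one; simp)
qed simp

text \<open>With a = w_2 one has w = a X^2 (1 + y) and y(0) = 0, so sqrt(a) X (1 + y)^(1/2) is the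
  root with positive linear coefficient. The binomial coefficients of 1/2 are at most 1 in modulus,
  hence the positive radius.\<close>

lemma fps_sqrt_exists:
  fixes w :: "real fps"
  assumes "fps_nth w 0 = 0" "fps_nth w 1 = 0" "fps_nth w 2 > 0" "0 < r" "fps_l1 r w M"
  obtains v s M' where "v ^ 2 = w" "fps_nth v 0 = 0" "fps_nth v 1 = sqrt (fps_nth w 2)" "0 < s" "fps_l1 s v M'"
proof -
  define a where "a = fps_nth w 2"
  define y where "y = fps_const (1 / a) * fps_shift 2 w - 1"
  define b where "b = fps_binomial (1 / 2) oo y"
  define v where "v = fps_const (sqrt a) * (fps_X * b)"
  have a: "a > 0" using assms(3) by (simp add: a_def)
  have y0: "fps_nth y 0 = 0" using a by (simp add: y_def a_def numeral_2_eq_2)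
  have wX: "w = fps_X ^ 2 * fps_shift 2 w"
    using assms(1,2) by (intro fps_ext) (auto simp: fps_X_power_mult_nth less_2_cases_iff intro!: arg_cong[of _ _ "fps_nth w"])
  have "b ^ 2 = (fps_binomial (1 / 2)) ^ 2 oo y"
    unfolding b_def by (rule fps_compose_power[OF y0])
  also have "(fps_binomial (1 / 2) :: real fps) ^ 2 = 1 + fps_X"
    by (simp add: fps_binomial_power fps_binomial_1)
  finally have "b ^ 2 = 1 + y"
    using y0 by (simp add: fps_compose_add_distrib)
  then have "v ^ 2 = fps_const a * (fps_X ^ 2 * (1 + y))"
  proof -
    assume b: "b ^ 2 = 1 + y"
    have "fps_const (sqrt a) ^ 2 = fps_const a" using a by (simp only: fps_const_power) simp
    then show ?thesis unfolding v_def power_mult_distrib b by simp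
  qed
  also have "\<dots> = (fps_const a * fps_const (1 / a)) * (fps_X ^ 2 * fps_shift 2 w)"
    by (simp add: y_def mult_ac)
  also have "fps_const a * fps_const (1 / a) = 1" using a by simp
  finally have 1: "v ^ 2 = w" using wX by simp
  have 2: "fps_nth v 0 = 0" "fps_nth v 1 = sqrt a"
    by (simp_all add: v_def b_def)
  have "fps_l1 r (fps_shift 2 w) (M / r ^ 2)"
    unfolding fps_l1_def
  proof
    fix n
    have "(\<Sum>i\<le>n. \<bar>fps_nth (fps_shift 2 w) i\<bar> * r ^ i) * r ^ 2 = (\<Sum>i\<le>n. \<bar>fps_nth w (i + 2)\<bar> * r ^ (i + 2))"
      unfolding sum_distrib_right by (simp add: power_add power2_eq_square mult_ac)
    also have "\<dots> = (\<Sum>i\<in>{2..n + 2}. \<bar>fps_nth w i\<bar> * r ^ i)"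
      by (rule sum.reindex_bij_witness[of _ "\<lambda>i. i - 2" "\<lambda>i. i + 2"]) auto
    also have "\<dots> \<le> (\<Sum>i\<le>n + 2. \<bar>fps_nth w i\<bar> * r ^ i)"
      using assms(4) by (intro sum_mono2) auto
    also have "\<dots> \<le> M" using assms(5) unfolding fps_l1_def by blast
    finally show "(\<Sum>i\<le>n. \<bar>fps_nth (fps_shift 2 w) i\<bar> * r ^ i) \<le> M / r ^ 2"
      using assms(4) by (simp add: field_simps)
  qed
  then have "fps_l1 r y (\<bar>1 / a\<bar> * (M / r ^ 2) + \<bar>- 1\<bar>)"
  proof -
    assume sh: "fps_l1 r (fps_shift 2 w) (M / r ^ 2)"
    have "y = fps_const (1 / a) * fps_shift 2 w + fps_const (- 1)"
      by (simp add: y_def flip: fps_const_neg)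
    then show ?thesis
      using assms(4) by (auto simp only: intro!: fps_l1_add fps_l1_mult fps_l1_const sh)
  qed
  then obtain s where s: "0 < s" "s \<le> r" "fps_l1 s b 2"
    unfolding b_def using fps_l1_compose_exists[of "fps_binomial (1 / 2)" y] abs_half_gbinomial_le y0 assms(4)
    by (metis fps_binomial_nth)
  have "fps_l1 s fps_X s"
    unfolding fps_l1_def
  proof
    fix n
    have "(\<Sum>i\<le>n. \<bar>fps_nth fps_X i\<bar> * s ^ i) = (\<Sum>i\<le>n. if i = 1 then s else 0)"
      by (intro sum.cong) auto
    also have "\<dots> \<le> s" using s by simp
    finally show "(\<Sum>i\<le>n. \<bar>fps_nth fps_X i\<bar> * s ^ i) \<le> s" .
  qed
  then have "fps_l1 s v (\<bar>sqrt a\<bar> * (s * 2))"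
    unfolding v_def using s by (intro fps_l1_mult fps_l1_const) auto
  with 1 2 s(1) show ?thesis by (intro that) (auto simp: a_def)
qed

section \<open>The geometric kernel of a power series\<close>

lemma fps_l1_eval_bound:
  assumes "fps_l1 r f M" "\<bar>x\<bar> \<le> r"
  shows "\<bar>eval_fps f x\<bar> \<le> M"
proof -
  have "\<bar>eval_fps f x\<bar> \<le> (\<Sum>i. \<bar>fps_nth f i * x ^ i\<bar>)"
    unfolding eval_fps_def using fps_l1_summable(1)[OF assms] by (rule summable_rabs)
  also have "\<dots> \<le> M" by (rule fps_l1_summable(2)[OF assms])
  finally show ?thesis .
qed

lemma fps_l1_eval_sums:
  assumes "fps_l1 r f M" "\<bar>x\<bar> \<le> r"
  shows "(\<lambda>i. fps_nth f i * x ^ i) sums eval_fps f x"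
  unfolding eval_fps_def
  by (rule summable_sums, rule summable_rabs_cancel, rule fps_l1_summable(1)[OF assms])

lemma fps_nth_divided_by_linear:
  fixes G :: "real fps"
  assumes "\<zeta> \<noteq> 0"
  shows "fps_nth (G * inverse (fps_const \<zeta> - fps_X)) N = (\<Sum>i\<le>N. fps_nth G i * \<zeta> ^ i) / \<zeta> ^ (N + 1)"
proof -
  define I where "I = Abs_fps (\<lambda>i. 1 / \<zeta> ^ (i + 1))"
  have "(fps_const \<zeta> - fps_X) * I = 1"
  proof (rule fps_ext)
    fix n
    show "fps_nth ((fps_const \<zeta> - fps_X) * I) n = fps_nth 1 n"
      using assms by (cases n) (auto simp: I_def left_diff_distrib)
  qed
  then have "inverse (fps_const \<zeta> - fps_X) = I"
    using fps_inverse_unique by blast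
  then have "fps_nth (G * inverse (fps_const \<zeta> - fps_X)) N = (\<Sum>i\<le>N. fps_nth G i * (1 / \<zeta> ^ (N - i + 1)))"
    by (simp add: fps_mult_nth atMost_atLeast0 I_def)
  also have "\<dots> = (\<Sum>i\<le>N. fps_nth G i * \<zeta> ^ i / \<zeta> ^ (N + 1))"
  proof (rule sum.cong[OF refl])
    fix i assume "i \<in> {..N}"
    then have "\<zeta> ^ (N + 1) = \<zeta> ^ i * \<zeta> ^ (N - i + 1)" by (simp flip: power_add)
    then show "fps_nth G i * (1 / \<zeta> ^ (N - i + 1)) = fps_nth G i * \<zeta> ^ i / \<zeta> ^ (N + 1)"
      using assms by (simp add: field_simps)
  qed
  finally show ?thesis by (simp add: sum_divide_distrib)
qed

text \<open>
  The difference quotient \<open>(v z - v \<zeta>) / (z - \<zeta>)\<close> as a power series in \<open>z\<close>.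
\<close>

definition dquot :: "real fps \<Rightarrow> real \<Rightarrow> real fps" where
  "dquot v \<zeta> = Abs_fps (\<lambda>i. \<Sum>j. fps_nth v (i + 1 + j) * \<zeta> ^ j)"

lemma summable_dquot:
  fixes v :: "real fps"
  assumes "\<And>k. \<bar>fps_nth v k\<bar> \<le> M / R ^ k" "0 < R" "\<bar>\<zeta>\<bar> \<le> R / 2" "0 \<le> M"
  shows "summable (\<lambda>j. \<bar>fps_nth v (i + j) * \<zeta> ^ j\<bar>)" "(\<Sum>j. \<bar>fps_nth v (i + j) * \<zeta> ^ j\<bar>) \<le> 2 * M / R ^ i"
proof -
  have b: "\<bar>fps_nth v (i + j) * \<zeta> ^ j\<bar> \<le> M / R ^ i * (1 / 2) ^ j" for j
  proof -
    have "\<bar>fps_nth v (i + j) * \<zeta> ^ j\<bar> \<le> M / R ^ (i + j) * (R / 2) ^ j"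
      unfolding abs_mult power_abs using assms by (intro mult_mono power_mono) auto
    also have "\<dots> = M / R ^ i * (1 / 2) ^ j"
      using assms(2) by (simp add: power_add power_divide)
    finally show ?thesis .
  qed
  have g: "(\<lambda>j. M / R ^ i * (1 / 2) ^ j) sums (M / R ^ i * 2)"
    using sums_mult[OF geometric_sums[of "1 / 2 :: real"], of "M / R ^ i"] by simp
  show s: "summable (\<lambda>j. \<bar>fps_nth v (i + j) * \<zeta> ^ j\<bar>)"
    by (rule summable_comparison_test'[OF sums_summable[OF g], of 0]) (simp only: real_norm_def abs_idempotent b)
  have "(\<Sum>j. \<bar>fps_nth v (i + j) * \<zeta> ^ j\<bar>) \<le> (\<Sum>j. M / R ^ i * (1 / 2) ^ j)"
    by (rule suminf_le[OF b s sums_summable[OF g]])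
  also have "\<dots> = M / R ^ i * 2"
    by (rule sums_unique[OF g, symmetric])
  also have "\<dots> = 2 * M / R ^ i" by simp
  finally show "(\<Sum>j. \<bar>fps_nth v (i + j) * \<zeta> ^ j\<bar>) \<le> 2 * M / R ^ i" .
qed

lemma dquot_eq:
  assumes "\<And>k. \<bar>fps_nth v k\<bar> \<le> M / R ^ k" "0 < R" "\<bar>\<zeta>\<bar> \<le> R / 2" "0 \<le> M"
  shows "(fps_const \<zeta> - fps_X) * dquot v \<zeta> = fps_const (eval_fps v \<zeta>) - v"
proof (rule fps_ext)
  fix n
  have *: "(\<Sum>j. fps_nth v (i + j) * \<zeta> ^ j) = fps_nth v i + \<zeta> * (\<Sum>j. fps_nth v (i + 1 + j) * \<zeta> ^ j)" for i
  proof -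
    have "summable (\<lambda>j. fps_nth v (i + j) * \<zeta> ^ j)"
      by (rule summable_rabs_cancel, rule summable_dquot(1)[OF assms])
    moreover have "summable (\<lambda>j. fps_nth v (i + 1 + j) * \<zeta> ^ j)"
      by (rule summable_rabs_cancel, rule summable_dquot(1)[OF assms])
    ultimately show ?thesis
      using suminf_split_head[of "\<lambda>j. fps_nth v (i + j) * \<zeta> ^ j"]
        suminf_mult[of "\<lambda>j. fps_nth v (i + 1 + j) * \<zeta> ^ j" \<zeta>]
      by (simp add: mult_ac)
  qed
  show "fps_nth ((fps_const \<zeta> - fps_X) * dquot v \<zeta>) n = fps_nth (fps_const (eval_fps v \<zeta>) - v) n"
  proof (cases n)
    case 0
    then show ?thesis using *[of 0] by (simp add: dquot_def eval_fps_def left_diff_distrib)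
  next
    case (Suc m)
    then show ?thesis using *[of "Suc m"] by (simp add: dquot_def left_diff_distrib)
  qed
qed

text \<open>For small r the difference quotient is close to the constant v'(0), uniformly in
  \<zeta>: its constant coefficient is off by O(r), and every other coefficient carries a factor r
  in the norm. This is what makes it invertible with a bound free of \<zeta>.\<close>

lemma dquot_l1:
  fixes v :: "real fps"
  assumes v: "\<And>k. \<bar>fps_nth v k\<bar> \<le> M / R ^ k" and R: "0 < R" "0 \<le> M"
    and r: "0 \<le> r" "r \<le> R / 2" and z: "\<bar>\<zeta>\<bar> \<le> r"
  shows "fps_l1 r (dquot v \<zeta> - fps_const (fps_nth v 1)) (6 * M * r / R ^ 2)"
  unfolding fps_l1_def
proof
  fix n
  have z': "\<bar>\<zeta>\<bar> \<le> R / 2" using r z by linarith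
  note sm = summable_dquot[OF v R(1) z' R(2)]
  define d where "d = dquot v \<zeta> - fps_const (fps_nth v 1)"
  have d0: "\<bar>fps_nth d 0\<bar> \<le> 2 * M * r / R ^ 2"
  proof -
    have "fps_nth d 0 = (\<Sum>j. fps_nth v (1 + j) * \<zeta> ^ j) - fps_nth v 1"
      by (simp add: d_def dquot_def)
    also have "\<dots> = (\<Sum>j. fps_nth v (2 + j) * \<zeta> ^ j * \<zeta>)"
      using suminf_split_head[OF summable_rabs_cancel[OF sm(1)[of 1]]] by (simp add: mult_ac)
    also have "\<dots> = (\<Sum>j. fps_nth v (2 + j) * \<zeta> ^ j) * \<zeta>"
      by (rule suminf_mult2[symmetric, OF summable_rabs_cancel[OF sm(1)]])
    finally have "\<bar>fps_nth d 0\<bar> = \<bar>\<Sum>j. fps_nth v (2 + j) * \<zeta> ^ j\<bar> * \<bar>\<zeta>\<bar>" by (simp add: abs_mult)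
    also have "\<dots> \<le> (2 * M / R ^ 2) * r"
      using z R order_trans[OF summable_rabs[OF sm(1)] sm(2), of 2] by (intro mult_mono) auto
    finally show ?thesis by simp
  qed
  have di: "\<bar>fps_nth d (Suc i)\<bar> \<le> 2 * M / R ^ (i + 2)" for i
    using order_trans[OF summable_rabs[OF sm(1)] sm(2), of "i + 2"] by (simp add: d_def dquot_def)
  have "(\<Sum>i\<le>n. \<bar>fps_nth d i\<bar> * r ^ i) \<le> (\<Sum>i\<le>Suc n. \<bar>fps_nth d i\<bar> * r ^ i)"
    using r by simp
  also have "\<dots> = \<bar>fps_nth d 0\<bar> + (\<Sum>i\<le>n. \<bar>fps_nth d (Suc i)\<bar> * r ^ Suc i)"
    by (subst sum.atMost_Suc_shift) simp
  also have "\<dots> \<le> 2 * M * r / R ^ 2 + (\<Sum>i\<le>n. (2 * M * r / R ^ 2) * (1 / 2) ^ i)"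
  proof (intro add_mono d0 sum_mono)
    fix i
    have "\<bar>fps_nth d (Suc i)\<bar> * r ^ Suc i \<le> 2 * M / R ^ (i + 2) * (r * (R / 2) ^ i)"
      using R r di[of i] by (intro mult_mono) (auto intro!: mult_left_mono power_mono)
    also have "\<dots> = (2 * M * r / R ^ 2) * (1 / 2) ^ i"
      using R by (simp add: power_add power_divide power2_eq_square)
    finally show "\<bar>fps_nth d (Suc i)\<bar> * r ^ Suc i \<le> (2 * M * r / R ^ 2) * (1 / 2) ^ i" .
  qed
  also have "(\<Sum>i\<le>n. (2 * M * r / R ^ 2) * (1 / 2) ^ i) = (2 * M * r / R ^ 2) * (2 - (1 / 2) ^ n)"
  proof -
    have "(\<Sum>i\<le>n. (1 / 2 :: real) ^ i) = 2 - (1 / 2) ^ n" by (induction n) auto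
    then show ?thesis by (simp only: sum_distrib_left[symmetric])
  qed
  also have "2 * M * r / R ^ 2 + \<dots> \<le> 2 * M * r / R ^ 2 + (2 * M * r / R ^ 2) * 2"
    using R r by (intro add_mono mult_left_mono) auto
  finally show "(\<Sum>i\<le>n. \<bar>fps_nth (dquot v \<zeta> - fps_const (fps_nth v 1)) i\<bar> * r ^ i) \<le> 6 * M * r / R ^ 2"
    by (simp add: d_def)
qed

text \<open>Away from \<zeta> the series evaluates to the ordinary difference quotient of v; as x
  tends to \<zeta>, its continuity and the differentiability of v identify the value.\<close>

lemma eval_dquot:
  assumes v: "\<And>k. \<bar>fps_nth v k\<bar> \<le> M / R ^ k" "fps_l1 R v M" and R: "0 < R"
    and r: "0 < r" "r \<le> R / 2" and z: "\<bar>\<zeta>\<bar> < r" and q: "fps_l1 r (dquot v \<zeta>) M'"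
  shows "eval_fps (dquot v \<zeta>) \<zeta> = eval_fps (fps_deriv v) \<zeta>"
proof -
  have M: "0 \<le> M" using v(2) by (rule fps_l1_nonneg)
  have rad: "ereal r \<le> fps_conv_radius (dquot v \<zeta>)" "ereal R \<le> fps_conv_radius v"
    using q v(2) r R by (auto intro: fps_l1_conv_radius)
  have lr: "ereal x < fps_conv_radius (dquot v \<zeta>)" "ereal x < fps_conv_radius v" if "x < r" for x
    using that rad r R by (auto intro!: less_le_trans[OF _ rad(1)] less_le_trans[OF _ rad(2)])
  have eq: "(\<zeta> - x) * eval_fps (dquot v \<zeta>) x = eval_fps v \<zeta> - eval_fps v x" if x: "\<bar>x\<bar> < r" for x
  proof -
    have "eval_fps ((fps_const \<zeta> - fps_X) * dquot v \<zeta>) x = eval_fps (fps_const \<zeta> - fps_X) x * eval_fps (dquot v \<zeta>) x"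
    proof (rule eval_fps_mult)
      have "min (fps_conv_radius (fps_const \<zeta>)) (fps_conv_radius (fps_X :: real fps)) \<le> fps_conv_radius (fps_const \<zeta> - fps_X)"
        by (rule fps_conv_radius_diff)
      then show "ereal (norm x) < fps_conv_radius (fps_const \<zeta> - fps_X)" by simp
    qed (use lr x in auto)
    also have "eval_fps (fps_const \<zeta> - fps_X) x = \<zeta> - x"
      by (subst eval_fps_diff) auto
    also have "(fps_const \<zeta> - fps_X) * dquot v \<zeta> = fps_const (eval_fps v \<zeta>) - v"
      by (rule dquot_eq[OF v(1) R _ M]) (use r z in auto)
    also have "eval_fps (fps_const (eval_fps v \<zeta>) - v) x = eval_fps v \<zeta> - eval_fps v x"
      using lr x by (subst eval_fps_diff) auto
    finally show ?thesis by simp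
  qed
  have "(eval_fps v has_field_derivative eval_fps (fps_deriv v) \<zeta>) (at \<zeta>)"
    using lr z by (intro has_field_derivative_eval_fps) auto
  then have l1: "(\<lambda>x. (eval_fps v x - eval_fps v \<zeta>) / (x - \<zeta>)) \<midarrow>\<zeta>\<rightarrow> eval_fps (fps_deriv v) \<zeta>"
    by (simp add: has_field_derivative_iff)
  have "isCont (eval_fps (dquot v \<zeta>)) \<zeta>"
    using lr z by (intro DERIV_isCont[OF has_field_derivative_eval_fps]) auto
  then have l2: "eval_fps (dquot v \<zeta>) \<midarrow>\<zeta>\<rightarrow> eval_fps (dquot v \<zeta>) \<zeta>"
    by (simp add: isCont_def)
  have "eventually (\<lambda>x. x \<in> {-r<..<r}) (at \<zeta>)"
    using z by (intro eventually_at_in_open') auto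
  moreover have "eventually (\<lambda>x. x \<noteq> \<zeta>) (at \<zeta>)"
    by (simp add: eventually_at_filter)
  ultimately have "eventually (\<lambda>x. (eval_fps v x - eval_fps v \<zeta>) / (x - \<zeta>) = eval_fps (dquot v \<zeta>) x) (at \<zeta>)"
  proof eventually_elim
    case (elim x)
    then have "eval_fps v x - eval_fps v \<zeta> = eval_fps (dquot v \<zeta>) x * (x - \<zeta>)"
      using eq[of x] by (simp add: algebra_simps abs_less_iff)
    with elim show ?case by simp
  qed
  with l1 have "eval_fps (dquot v \<zeta>) \<midarrow>\<zeta>\<rightarrow> eval_fps (fps_deriv v) \<zeta>"
    by (rule Lim_transform_eventually)
  from LIM_unique[OF l2 this] show ?thesis .
qed

section \<open>Coefficient estimates for the kernel Y / (1 - p v)\<close>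

lemma kernel_nth:
  fixes v Y :: "real fps"
  assumes "fps_nth v 0 = 0"
  shows "fps_nth (Y * inverse (1 - fps_const p * v)) N = (\<Sum>k\<le>N. p ^ k * fps_nth (Y * v ^ k) N)"
proof -
  define y where "y = fps_const p * v"
  have y0: "fps_nth y 0 = 0" using assms by (simp add: y_def)
  \<comment> \<open>v^k has order at least k, so only k <= N contributes and the coefficient is a
    polynomial in p.\<close>
  have c: "fps_nth (Abs_fps (\<lambda>_. 1) oo y) j = (\<Sum>k\<le>N. fps_nth (y ^ k) j)" if "j \<le> N" for j
    using that startsby_zero_power_prefix[OF y0] unfolding fps_compose_nth
    by (intro sum.mono_neutral_cong_left) auto
  have "fps_nth (Y * inverse (1 - y)) N = (\<Sum>i\<le>N. fps_nth Y i * (\<Sum>k\<le>N. fps_nth (y ^ k) (N - i)))"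
    unfolding fps_inverse_one_minus[OF y0] fps_mult_nth atMost_atLeast0[symmetric]
    by (intro sum.cong refl) (simp add: c)
  also have "\<dots> = (\<Sum>k\<le>N. \<Sum>i\<le>N. fps_nth Y i * fps_nth (y ^ k) (N - i))"
    unfolding sum_distrib_left by (rule sum.swap)
  also have "\<dots> = (\<Sum>k\<le>N. fps_nth (Y * y ^ k) N)"
    by (simp add: fps_mult_nth atMost_atLeast0)
  also have "\<dots> = (\<Sum>k\<le>N. p ^ k * fps_nth (Y * v ^ k) N)"
    by (intro sum.cong refl)
       (simp add: y_def power_mult_distrib fps_const_power mult.left_commute[of Y])
  finally show ?thesis by (simp add: y_def)
qed

text \<open>For bounded p a common radius s makes the norm of p v at most 1/2, and coefficient N is
  O(s^(-N)). Such a bound is negligible later, so only large p needs a closer look.\<close>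

lemma kernel_bound:
  fixes v Y :: "real fps"
  assumes "fps_nth v 0 = 0" "0 < R" "fps_l1 R v M" "fps_l1 R Y M'" "0 \<le> P"
  obtains C D where "0 \<le> C" "0 < D"
    "\<forall>p N. \<bar>p\<bar> \<le> P \<longrightarrow> \<bar>fps_nth (Y * inverse (1 - fps_const p * v)) N\<bar> \<le> C * D ^ N"
proof -
  obtain s where s: "0 < s" "s \<le> R" "\<And>t. 0 < t \<Longrightarrow> t \<le> s \<Longrightarrow> fps_l1 t v (1 / (2 * (P + 1)))"
    using fps_l1_small[OF assms(3,1,2), of "1 / (2 * (P + 1))"] assms(5) by auto
  have Y: "fps_l1 s Y M'"
    using fps_l1_shrink[OF assms(4), of 0 s] s assms(2) by simp
  have "\<bar>fps_nth (Y * inverse (1 - fps_const p * v)) N\<bar> \<le> (M' * 2) * (1 / s) ^ N" if "\<bar>p\<bar> \<le> P" for p N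
  proof -
    have "fps_l1 s (fps_const p * v) (\<bar>p\<bar> * (1 / (2 * (P + 1))))"
      using s by (intro fps_l1_mult fps_l1_const) auto
    moreover have "\<bar>p\<bar> * (1 / (2 * (P + 1))) \<le> 1 / 2"
      using that assms(5) by (simp add: field_simps)
    ultimately have "fps_l1 s (fps_const p * v) (1 / 2)"
      by (rule fps_l1_mono)
    then have "fps_l1 s (Y * inverse (1 - fps_const p * v)) (M' * 2)"
      using s Y assms(1) by (intro fps_l1_mult fps_l1_inverse) auto
    from fps_l1_nth[OF this s(1), of N] show ?thesis by (simp add: power_divide)
  qed
  with s(1) fps_l1_nonneg[OF assms(4)] show ?thesis
    by (intro that[of "M' * 2" "1 / s"]) auto
qed

text \<open>
  The kernel has a simple pole at the small solution \<open>\<zeta>\<close> of \<open>p * v \<zeta> = 1\<close>; removing it leaves a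
  function holomorphic in a disc whose radius does not depend on \<open>p\<close>.
\<close>

lemma kernel_residue:
  fixes v Y :: "real fps"
  assumes v: "fps_nth v 0 = 0" "fps_nth v 1 > 0" and R: "0 < R" "fps_l1 R v M" "fps_l1 R Y M'"
  obtains r C D where "0 < r" "r < R" "0 \<le> C" "0 < D"
    "\<forall>\<zeta>. 0 < \<zeta> \<longrightarrow> \<zeta> \<le> r \<longrightarrow> 0 < eval_fps v \<zeta>"
    "\<forall>\<zeta>. 0 \<le> \<zeta> \<longrightarrow> \<zeta> \<le> r \<longrightarrow> 0 < eval_fps (fps_deriv v) \<zeta>"
    "\<forall>\<zeta> N. 0 < \<zeta> \<longrightarrow> \<zeta> \<le> r \<longrightarrow>
       \<bar>fps_nth (Y * inverse (1 - fps_const (1 / eval_fps v \<zeta>) * v)) N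
         - eval_fps v \<zeta> * eval_fps Y \<zeta> / (eval_fps (fps_deriv v) \<zeta> * \<zeta> ^ (N + 1))\<bar> \<le> C * D ^ N"
proof -
  define a where "a = fps_nth v 1"
  have a: "a > 0" using v(2) by (simp add: a_def)
  have M: "0 \<le> M" "0 \<le> M'" using R by (auto dest: fps_l1_nonneg)
  have vk: "\<bar>fps_nth v k\<bar> \<le> M / R ^ k" for k by (rule fps_l1_nth[OF R(2,1)])
  \<comment> \<open>At this radius \<open>dquot_l1\<close> keeps the difference quotient within a/8
    of a, for all admissible \<zeta> at once.\<close>
  define s where "s = min (R / 2) (a * R ^ 2 / (48 * (M + 1)))"
  have "s \<le> R / 2" unfolding s_def by (rule min.cobounded1)
  moreover have "0 < s" using a R M by (auto simp: s_def)
  ultimately have s: "0 < s" "s \<le> R / 2" by auto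
  have s8: "6 * M * s / R ^ 2 \<le> a / 8"
  proof -
    have "s \<le> a * R ^ 2 / (48 * (M + 1))" by (simp add: s_def)
    then have "s * (48 * (M + 1)) \<le> a * R ^ 2" using M by (simp add: field_simps)
    moreover have "s * (48 * M) \<le> s * (48 * (M + 1))" using s M by (intro mult_left_mono) auto
    ultimately have "s * (48 * M) \<le> a * R ^ 2" by linarith
    then show ?thesis using R by (simp add: field_simps)
  qed
  define r where "r = s / 2"
  have r: "0 < r" "r < s" "r < R" using s R by (auto simp: r_def)
  define M2 where "M2 = M' * (4 / a)"
  have M2: "0 \<le> M2" using M a by (simp add: M2_def)
  have main: "0 < eval_fps v \<zeta> \<or> \<zeta> = 0" "0 < eval_fps (fps_deriv v) \<zeta>"
     "0 < \<zeta> \<Longrightarrow> \<bar>fps_nth (Y * inverse (1 - fps_const (1 / eval_fps v \<zeta>) * v)) N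
         - eval_fps v \<zeta> * eval_fps Y \<zeta> / (eval_fps (fps_deriv v) \<zeta> * \<zeta> ^ (N + 1))\<bar> \<le> (2 * M * M2 / s) * (1 / s) ^ N"
    if z: "0 \<le> \<zeta>" "\<zeta> \<le> r" for \<zeta> N
  proof -
    have z': "\<bar>\<zeta>\<bar> < s" "\<bar>\<zeta>\<bar> \<le> s" "\<bar>\<zeta>\<bar> \<le> R / 2" "\<bar>\<zeta>\<bar> \<le> R" using z r s by auto
    define q where "q = dquot v \<zeta>"
    define d where "d = q - fps_const a"
    have d: "fps_l1 s d (a / 8)"
      unfolding d_def q_def a_def using s8 s z' unfolding a_def
      by (intro fps_l1_mono[OF dquot_l1[OF vk R(1) M(1)]]) auto
    have qd: "q = fps_const a + d" by (simp add: d_def)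
    have ql: "fps_l1 s q (\<bar>a\<bar> + a / 8)"
      unfolding qd using s d by (intro fps_l1_add fps_l1_const) auto
    have d0: "\<bar>fps_nth d 0\<bar> \<le> a / 8" using fps_l1_nth[OF d s(1), of 0] by simp
    define q0 where "q0 = fps_nth q 0"
    have q0: "7 / 8 * a \<le> q0" using d0 by (simp add: q0_def qd abs_le_iff)
    then have q0': "0 < q0" using a by linarith
    have eq: "eval_fps q \<zeta> = eval_fps (fps_deriv v) \<zeta>"
      unfolding q_def by (rule eval_dquot[OF vk R(2,1) s z'(1)]) (use ql in \<open>simp add: q_def\<close>)
    have "eval_fps q \<zeta> = a + eval_fps d \<zeta>"
      unfolding qd using fps_l1_conv_radius[OF d s(1)] z'(1)
      by (subst eval_fps_add) (auto intro: less_le_trans[rotated])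
    moreover have "\<bar>eval_fps d \<zeta>\<bar> \<le> a / 8" by (rule fps_l1_eval_bound[OF d z'(2)])
    ultimately have qpos: "0 < eval_fps q \<zeta>" using a by (simp add: abs_le_iff)
    then show 2: "0 < eval_fps (fps_deriv v) \<zeta>" by (simp add: eq)
    have dq: "(fps_const \<zeta> - fps_X) * q = fps_const (eval_fps v \<zeta>) - v"
      unfolding q_def by (rule dquot_eq[OF vk R(1) z'(3) M(1)])
    have "\<zeta> * q0 = eval_fps v \<zeta>"
      using arg_cong[OF dq, of "\<lambda>f. fps_nth f 0"] v(1) by (simp add: q0_def)
    then show 1: "0 < eval_fps v \<zeta> \<or> \<zeta> = 0"
      using q0' z by (metis less_eq_real_def mult_pos_pos)
    show "\<bar>fps_nth (Y * inverse (1 - fps_const (1 / eval_fps v \<zeta>) * v)) N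
         - eval_fps v \<zeta> * eval_fps Y \<zeta> / (eval_fps (fps_deriv v) \<zeta> * \<zeta> ^ (N + 1))\<bar> \<le> (2 * M * M2 / s) * (1 / s) ^ N"
      if zp: "0 < \<zeta>"
    proof -
      define vz where "vz = eval_fps v \<zeta>"
      have vz: "0 < vz" "\<bar>vz\<bar> \<le> M"
        using 1 zp fps_l1_eval_bound[OF R(2) z'(4)] by (auto simp: vz_def)
      define y where "y = fps_const (- 1 / q0) * (d + fps_const (- fps_nth d 0))"
      have qy: "q = fps_const q0 * (1 - y)"
      proof -
        have "fps_const q0 * (1 - y) = fps_const q0 - (fps_const q0 * fps_const (- 1 / q0)) * (d + fps_const (- fps_nth d 0))"
          by (simp add: y_def algebra_simps)
        also have "fps_const q0 * fps_const (- 1 / q0) = - 1" using q0' by (simp flip: fps_const_neg)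
        also have "fps_const q0 - - 1 * (d + fps_const (- fps_nth d 0)) = fps_const (q0 - fps_nth d 0) + d"
          by (simp add: algebra_simps flip: fps_const_sub)
        also have "q0 - fps_nth d 0 = a" by (simp add: q0_def qd)
        finally show ?thesis by (simp add: qd)
      qed
      have y0: "fps_nth y 0 = 0" by (simp add: y_def)
      have "fps_l1 s y (\<bar>- 1 / q0\<bar> * (a / 8 + \<bar>- fps_nth d 0\<bar>))"
        unfolding y_def using s d by (intro fps_l1_mult fps_l1_add fps_l1_const) auto
      moreover have "\<bar>- 1 / q0\<bar> * (a / 8 + \<bar>- fps_nth d 0\<bar>) \<le> 1 / 2"
        using d0 q0 q0' by (simp add: field_simps)
      ultimately have y: "fps_l1 s y (1 / 2)" by (rule fps_l1_mono)
      have iq: "inverse q = fps_const (1 / q0) * inverse (1 - y)"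
        unfolding qy fps_inverse_mult by (simp add: fps_const_inverse inverse_eq_divide)
      have iql: "fps_l1 s (inverse q) (4 / a)"
      proof -
        have "fps_l1 s (inverse q) (\<bar>1 / q0\<bar> * 2)"
          unfolding iq using s y y0 by (intro fps_l1_mult fps_l1_const fps_l1_inverse) auto
        moreover have "\<bar>1 / q0\<bar> * 2 \<le> 4 / a" using q0 q0' a by (simp add: field_simps)
        ultimately show ?thesis by (rule fps_l1_mono)
      qed
      define G where "G = Y * inverse q"
      have Yl: "fps_l1 s Y M'"
        using fps_l1_shrink[OF R(3), of 0 s] s R(1) by simp
      have Gl: "fps_l1 s G M2"
        unfolding G_def M2_def using s Yl iql by (intro fps_l1_mult) auto
      have lr: "ereal \<zeta> < fps_conv_radius f" if "fps_l1 s f B" for f B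
        using z' fps_l1_conv_radius[OF that s(1)] by (auto intro: less_le_trans[rotated])
      have "eval_fps (inverse q * q) \<zeta> = eval_fps (inverse q) \<zeta> * eval_fps q \<zeta>"
        using lr[OF iql] lr[OF ql] z by (intro eval_fps_mult) auto
      also have "inverse q * q = 1"
        using q0' by (intro inverse_mult_eq_1) (simp add: q0_def)
      finally have eiq: "eval_fps (inverse q) \<zeta> = 1 / eval_fps (fps_deriv v) \<zeta>"
        using qpos by (simp add: eq field_simps)
      have eG: "eval_fps G \<zeta> = eval_fps Y \<zeta> / eval_fps (fps_deriv v) \<zeta>"
        unfolding G_def using lr[OF iql] lr[OF Yl] z by (subst eval_fps_mult) (auto simp: eiq)
      \<comment> \<open>Since 1 - v/v(\<zeta>) = (\<zeta> - X) q / v(\<zeta>), the pole sits in the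
        linear factor alone, and G = Y/q is regular.\<close>
      have "1 - fps_const (1 / vz) * v = fps_const (1 / vz) * ((fps_const \<zeta> - fps_X) * q)"
        unfolding dq using vz by (simp add: right_diff_distrib flip: vz_def)
      then have "Y * inverse (1 - fps_const (1 / vz) * v) = fps_const vz * (G * inverse (fps_const \<zeta> - fps_X))"
        by (simp only: fps_inverse_mult) (simp add: G_def fps_const_inverse mult_ac)
      then have K: "fps_nth (Y * inverse (1 - fps_const (1 / vz) * v)) N
          = vz * ((\<Sum>i\<le>N. fps_nth G i * \<zeta> ^ i) / \<zeta> ^ (N + 1))"
        using zp by (simp only: fps_nth_divided_by_linear fps_mult_left_const_nth)
      \<comment> \<open>Coefficient N of G/(\<zeta> - X) is a partial sum of G(\<zeta>) over
        \<zeta>^(N+1). The full sum gives the residue term; the tail over \<zeta>^(N+1) is only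
        O(s^(-N)), as \<zeta> <= s/2.\<close>
      have tail: "\<bar>(\<Sum>i\<le>N. fps_nth G i * \<zeta> ^ i) - eval_fps G \<zeta>\<bar> \<le> 2 * M2 * (\<zeta> / s) ^ (N + 1)"
      proof -
        have t: "(\<lambda>i. fps_nth G (i + Suc N) * \<zeta> ^ (i + Suc N)) sums (eval_fps G \<zeta> - (\<Sum>i\<le>N. fps_nth G i * \<zeta> ^ i))"
          using sums_split_initial_segment[OF fps_l1_eval_sums[OF Gl z'(2)], of "Suc N"] by (simp add: lessThan_Suc_atMost)
        have g: "(\<lambda>i. M2 * (\<zeta> / s) ^ (N + 1) * (1 / 2) ^ i) sums (M2 * (\<zeta> / s) ^ (N + 1) * 2)"
          using sums_mult[OF geometric_sums[of "1 / 2 :: real"], of "M2 * (\<zeta> / s) ^ (N + 1)"] by simp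
        have b: "norm (fps_nth G (i + Suc N) * \<zeta> ^ (i + Suc N)) \<le> M2 * (\<zeta> / s) ^ (N + 1) * (1 / 2) ^ i" for i
        proof -
          have "norm (fps_nth G (i + Suc N) * \<zeta> ^ (i + Suc N)) \<le> M2 / s ^ (i + Suc N) * \<zeta> ^ (i + Suc N)"
          proof -
            have "norm (fps_nth G (i + Suc N) * \<zeta> ^ (i + Suc N)) = \<bar>fps_nth G (i + Suc N)\<bar> * \<zeta> ^ (i + Suc N)"
              using z by (simp only: real_norm_def abs_mult power_abs abs_of_nonneg)
            then show ?thesis
              using z by (simp only:) (intro mult_right_mono fps_l1_nth[OF Gl s(1)] zero_le_power)
          qed
          also have "\<dots> = M2 * (\<zeta> / s) ^ (N + 1) * (\<zeta> / s) ^ i"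
            by (simp add: power_divide power_add mult_ac)
          also have "\<dots> \<le> M2 * (\<zeta> / s) ^ (N + 1) * (1 / 2) ^ i"
            using z s M2 by (intro mult_left_mono power_mono) (auto simp: r_def field_simps)
          finally show ?thesis .
        qed
        have "norm (\<Sum>i. fps_nth G (i + Suc N) * \<zeta> ^ (i + Suc N)) \<le> (\<Sum>i. M2 * (\<zeta> / s) ^ (N + 1) * (1 / 2) ^ i)"
          using b sums_summable[OF g] by (rule norm_suminf_le)
        also have "(\<Sum>i. M2 * (\<zeta> / s) ^ (N + 1) * (1 / 2) ^ i) = M2 * (\<zeta> / s) ^ (N + 1) * 2"
          by (rule sums_unique[OF g, symmetric])
        finally show ?thesis
          unfolding sums_unique[OF t, symmetric] by (simp add: abs_minus_commute mult_ac)
      qed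
      have "fps_nth (Y * inverse (1 - fps_const (1 / vz) * v)) N - vz * eval_fps Y \<zeta> / (eval_fps (fps_deriv v) \<zeta> * \<zeta> ^ (N + 1))
         = vz / \<zeta> ^ (N + 1) * ((\<Sum>i\<le>N. fps_nth G i * \<zeta> ^ i) - eval_fps G \<zeta>)"
        unfolding K eG by (simp add: right_diff_distrib)
      then have "\<bar>fps_nth (Y * inverse (1 - fps_const (1 / vz) * v)) N - vz * eval_fps Y \<zeta> / (eval_fps (fps_deriv v) \<zeta> * \<zeta> ^ (N + 1))\<bar>
         = vz / \<zeta> ^ (N + 1) * \<bar>(\<Sum>i\<le>N. fps_nth G i * \<zeta> ^ i) - eval_fps G \<zeta>\<bar>"
        using vz zp by (simp only: abs_mult) simp
      also have "\<dots> \<le> vz / \<zeta> ^ (N + 1) * (2 * M2 * (\<zeta> / s) ^ (N + 1))"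
        using tail vz zp by (intro mult_left_mono) auto
      also have "\<dots> = vz * (2 * M2 / s ^ (N + 1))"
        using zp by (simp add: power_divide)
      also have "\<dots> \<le> M * (2 * M2 / s ^ (N + 1))"
        using vz M2 s by (intro mult_right_mono) auto
      also have "\<dots> = (2 * M * M2 / s) * (1 / s) ^ N"
        by (simp add: power_divide)
      finally show ?thesis by (simp only: vz_def)
    qed
  qed
  show ?thesis
  proof (rule that[of r "2 * M * M2 / s" "1 / s"])
    show "\<forall>\<zeta>. 0 < \<zeta> \<longrightarrow> \<zeta> \<le> r \<longrightarrow> 0 < eval_fps v \<zeta>"
      using main(1) by (metis less_irrefl less_imp_le)
    show "\<forall>\<zeta>. 0 \<le> \<zeta> \<longrightarrow> \<zeta> \<le> r \<longrightarrow> 0 < eval_fps (fps_deriv v) \<zeta>"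
      using main(2) by (intro allI impI)
    show "\<forall>\<zeta> N. 0 < \<zeta> \<longrightarrow> \<zeta> \<le> r \<longrightarrow>
       \<bar>fps_nth (Y * inverse (1 - fps_const (1 / eval_fps v \<zeta>) * v)) N
         - eval_fps v \<zeta> * eval_fps Y \<zeta> / (eval_fps (fps_deriv v) \<zeta> * \<zeta> ^ (N + 1))\<bar> \<le> (2 * M * M2 / s) * (1 / s) ^ N"
      by (intro allI impI main(3)) auto
  qed (use r s M M2 in auto)
qed

section \<open>Gaussian moments\<close>

lemma power_le_fact_exp:
  fixes x :: real
  assumes "0 \<le> x"
  shows "x ^ k \<le> fact k * exp x"
proof -
  have "(\<Sum>i\<in>{k}. x ^ i /\<^sub>R fact i) \<le> (\<Sum>i. x ^ i /\<^sub>R fact i)"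
    by (rule sum_le_suminf[OF summable_exp_generic]) (use assms in auto)
  then show ?thesis by (simp add: exp_def field_simps)
qed

text \<open>Two factors e^u are split off: one absorbs u^k <= k! e^u, the other leaves the
  integrable majorant e^(-u). Hence B + 2 in the completed square.\<close>

lemma power_exp_quadratic_le:
  fixes A B u :: real
  assumes "0 < A" "0 \<le> u"
  shows "u ^ k * exp (- A * u\<^sup>2 + B * u) \<le> fact k * exp ((B + 2)\<^sup>2 / (4 * A)) * exp (- u)"
proof -
  have "- A * u\<^sup>2 + (B + 2) * u \<le> (B + 2)\<^sup>2 / (4 * A)"
  proof -
    have "0 \<le> (2 * A * u - (B + 2))\<^sup>2" by simp
    then have "(- A * u\<^sup>2 + (B + 2) * u) * (4 * A) \<le> (B + 2)\<^sup>2"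
      by (simp add: power2_eq_square algebra_simps)
    then show ?thesis using assms(1) by (simp add: field_simps)
  qed
  then have "- A * u\<^sup>2 + B * u + u \<le> (B + 2)\<^sup>2 / (4 * A) + (- u)"
    by (simp add: algebra_simps)
  then have "exp (- A * u\<^sup>2 + B * u + u) \<le> exp ((B + 2)\<^sup>2 / (4 * A) + (- u))" by simp
  then have e: "exp (- A * u\<^sup>2 + B * u) * exp u \<le> exp ((B + 2)\<^sup>2 / (4 * A)) * exp (- u)"
    by (simp only: exp_add)
  have "u ^ k * exp (- A * u\<^sup>2 + B * u) \<le> (fact k * exp u) * exp (- A * u\<^sup>2 + B * u)"
    using power_le_fact_exp[OF assms(2)] by (intro mult_right_mono) auto
  also have "\<dots> = fact k * (exp (- A * u\<^sup>2 + B * u) * exp u)" by (simp add: mult_ac)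
  also have "\<dots> \<le> fact k * (exp ((B + 2)\<^sup>2 / (4 * A)) * exp (- u))"
    using e by (intro mult_left_mono) auto
  finally show ?thesis by (simp add: mult_ac)
qed

lemma absolutely_integrable_power_gauss:
  fixes A B :: real
  assumes "0 < A"
  shows "(\<lambda>u. u ^ k * exp (- A * u\<^sup>2 + B * u)) absolutely_integrable_on {0..}"
proof (rule measurable_bounded_by_integrable_imp_absolutely_integrable)
  show "(\<lambda>u. u ^ k * exp (- A * u\<^sup>2 + B * u)) \<in> borel_measurable (lebesgue_on {0..})"
    by (intro continuous_imp_measurable_on_sets_lebesgue continuous_intros) auto
  show "(\<lambda>u. (fact k * exp ((B + 2)\<^sup>2 / (4 * A))) * exp (- u)) integrable_on {0..}"
    using integrable_on_exp_minus_to_infinity[of 1 0] by (intro integrable_on_mult_right) simp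
  show "norm (u ^ k * exp (- A * u\<^sup>2 + B * u)) \<le> (fact k * exp ((B + 2)\<^sup>2 / (4 * A))) * exp (- u)"
    if "u \<in> {0..}" for u
    using power_exp_quadratic_le[OF assms, of u k B] that by simp
qed auto

lemma has_integral_gauss_moment:
  fixes K :: real
  assumes "0 < K"
  shows "((\<lambda>p. p ^ (2 * n + 2) * exp (- K * p\<^sup>2)) has_integral
    (sqrt pi / 4 * (fact (2 * n + 1) / (4 ^ n * fact n)) / (K ^ (n + 1) * sqrt K))) {0..}"
proof -
  define c where "c = sqrt K"
  have c: "0 < c" "c ^ 2 = K" using assms by (auto simp: c_def)
  define I where "I = (sqrt pi / 2) * (fact (2 * (n + 1)) / (2 ^ (2 * (n + 1)) * fact (n + 1)))"
  have hb0: "has_bochner_integral lborel (\<lambda>x. indicator {0..} (0 + c * x) *\<^sub>R (exp (- (0 + c * x)\<^sup>2) * (0 + c * x) ^ (2 * (n + 1)))) (I /\<^sub>R \<bar>c\<bar>)"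
    using gaussian_moment_even_pos[of "n + 1"] c(1) unfolding I_def
    by (subst lborel_has_bochner_integral_real_affine_iff[symmetric]) auto
  have eq: "indicator {0..} (0 + c * x) *\<^sub>R (exp (- (0 + c * x)\<^sup>2) * (0 + c * x) ^ (2 * (n + 1)))
       = K ^ (n + 1) * (indicator {0..} x *\<^sub>R (x ^ (2 * n + 2) * exp (- K * x\<^sup>2)))" for x
  proof -
    have e1: "(c * x) ^ (2 * (n + 1)) = K ^ (n + 1) * x ^ (2 * n + 2)"
      by (simp only: power_mult_distrib power_mult c(2)) (simp add: power_mult power2_eq_square)
    have e2: "- (c * x)\<^sup>2 = - K * x\<^sup>2" by (simp add: power_mult_distrib c(2))
    have e3: "indicator {0..} (c * x) = (indicator {0..} x :: real)"
      using c(1) by (simp add: indicator_def zero_le_mult_iff)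
    show ?thesis unfolding add_0_left e1 e2 e3 by simp
  qed
  have "I /\<^sub>R \<bar>c\<bar> = I / c" using c(1) by (simp add: divide_inverse)
  with hb0 have hb: "has_bochner_integral lborel (\<lambda>x. K ^ (n + 1) * (indicator {0..} x *\<^sub>R (x ^ (2 * n + 2) * exp (- K * x\<^sup>2)))) (I / c)"
    by (simp only: eq)
  have "has_bochner_integral lborel (\<lambda>x. inverse (K ^ (n + 1)) * (K ^ (n + 1) * (indicator {0..} x *\<^sub>R (x ^ (2 * n + 2) * exp (- K * x\<^sup>2))))) (inverse (K ^ (n + 1)) * (I / c))"
    by (rule has_bochner_integral_mult_right[OF hb])
  moreover have "inverse (K ^ (n + 1)) * (K ^ (n + 1) * x) = x" for x
    using assms by (simp add: field_simps)
  ultimately have hb: "has_bochner_integral lborel (\<lambda>x. indicator {0..} x *\<^sub>R (x ^ (2 * n + 2) * exp (- K * x\<^sup>2))) (inverse (K ^ (n + 1)) * (I / c))"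
    by (simp only:)
  then have "set_integrable lborel {0..} (\<lambda>x. x ^ (2 * n + 2) * exp (- K * x\<^sup>2))"
    by (auto simp: set_integrable_def has_bochner_integral_iff)
  from set_borel_integral_eq_integral[OF this]
  have "((\<lambda>x. x ^ (2 * n + 2) * exp (- K * x\<^sup>2)) has_integral (LINT x:{0..}|lborel. x ^ (2 * n + 2) * exp (- K * x\<^sup>2))) {0..}"
    by (simp add: has_integral_integral)
  also have "(LINT x:{0..}|lborel. x ^ (2 * n + 2) * exp (- K * x\<^sup>2)) = inverse (K ^ (n + 1)) * (I / c)"
    using hb by (simp add: set_lebesgue_integral_def has_bochner_integral_iff)
  also have "\<dots> = sqrt pi / 4 * (fact (2 * n + 1) / (4 ^ n * fact n)) / (K ^ (n + 1) * sqrt K)"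
  proof -
    have "fact (2 * (n + 1)) = (2 * real (n + 1)) * fact (2 * n + 1)"
      by simp
    moreover have "fact (n + 1) = real (n + 1) * fact n" by simp
    moreover have "(2 :: real) ^ (2 * (n + 1)) = 4 * 4 ^ n" by (simp add: power_mult)
    ultimately have "I = (sqrt pi / 2) * ((2 * real (n + 1)) * fact (2 * n + 1) / (4 * 4 ^ n * (real (n + 1) * fact n)))"
      by (simp only: I_def)
    also have "\<dots> = sqrt pi / 4 * (fact (2 * n + 1) / (4 ^ n * fact n))"
    proof -
      have gen: "(s / 2) * ((2 * m) * a / (4 * p * (m * b))) = s / 4 * (a / (p * b))" if "m \<noteq> 0" for s m a p b :: real
        using that by simp
      show ?thesis by (rule gen) simp
    qed
    finally have I: "I = sqrt pi / 4 * (fact (2 * n + 1) / (4 ^ n * fact n))" .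
    show ?thesis unfolding I c_def by (simp only: divide_inverse inverse_mult_distrib mult_ac)
  qed
  finally show ?thesis .
qed

text \<open>The substitution p = 1/v(1/u) makes 1/u the solution \<zeta> of p v(\<zeta>) = 1. Its
  Jacobian v'(\<zeta>)/(u^2 v(\<zeta>)^2) cancels the derivative in the residue term, and T remains.
  The claim holds for all U beyond a threshold so that one U can serve both half-lines.\<close>

lemma half_integral:
  fixes v Y :: "real fps" and K :: real
  assumes v: "fps_nth v 0 = 0" "fps_nth v 1 > 0" and R: "0 < R" "fps_l1 R v M" "fps_l1 R Y M'" and K: "0 < K"
  defines "f \<equiv> \<lambda>N p. p\<^sup>2 * exp (- K * p\<^sup>2) * fps_nth (Y * inverse (1 - fps_const p * v)) N"
  defines "T \<equiv> \<lambda>N u. exp (- K / (eval_fps v (1 / u))\<^sup>2) / eval_fps v (1 / u) ^ 3 * eval_fps Y (1 / u) * u ^ (N + 1) / u\<^sup>2"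
  obtains U0 where "0 < U0" "\<And>U. U0 \<le> U \<Longrightarrow> (\<forall>u\<ge>U. 0 < eval_fps v (1 / u)) \<and>
     (\<exists>C D. 0 \<le> C \<and> 0 < D \<and> (\<forall>N. f N absolutely_integrable_on {0..} \<and> T N absolutely_integrable_on {U..} \<and>
        \<bar>integral {0..} (f N) - integral {U..} (T N)\<bar> \<le> C * D ^ N))"
proof -
  obtain r C1 D1 where r: "0 < r" "r < R" and CD: "0 \<le> C1" "0 < D1"
    and vpos: "\<forall>\<zeta>. 0 < \<zeta> \<longrightarrow> \<zeta> \<le> r \<longrightarrow> 0 < eval_fps v \<zeta>"
    and dvpos: "\<forall>\<zeta>. 0 \<le> \<zeta> \<longrightarrow> \<zeta> \<le> r \<longrightarrow> 0 < eval_fps (fps_deriv v) \<zeta>"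
    and res: "\<forall>\<zeta> N. 0 < \<zeta> \<longrightarrow> \<zeta> \<le> r \<longrightarrow>
       \<bar>fps_nth (Y * inverse (1 - fps_const (1 / eval_fps v \<zeta>) * v)) N
         - eval_fps v \<zeta> * eval_fps Y \<zeta> / (eval_fps (fps_deriv v) \<zeta> * \<zeta> ^ (N + 1))\<bar> \<le> C1 * D1 ^ N"
    by (rule kernel_residue[OF v R])
  define g where "g = (\<lambda>u. 1 / eval_fps v (1 / u))"
  define g' where "g' = (\<lambda>u. eval_fps (fps_deriv v) (1 / u) / (u\<^sup>2 * (eval_fps v (1 / u))\<^sup>2))"
  have radv: "ereal x < fps_conv_radius v" "ereal x < fps_conv_radius Y" "ereal x < fps_conv_radius (fps_deriv v)" if "x \<le> r" for x
  proof -
    have x: "ereal x < ereal R" using that r(2) by simp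
    show 1: "ereal x < fps_conv_radius v" "ereal x < fps_conv_radius Y"
      using x fps_l1_conv_radius[OF R(2,1)] fps_l1_conv_radius[OF R(3,1)] by (blast intro: less_le_trans)+
    from 1(1) fps_conv_radius_deriv[of v] show "ereal x < fps_conv_radius (fps_deriv v)"
      by (blast intro: less_le_trans)
  qed
  have f_int: "f N absolutely_integrable_on {0..}" for N
  proof -
    have "f N = (\<lambda>p. \<Sum>k\<le>N. fps_nth (Y * v ^ k) N * (p ^ (k + 2) * exp (- K * p\<^sup>2 + 0 * p)))"
      unfolding f_def kernel_nth[OF v(1)] by (auto simp: sum_distrib_left power_add power2_eq_square mult_ac fun_eq_iff)
    then show ?thesis
      using K by (simp only:) (intro absolutely_integrable_sum set_integrable_mult_right absolutely_integrable_power_gauss; simp)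
  qed
  show ?thesis
  proof (rule that[of "1 / r"])
    show "0 < 1 / r" using r by simp
    fix U assume U: "1 / r \<le> U"
    define S where "S = {U..}"
    have U0: "0 < U" using U r by (meson less_le_trans zero_less_divide_1_iff)
    have z: "0 < u \<and> 0 < 1 / u \<and> 1 / u \<le> r" if "U \<le> u" for u
    proof -
      have "1 / r \<le> u" "0 < u" using that U U0 by auto
      then show ?thesis using r by (simp add: field_simps)
    qed
    have vp: "0 < eval_fps v (1 / u)" if "U \<le> u" for u using z[OF that] vpos by blast
    have dvp: "0 < eval_fps (fps_deriv v) (1 / u)" if "U \<le> u" for u using z[OF that] dvpos less_imp_le by blast
    have derg: "(g has_field_derivative g' u) (at u)" if "U \<le> u" for u
    proof -
      have "(eval_fps v has_field_derivative eval_fps (fps_deriv v) (1 / u)) (at (1 / u))"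
        using radv z[OF that] by (intro has_field_derivative_eval_fps) auto
      moreover have "((\<lambda>u. 1 / u) has_field_derivative (- 1 / u\<^sup>2)) (at u)"
        using z[OF that] by (auto intro!: derivative_eq_intros simp: power2_eq_square field_simps)
      ultimately have "((\<lambda>u. eval_fps v (1 / u)) has_field_derivative eval_fps (fps_deriv v) (1 / u) * (- 1 / u\<^sup>2)) (at u)"
        by (rule DERIV_chain2)
      then have "((\<lambda>u. 1 / eval_fps v (1 / u)) has_field_derivative
          ((0 * eval_fps v (1 / u) - 1 * (eval_fps (fps_deriv v) (1 / u) * (- 1 / u\<^sup>2))) / (eval_fps v (1 / u) * eval_fps v (1 / u)))) (at u)"
        using vp[OF that] by (intro DERIV_divide DERIV_const) auto
      then show ?thesis by (simp add: g_def g'_def power2_eq_square)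
    qed
    have g'pos: "0 < g' u" if "U \<le> u" for u
      using z[OF that] vp[OF that] dvp[OF that] by (simp add: g'_def)
    have mono: "g a < g b" if "U \<le> a" "a < b" for a b
      using that(2)
    proof (rule DERIV_pos_imp_increasing)
      fix x assume "a \<le> x" "x \<le> b"
      with that have "U \<le> x" by simp
      then show "\<exists>y. (g has_real_derivative y) (at x) \<and> 0 < y" using derg g'pos by blast
    qed
    have inj: "inj_on g S"
      unfolding S_def by (intro linorder_inj_onI) (auto dest: mono)
    \<comment> \<open>Surjectivity: v(1/u) tends to 0, so 1/v(1/u) exceeds any given p, and the
      intermediate value theorem applies.\<close>
    have img: "g ` S = {g U..}"
    proof (intro equalityI subsetI)
      fix p assume "p \<in> g ` S"
      then show "p \<in> {g U..}" unfolding S_def using mono[of U] by (force simp: le_less)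
    next
      fix p assume p: "p \<in> {g U..}"
      have "0 < g U" using vp[of U] by (simp add: g_def)
      with p have p0: "0 < p" by auto
      have "isCont (eval_fps v) 0"
        using radv[of 0] r by (intro DERIV_isCont[OF has_field_derivative_eval_fps]) auto
      then have "eval_fps v \<midarrow>0\<rightarrow> 0" using v(1) by (simp add: isCont_def eval_fps_at_0)
      moreover have "filterlim (\<lambda>u :: real. 1 / u) (at 0) at_top"
        by (auto simp: filterlim_at intro!: tendsto_divide_0[OF tendsto_const] filterlim_ident filterlim_at_top_imp_at_infinity eventually_gt_at_top[THEN eventually_mono, of 0])
      ultimately have "((\<lambda>u. eval_fps v (1 / u)) \<longlongrightarrow> 0) at_top" by (rule filterlim_compose)
      then have "eventually (\<lambda>u. eval_fps v (1 / u) < 1 / p) at_top"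
        by (rule order_tendstoD) (use p0 in simp)
      then have "eventually (\<lambda>u. eval_fps v (1 / u) < 1 / p \<and> U \<le> u) at_top"
        using eventually_ge_at_top eventually_conj by blast
      then obtain u where u: "eval_fps v (1 / u) < 1 / p" "U \<le> u"
        by (auto dest!: eventually_happens)
      then have "p \<le> g u" using vp[of u] p0 by (simp add: g_def field_simps)
      moreover have "continuous_on {U..u} g"
        using derg by (intro continuous_at_imp_continuous_on ballI) (auto intro: DERIV_isCont)
      ultimately obtain x where "U \<le> x" "x \<le> u" "g x = p"
        using IVT'[of g U p u] p u by auto
      then show "p \<in> g ` S" unfolding S_def by auto
    qed
    have S: "S \<in> sets lebesgue" unfolding S_def by simp
    have derS: "(g has_field_derivative g' u) (at u within S)" if "u \<in> S" for u
      using derg that has_field_derivative_at_within unfolding S_def by blast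
    have cov: "(\<lambda>u. \<bar>g' u\<bar> * h (g u)) absolutely_integrable_on S"
      "integral S (\<lambda>u. \<bar>g' u\<bar> * h (g u)) = integral {g U..} h"
      if "h absolutely_integrable_on {g U..}" for h
      using has_absolute_integral_change_of_variables_1'[OF S derS inj, of h "integral {g U..} h"] that img
      by auto
    have gU: "0 < g U" using vp[of U] by (simp add: g_def)
    have sub: "{g U..} \<subseteq> {0..}" using gU by auto
    have f_int2: "f N absolutely_integrable_on {g U..}" for N
      by (rule set_integrable_subset[OF f_int _ sub]) simp
    \<comment> \<open>Majorant of the error of \<open>kernel_residue\<close> under the Gaussian
      weight; its integral is a constant times D1^N.\<close>
    define h where "h = (\<lambda>N p. (C1 * D1 ^ N) * (p ^ 2 * exp (- K * p\<^sup>2 + 0 * p)))"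
    have h0: "h N absolutely_integrable_on {0..}" for N
      unfolding h_def using K by (intro set_integrable_mult_right absolutely_integrable_power_gauss)
    have h_int: "h N absolutely_integrable_on {g U..}" for N
      by (rule set_integrable_subset[OF h0 _ sub]) simp
    define m2 where "m2 = integral {0..} (\<lambda>p. p ^ 2 * exp (- K * p\<^sup>2 + 0 * p))"
    have err: "\<bar>\<bar>g' u\<bar> * f N (g u) - T N u\<bar> \<le> \<bar>g' u\<bar> * h N (g u)" if "u \<in> S" for u N
    proof -
      have u: "U \<le> u" using that by (simp add: S_def)
      define \<zeta> where "\<zeta> = 1 / u"
      define Q where "Q = fps_nth (Y * inverse (1 - fps_const (1 / eval_fps v \<zeta>) * v)) N"
      define W where "W = eval_fps v \<zeta> * eval_fps Y \<zeta> / (eval_fps (fps_deriv v) \<zeta> * \<zeta> ^ (N + 1))"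
      have zz: "0 < \<zeta>" "\<zeta> \<le> r" "0 < eval_fps v \<zeta>" "0 < eval_fps (fps_deriv v) \<zeta>" "u = 1 / \<zeta>"
        using z[OF u] vp[OF u] dvp[OF u] by (auto simp: \<zeta>_def)
      have T: "T N u = \<bar>g' u\<bar> * ((g u)\<^sup>2 * exp (- K * (g u)\<^sup>2) * W)"
        using zz g'pos[OF u] unfolding T_def g_def W_def g'_def \<zeta>_def[symmetric]
        by (simp add: zz(5) power_divide field_simps power2_eq_square power3_eq_cube)
      have "\<bar>g' u\<bar> * f N (g u) - T N u = \<bar>g' u\<bar> * ((g u)\<^sup>2 * exp (- K * (g u)\<^sup>2) * (Q - W))"
        unfolding T f_def Q_def by (simp add: g_def \<zeta>_def[symmetric] right_diff_distrib)
      then have "\<bar>\<bar>g' u\<bar> * f N (g u) - T N u\<bar> = \<bar>g' u\<bar> * ((g u)\<^sup>2 * exp (- K * (g u)\<^sup>2) * \<bar>Q - W\<bar>)"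
        by (simp add: abs_mult)
      also have "\<dots> \<le> \<bar>g' u\<bar> * ((g u)\<^sup>2 * exp (- K * (g u)\<^sup>2) * (C1 * D1 ^ N))"
        using res[rule_format, OF zz(1,2), of N] unfolding Q_def W_def by (intro mult_left_mono) auto
      finally show ?thesis by (simp add: h_def mult_ac)
    qed
    have T_int: "T N absolutely_integrable_on S" for N
    proof (rule measurable_bounded_by_integrable_imp_absolutely_integrable[OF _ S])
      have rz: "ereal (1 / \<bar>u\<bar>) < fps_conv_radius v" "ereal (1 / \<bar>u\<bar>) < fps_conv_radius Y" if "U \<le> u" for u
        using z[OF that] radv[of "1 / \<bar>u\<bar>"] by auto
      have "continuous_on S (T N)"
        unfolding T_def using vp z rz
        by (intro continuous_intros) (auto simp: S_def less_imp_neq[THEN not_sym])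
      then show "T N \<in> borel_measurable (lebesgue_on S)"
        using S by (rule continuous_imp_measurable_on_sets_lebesgue)
      show "(\<lambda>u. norm (\<bar>g' u\<bar> * f N (g u)) + \<bar>g' u\<bar> * h N (g u)) integrable_on S"
        using cov(1)[OF f_int2] cov(1)[OF h_int] by (intro integrable_add) (auto simp: absolutely_integrable_on_def)
      show "norm (T N u) \<le> norm (\<bar>g' u\<bar> * f N (g u)) + \<bar>g' u\<bar> * h N (g u)" if "u \<in> S" for u
        using err[OF that, of N] unfolding real_norm_def by linarith
    qed
    \<comment> \<open>On 0 <= p <= g U, which the substitution does not reach, the crude bound on
      the kernel suffices.\<close>
    obtain C2 D2 where CD2: "0 \<le> C2" "0 < D2"
      "\<forall>p N. \<bar>p\<bar> \<le> g U \<longrightarrow> \<bar>fps_nth (Y * inverse (1 - fps_const p * v)) N\<bar> \<le> C2 * D2 ^ N"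
      by (rule kernel_bound[OF v(1) R less_imp_le[OF gU]])
    have bound: "\<bar>integral {0..} (f N) - integral S (T N)\<bar> \<le> (g U ^ 3 * C2 + C1 * \<bar>m2\<bar>) * (max D1 D2) ^ N" for N
    proof -
      have f1: "f N integrable_on {0..g U}"
        using set_integrable_subset[OF f_int, of "{0..g U}" N] by (auto simp: absolutely_integrable_on_def)
      have f2: "f N integrable_on {g U..}"
        using f_int2 by (auto simp: absolutely_integrable_on_def)
      have "integral ({0..g U} \<union> {g U..}) (f N) = integral {0..g U} (f N) + integral {g U..} (f N)"
        using f1 f2 gU by (intro integral_Un) auto
      moreover have "{0..g U} \<union> {g U..} = {0..}" using gU by auto
      ultimately have split: "integral {0..} (f N) = integral {0..g U} (f N) + integral {g U..} (f N)" by simp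
      have "norm (integral {0..g U} (f N)) \<le> integral {0..g U} (\<lambda>_. (g U)\<^sup>2 * (C2 * D2 ^ N))"
      proof (rule integral_norm_bound_integral[OF f1])
        fix p assume p: "p \<in> {0..g U}"
        have "norm (f N p) = (p\<^sup>2 * exp (- K * p\<^sup>2)) * \<bar>fps_nth (Y * inverse (1 - fps_const p * v)) N\<bar>"
          by (simp add: f_def abs_mult)
        also have "\<dots> \<le> ((g U)\<^sup>2 * 1) * (C2 * D2 ^ N)"
          using p K CD2(3)[rule_format, of p N] by (intro mult_mono power_mono) auto
        finally show "norm (f N p) \<le> (g U)\<^sup>2 * (C2 * D2 ^ N)" by simp
      qed auto
      also have "\<dots> = g U ^ 3 * C2 * D2 ^ N"
        using gU by (simp add: power2_eq_square power3_eq_cube)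
      finally have b1: "\<bar>integral {0..g U} (f N)\<bar> \<le> g U ^ 3 * C2 * D2 ^ N" by simp
      define E where "E = (\<lambda>u. \<bar>g' u\<bar> * f N (g u) - T N u)"
      have i1: "(\<lambda>u. \<bar>g' u\<bar> * f N (g u)) integrable_on S" and i2: "T N integrable_on S" and i3: "(\<lambda>u. \<bar>g' u\<bar> * h N (g u)) integrable_on S"
        using cov(1)[OF f_int2] T_int cov(1)[OF h_int] by (auto simp: absolutely_integrable_on_def)
      have "integral S E = integral {g U..} (f N) - integral S (T N)"
        unfolding E_def cov(2)[OF f_int2, symmetric] by (rule integral_diff[OF i1 i2])
      moreover have "norm (integral S E) \<le> integral S (\<lambda>u. \<bar>g' u\<bar> * h N (g u))"
        using err unfolding E_def by (intro integral_norm_bound_integral integrable_diff i1 i2 i3) auto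
      moreover have "integral S (\<lambda>u. \<bar>g' u\<bar> * h N (g u)) \<le> integral {0..} (h N)"
        unfolding cov(2)[OF h_int] using h_int[of N] h0[of N] sub CD
        by (intro integral_subset_le) (auto simp: absolutely_integrable_on_def h_def)
      moreover have "integral {0..} (h N) = C1 * D1 ^ N * m2"
        unfolding h_def m2_def by (rule integral_mult_right)
      moreover have "C1 * D1 ^ N * m2 \<le> C1 * D1 ^ N * \<bar>m2\<bar>"
        using CD by (intro mult_left_mono) auto
      ultimately have b2: "\<bar>integral {g U..} (f N) - integral S (T N)\<bar> \<le> C1 * D1 ^ N * \<bar>m2\<bar>" by simp
      have "\<bar>integral {0..} (f N) - integral S (T N)\<bar> \<le> g U ^ 3 * C2 * D2 ^ N + C1 * \<bar>m2\<bar> * D1 ^ N"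
        using b1 b2 unfolding split by (simp add: mult_ac)
      also have "\<dots> \<le> g U ^ 3 * C2 * (max D1 D2) ^ N + C1 * \<bar>m2\<bar> * (max D1 D2) ^ N"
        using CD CD2 gU by (intro add_mono mult_left_mono power_mono) auto
      finally show ?thesis by (simp add: distrib_right)
    qed
    show "(\<forall>u\<ge>U. 0 < eval_fps v (1 / u)) \<and>
     (\<exists>C D. 0 \<le> C \<and> 0 < D \<and> (\<forall>N. f N absolutely_integrable_on {0..} \<and> T N absolutely_integrable_on {U..} \<and>
        \<bar>integral {0..} (f N) - integral {U..} (T N)\<bar> \<le> C * D ^ N))"
      using vp f_int T_int bound CD CD2 gU unfolding S_def
      by (intro conjI exI[of _ "g U ^ 3 * C2 + C1 * \<bar>m2\<bar>"] exI[of _ "max D1 D2"]) auto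
  qed
qed

section \<open>Laplace's method\<close>

text \<open>The expression inside the modulus vanishes at 0 and has derivative x^2/(1 + x), at most
  2 x^2 for x >= -1/2.\<close>

lemma ln_one_plus_taylor2:
  fixes x :: real
  assumes "- 1 / 2 \<le> x"
  shows "\<bar>ln (1 + x) - x + x\<^sup>2 / 2\<bar> \<le> 2 * \<bar>x\<bar> ^ 3"
proof -
  define f where "f = (\<lambda>x :: real. ln (1 + x) - x + x\<^sup>2 / 2)"
  have df: "(f has_real_derivative y\<^sup>2 / (1 + y)) (at y)" if "- 1 / 2 \<le> y" for y
    unfolding f_def using that
    by (auto intro!: derivative_eq_intros simp: field_simps power2_eq_square)
  have f0: "f 0 = 0" by (simp add: f_def)
  show ?thesis
  proof (cases "x = 0")
    case False
    have "\<exists>z. \<bar>z\<bar> \<le> \<bar>x\<bar> \<and> - 1 / 2 \<le> z \<and> f x - f 0 = x * (z\<^sup>2 / (1 + z))"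
    proof (cases "x > 0")
      case True
      then obtain z where "0 < z" "z < x" "f x - f 0 = (x - 0) * (z\<^sup>2 / (1 + z))"
        using MVT2[of 0 x f "\<lambda>y. y\<^sup>2 / (1 + y)"] df by force
      then show ?thesis by (intro exI[of _ z]) auto
    next
      case False
      with \<open>x \<noteq> 0\<close> have "x < 0" by simp
      then obtain z where "x < z" "z < 0" "f 0 - f x = (0 - x) * (z\<^sup>2 / (1 + z))"
        using MVT2[of x 0 f "\<lambda>y. y\<^sup>2 / (1 + y)"] df assms by force
      then show ?thesis using assms by (intro exI[of _ z]) auto
    qed
    then obtain z where z: "\<bar>z\<bar> \<le> \<bar>x\<bar>" "- 1 / 2 \<le> z" "f x = x * (z\<^sup>2 / (1 + z))"
      using f0 by auto
    have "z\<^sup>2 / (1 + z) \<le> z\<^sup>2 / (1 / 2)"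
      using z(2) by (intro divide_left_mono) auto
    also have "\<dots> \<le> 2 * \<bar>x\<bar>\<^sup>2" using z(1) abs_le_square_iff[of z x] by simp
    finally have "\<bar>x\<bar> * (z\<^sup>2 / (1 + z)) \<le> \<bar>x\<bar> * (2 * \<bar>x\<bar>\<^sup>2)"
      by (intro mult_left_mono) auto
    moreover have "\<bar>f x\<bar> = \<bar>x\<bar> * (z\<^sup>2 / (1 + z))"
      unfolding z(3) using z(2) by (simp add: abs_mult)
    ultimately show ?thesis by (simp add: f_def power2_eq_square power3_eq_cube)
  qed simp
qed

lemma abs_exp_diff_le:
  fixes a b c :: real
  assumes "a \<le> c" "b \<le> c"
  shows "\<bar>exp a - exp b\<bar> \<le> \<bar>a - b\<bar> * exp c"
proof -
  have *: "exp y - exp x \<le> (y - x) * exp c" if "x \<le> y" "y \<le> c" for x y :: real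
  proof -
    have "1 - (y - x) \<le> exp (x - y)" using exp_ge_add_one_self[of "x - y"] by linarith
    then have "exp y * (1 - exp (x - y)) \<le> exp c * (y - x)"
      using that by (intro mult_mono) auto
    moreover have "exp y * (1 - exp (x - y)) = exp y - exp x"
      by (simp add: right_diff_distrib exp_diff)
    ultimately show ?thesis by (simp add: mult.commute)
  qed
  show ?thesis
  proof (cases "a \<le> b")
    case True
    then show ?thesis using *[of a b] assms by (simp add: abs_if)
  next
    case False
    then show ?thesis using *[of b a] assms by (simp add: abs_if)
  qed
qed

lemma integrable_abs_power_gauss:
  fixes A B :: real
  assumes "0 < A"
  shows "integrable lborel (\<lambda>y. \<bar>y\<bar> ^ k * exp (- A * y\<^sup>2 + B * y))"
proof -
  have half: "integrable lborel (\<lambda>y. indicator {0..} y * (y ^ k * exp (- A * y\<^sup>2 + b * y)))" for b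
  proof -
    have "integrable lebesgue (\<lambda>y. indicator {0..} y *\<^sub>R (y ^ k * exp (- A * y\<^sup>2 + b * y)))"
      using absolutely_integrable_power_gauss[OF assms, of k b] by (simp add: set_integrable_def)
    then show ?thesis by (subst (asm) integrable_completion) auto
  qed
  have "integrable lborel (\<lambda>y. indicator {0..} (0 + (-1) * y) * ((0 + (-1) * y) ^ k * exp (- A * (0 + (-1) * y)\<^sup>2 + (- B) * (0 + (-1) * y))))"
    by (rule lborel_integrable_real_affine[OF half]) simp
  from Bochner_Integration.integrable_add[OF half[of B] this]
  have "integrable lborel (\<lambda>y. indicator {0..} y * (y ^ k * exp (- A * y\<^sup>2 + B * y)) +
     indicator {0..} (- y) * ((- y) ^ k * exp (- A * y\<^sup>2 + B * y)))" by simp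
  then show ?thesis
  proof (rule Bochner_Integration.integrable_bound)
    show "AE y in lborel. norm (\<bar>y\<bar> ^ k * exp (- A * y\<^sup>2 + B * y)) \<le> norm (indicator {0..} y * (y ^ k * exp (- A * y\<^sup>2 + B * y)) +
     indicator {0..} (- y) * ((- y) ^ k * exp (- A * y\<^sup>2 + B * y)))"
    proof (intro AE_I2)
      fix y :: real
      show "norm (\<bar>y\<bar> ^ k * exp (- A * y\<^sup>2 + B * y)) \<le> norm (indicator {0..} y * (y ^ k * exp (- A * y\<^sup>2 + B * y)) +
        indicator {0..} (- y) * ((- y) ^ k * exp (- A * y\<^sup>2 + B * y)))"
        by (cases "y = 0"; cases "0 < y") (auto simp: abs_mult power_abs)
    qed
  qed measurable
qed

lemma integral_gauss_linear:
  fixes A B :: real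
  assumes "0 < A"
  shows "integrable lborel (\<lambda>y. exp (- 2 * A * y\<^sup>2 + B * y))"
    "(LINT y|lborel. exp (- 2 * A * y\<^sup>2 + B * y)) = sqrt (pi / (2 * A)) * exp (B\<^sup>2 / (8 * A))"
proof -
  show "integrable lborel (\<lambda>y. exp (- 2 * A * y\<^sup>2 + B * y))"
    using integrable_abs_power_gauss[of "2 * A" 0 B] assms by simp
  define \<sigma> where "\<sigma> = 1 / (2 * sqrt A)"
  define \<mu> where "\<mu> = B / (4 * A)"
  have s: "0 < \<sigma>" "\<sigma>\<^sup>2 = 1 / (4 * A)" using assms by (auto simp: \<sigma>_def power_divide power_mult_distrib)
  have "exp (- 2 * A * y\<^sup>2 + B * y) = (sqrt (pi / (2 * A)) * exp (B\<^sup>2 / (8 * A))) * normal_density \<mu> \<sigma> y" for y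
  proof -
    have "- (y - \<mu>)\<^sup>2 / (2 * \<sigma>\<^sup>2) = - 2 * A * y\<^sup>2 + B * y - B\<^sup>2 / (8 * A)"
      unfolding s(2) \<mu>_def using assms by (simp add: power2_eq_square field_simps)
    moreover have "sqrt (2 * pi * \<sigma>\<^sup>2) = sqrt (pi / (2 * A))" unfolding s(2) by simp
    moreover have "0 < sqrt (pi / (2 * A))" using assms by simp
    ultimately show ?thesis
      using assms by (simp only: normal_density_def) (simp add: exp_diff)
  qed
  then have "(LINT y|lborel. exp (- 2 * A * y\<^sup>2 + B * y))
      = (LINT y|lborel. (sqrt (pi / (2 * A)) * exp (B\<^sup>2 / (8 * A))) * normal_density \<mu> \<sigma> y)" by presburger
  also have "\<dots> = sqrt (pi / (2 * A)) * exp (B\<^sup>2 / (8 * A))"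
    using s by simp
  finally show "(LINT y|lborel. exp (- 2 * A * y\<^sup>2 + B * y)) = sqrt (pi / (2 * A)) * exp (B\<^sup>2 / (8 * A))" .
qed

text \<open>At the maximum u0 of u^M exp(- A u^2), put u = u0 + y and x = y/u0. Relative to its
  value at u0 the integrand is exp(M (ln(1 + x) - x) - A y^2 + B y). As M x^2/2 = A y^2, its limit
  is exp(- 2 A y^2 + B y). The factor exp(B u) has no part in the choice of u0; it shows up as
  exp(B^2/(8 A)).\<close>

lemma laplace_power_gauss:
  fixes A B :: real
  assumes A: "0 < A"
  obtains C where "0 \<le> C" "\<forall>M\<ge>1. integrable lborel (\<lambda>u. indicator {0<..} u * (u powr M * exp (- A * u\<^sup>2 + B * u))) \<and>
     \<bar>(LINT u|lborel. indicator {0<..} u * (u powr M * exp (- A * u\<^sup>2 + B * u)))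
       - sqrt (M / (2 * A)) powr M * exp (- M / 2 + B * sqrt (M / (2 * A))) * (sqrt (pi / (2 * A)) * exp (B\<^sup>2 / (8 * A)))\<bar>
      \<le> C / sqrt M * (sqrt (M / (2 * A)) powr M * exp (- M / 2 + B * sqrt (M / (2 * A))))"
proof -
  define I3 where "I3 = (LINT y|lborel. \<bar>y\<bar> ^ 3 * exp (- A * y\<^sup>2 + B * y))"
  \<comment> \<open>Chosen so that 8 M |x|^3 = c |y|^3 / sqrt M for x = y/u0.\<close>
  define c where "c = 8 * sqrt (2 * A) ^ 3"
  have c: "0 \<le> c" using A by (simp add: c_def)
  have I3: "0 \<le> I3" unfolding I3_def by (intro integral_nonneg_AE) auto
  define F where "F = (\<lambda>M u. indicator {0<..} u * (u powr M * exp (- A * u\<^sup>2 + B * u)))"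
  have main: "integrable lborel (F M) \<and> \<bar>(LINT u|lborel. F M u)
       - sqrt (M / (2 * A)) powr M * exp (- M / 2 + B * sqrt (M / (2 * A))) * (sqrt (pi / (2 * A)) * exp (B\<^sup>2 / (8 * A)))\<bar>
      \<le> (c * I3) / sqrt M * (sqrt (M / (2 * A)) powr M * exp (- M / 2 + B * sqrt (M / (2 * A))))" if M: "1 \<le> M" for M
  proof -
    define u0 where "u0 = sqrt (M / (2 * A))"
    have u0: "0 < u0" "u0\<^sup>2 = M / (2 * A)" "2 * A * u0\<^sup>2 = M" using A M by (auto simp: u0_def)
    define W where "W = u0 powr M * exp (- M / 2 + B * u0)"
    have W: "0 < W" using u0 by (simp add: W_def)
    define \<phi> where "\<phi> = (\<lambda>y. indicator {- u0<..} y * exp (M * (ln (1 + y / u0) - y / u0) - A * y\<^sup>2 + B * y))"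
    define \<psi> where "\<psi> = (\<lambda>y. exp (- 2 * A * y\<^sup>2 + B * y))"
    have F\<phi>: "F M (u0 + 1 * y) = W * \<phi> y" for y
    proof (cases "- u0 < y")
      case True
      have "(u0 + y) powr M = u0 powr M * exp (M * ln (1 + y / u0))"
      proof -
        have "u0 + y = u0 * (1 + y / u0)" using u0 by (simp add: field_simps)
        moreover have "0 < 1 + y / u0" using True u0 by (simp add: field_simps)
        ultimately show ?thesis using u0 by (simp add: powr_mult powr_def[of "1 + y / u0"])
      qed
      moreover have "- A * (u0 + y)\<^sup>2 + B * (u0 + y) = - M / 2 + B * u0 + (- M * (y / u0) - A * y\<^sup>2 + B * y)"
      proof -
        have "M * (y / u0) = 2 * A * u0 * y"
          unfolding u0(3)[symmetric] using u0(1) by (simp add: power2_eq_square)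
        then show ?thesis using u0(3) by (simp add: power2_eq_square algebra_simps)
      qed
      ultimately have "(u0 + y) powr M * exp (- A * (u0 + y)\<^sup>2 + B * (u0 + y))
          = W * exp (M * ln (1 + y / u0) + (- M * (y / u0) - A * y\<^sup>2 + B * y))"
        by (simp only: exp_add W_def mult_ac)
      also have "M * ln (1 + y / u0) + (- M * (y / u0) - A * y\<^sup>2 + B * y) = M * (ln (1 + y / u0) - y / u0) - A * y\<^sup>2 + B * y"
        by (simp add: algebra_simps)
      finally show ?thesis using True by (simp add: F_def \<phi>_def)
    qed (simp add: F_def \<phi>_def)
    \<comment> \<open>By ln(1 + x) <= x both integrands lie below exp(- A y^2 + B y), so the cubic
      bound holds pointwise on the whole line and no central region has to be cut out.\<close>
    have bd: "\<bar>\<phi> y - \<psi> y\<bar> \<le> c / sqrt M * (\<bar>y\<bar> ^ 3 * exp (- A * y\<^sup>2 + B * y))" for y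
    proof -
      define x where "x = y / u0"
      have x3: "8 * (M * \<bar>x\<bar> ^ 3) = c / sqrt M * \<bar>y\<bar> ^ 3"
      proof -
        have "u0 ^ 3 = M * sqrt M / sqrt (2 * A) ^ 3"
          using M by (simp add: u0_def real_sqrt_divide power_divide power3_eq_cube)
        then show ?thesis
          using M u0(1) A by (simp add: x_def c_def power_divide abs_divide field_simps)
      qed
      have Mx2: "M * (x\<^sup>2 / 2) = A * y\<^sup>2"
      proof -
        have "M * (x\<^sup>2 / 2) = A * (u0\<^sup>2 * x\<^sup>2)" unfolding u0(3)[symmetric] by simp
        also have "u0\<^sup>2 * x\<^sup>2 = y\<^sup>2" using u0(1) by (simp add: x_def power_divide)
        finally show ?thesis .
      qed
      have \<psi>le: "- 2 * A * y\<^sup>2 + B * y \<le> - A * y\<^sup>2 + B * y" using A by simp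
      show ?thesis
      proof (cases "- 1 / 2 \<le> x")
        case True
        then have "- u0 < y" using u0(1) by (simp add: x_def field_simps)
        then have \<phi>: "\<phi> y = exp (M * (ln (1 + x) - x) - A * y\<^sup>2 + B * y)" by (simp add: \<phi>_def x_def)
        have "ln (1 + x) \<le> x" using ln_add_one_self_le_self2[of x] True by simp
        then have \<phi>le: "M * (ln (1 + x) - x) - A * y\<^sup>2 + B * y \<le> - A * y\<^sup>2 + B * y"
          using M by (simp add: mult_nonneg_nonpos)
        have "\<bar>(M * (ln (1 + x) - x) - A * y\<^sup>2 + B * y) - (- 2 * A * y\<^sup>2 + B * y)\<bar> = \<bar>M * (ln (1 + x) - x + x\<^sup>2 / 2)\<bar>"
          using Mx2 by (intro arg_cong[of _ _ abs]) (simp add: algebra_simps)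
        also have "\<dots> \<le> M * (2 * \<bar>x\<bar> ^ 3)"
          using ln_one_plus_taylor2[OF True] M by (simp add: abs_mult)
        also have "\<dots> \<le> c / sqrt M * \<bar>y\<bar> ^ 3" unfolding x3[symmetric] using M by simp
        finally have d: "\<bar>(M * (ln (1 + x) - x) - A * y\<^sup>2 + B * y) - (- 2 * A * y\<^sup>2 + B * y)\<bar> \<le> c / sqrt M * \<bar>y\<bar> ^ 3" .
        have "\<bar>\<phi> y - \<psi> y\<bar> \<le> \<bar>(M * (ln (1 + x) - x) - A * y\<^sup>2 + B * y) - (- 2 * A * y\<^sup>2 + B * y)\<bar> * exp (- A * y\<^sup>2 + B * y)"
          unfolding \<phi> \<psi>_def by (rule abs_exp_diff_le[OF \<phi>le \<psi>le])
        also have "\<dots> \<le> (c / sqrt M * \<bar>y\<bar> ^ 3) * exp (- A * y\<^sup>2 + B * y)"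
          using d by (intro mult_right_mono) auto
        finally show ?thesis by (simp add: mult.assoc)
      next
        case False
        have "0 \<le> \<phi> y" "0 \<le> \<psi> y" by (auto simp: \<phi>_def \<psi>_def)
        moreover have "\<psi> y \<le> exp (- A * y\<^sup>2 + B * y)" using \<psi>le by (simp add: \<psi>_def)
        moreover have "\<phi> y \<le> exp (- A * y\<^sup>2 + B * y)"
        proof (cases "- u0 < y")
          case True
          then have "- 1 < x" using u0(1) by (simp add: x_def field_simps)
          then have "ln (1 + x) \<le> x" using ln_add_one_self_le_self2[of x] by simp
          then have "M * (ln (1 + x) - x) - A * y\<^sup>2 + B * y \<le> - A * y\<^sup>2 + B * y"
            using M by (simp add: mult_nonneg_nonpos)
          then show ?thesis using True by (simp add: \<phi>_def x_def)
        qed (simp add: \<phi>_def)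
        ultimately have "\<bar>\<phi> y - \<psi> y\<bar> \<le> 1 * exp (- A * y\<^sup>2 + B * y)" by simp
        also have "\<dots> \<le> (c / sqrt M * \<bar>y\<bar> ^ 3) * exp (- A * y\<^sup>2 + B * y)"
        proof (rule mult_right_mono)
          have "(1 / 2) ^ 3 \<le> \<bar>x\<bar> ^ 3" using False by (intro power_mono) auto
          then have "1 \<le> 8 * \<bar>x\<bar> ^ 3" by (simp add: power3_eq_cube)
          also have "\<dots> \<le> 8 * (M * \<bar>x\<bar> ^ 3)" using M by (simp add: mult_le_cancel_right1)
          finally show "1 \<le> c / sqrt M * \<bar>y\<bar> ^ 3" by (simp add: x3)
        qed simp
        finally show ?thesis by (simp add: mult.assoc)
      qed
    qed
    have int3: "integrable lborel (\<lambda>y. c / sqrt M * (\<bar>y\<bar> ^ 3 * exp (- A * y\<^sup>2 + B * y)))"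
      by (intro integrable_mult_right integrable_abs_power_gauss A)
    have int\<psi>: "integrable lborel \<psi>" unfolding \<psi>_def by (rule integral_gauss_linear(1)[OF A])
    have m\<phi>: "\<phi> \<in> borel_measurable lborel" unfolding \<phi>_def by measurable
    have m\<psi>: "\<psi> \<in> borel_measurable lborel" unfolding \<psi>_def by measurable
    have intd: "integrable lborel (\<lambda>y. \<phi> y - \<psi> y)"
      by (rule Bochner_Integration.integrable_bound[OF int3])
         (use m\<phi> m\<psi> in measurable, use order_trans[OF bd abs_ge_self] in \<open>auto simp only: real_norm_def\<close>)
    have int\<phi>: "integrable lborel \<phi>"
      using Bochner_Integration.integrable_add[OF intd int\<psi>] by simp
    have "integrable lborel (\<lambda>y. F M (u0 + 1 * y))"
      unfolding F\<phi> using int\<phi> by simp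
    then have 1: "integrable lborel (F M)"
      by (subst (asm) lborel_integrable_real_affine_iff) auto
    have "(LINT u|lborel. F M u) = \<bar>1\<bar> *\<^sub>R (LINT y|lborel. F M (u0 + 1 * y))"
      by (rule lborel_integral_real_affine) simp
    then have eq: "(LINT u|lborel. F M u) = W * (LINT y|lborel. \<phi> y)" unfolding F\<phi> by simp
    have "\<bar>(LINT y|lborel. \<phi> y) - (LINT y|lborel. \<psi> y)\<bar> = norm (LINT y|lborel. \<phi> y - \<psi> y)"
      using int\<phi> int\<psi> by simp
    also have "\<dots> \<le> (LINT y|lborel. c / sqrt M * (\<bar>y\<bar> ^ 3 * exp (- A * y\<^sup>2 + B * y)))"
      by (rule Bochner_Integration.integral_norm_bound_integral[OF intd int3]) (use bd in auto)
    also have "\<dots> = c / sqrt M * I3" unfolding I3_def by simp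
    finally have d: "\<bar>(LINT y|lborel. \<phi> y) - (LINT y|lborel. \<psi> y)\<bar> \<le> c / sqrt M * I3" .
    have "\<bar>(LINT u|lborel. F M u) - W * (LINT y|lborel. \<psi> y)\<bar> = W * \<bar>(LINT y|lborel. \<phi> y) - (LINT y|lborel. \<psi> y)\<bar>"
      unfolding eq using W by (simp add: abs_mult flip: right_diff_distrib)
    also have "\<dots> \<le> W * (c / sqrt M * I3)" using d W by (intro mult_left_mono) auto
    finally have "\<bar>(LINT u|lborel. F M u) - W * (LINT y|lborel. \<psi> y)\<bar> \<le> c * I3 / sqrt M * W"
      by (simp add: mult_ac)
    then show ?thesis
      using 1 integral_gauss_linear(2)[OF A, of B] unfolding W_def u0_def \<psi>_def by simp
  qed
  show ?thesis
    by (rule that[of "c * I3"]) (use main c I3 in \<open>auto simp: F_def\<close>)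
qed

section \<open>The normalising scale and relative errors of order N^(-1/2)\<close>

lemma cmult_bigo: "f \<in> O[F](g) \<Longrightarrow> (\<lambda>x. c * f x) \<in> O[F](g)"
  for c :: real
  by (cases "c = 0") simp_all

lemma exp_minus_one_bigo:
  fixes f :: "nat \<Rightarrow> real"
  assumes "f \<in> O(\<lambda>n. real n powr (-1/2))"
  shows "(\<lambda>n. exp (f n) - 1) \<in> O(\<lambda>n. real n powr (-1/2))"
proof -
  have "(\<lambda>n. real n powr (-1/2)) \<longlonglongrightarrow> 0" by real_asymp
  then have "(\<lambda>n::nat. real n powr (-1/2)) \<in> o(\<lambda>_. 1)" by (simp add: smalloI_tendsto)
  with assms have "f \<in> o(\<lambda>_. 1)" by (rule landau_o.big_small_trans)
  then have "f \<longlonglongrightarrow> 0" using smalloD_tendsto by fastforce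
  then have "eventually (\<lambda>n. \<bar>f n\<bar> < 1) sequentially"
    by (intro order_tendstoD(2)[OF tendsto_rabs_zero]) auto
  then have "(\<lambda>n. exp (f n) - 1) \<in> O(f)"
  proof (intro bigoI[where c = "exp 1"], eventually_elim)
    case (elim n)
    have "\<bar>exp (f n) - exp 0\<bar> \<le> \<bar>f n - 0\<bar> * exp 1"
      using elim by (intro abs_exp_diff_le) auto
    then show ?case by (simp add: mult.commute)
  qed
  with assms show ?thesis by (rule landau_o.big_trans[rotated])
qed

text \<open>
  The function \<open>u\<^sup>M * exp (- A * u\<^sup>2)\<close> is maximal at \<open>u = sqrt (M / (2 * A))\<close>, and \<open>laplace_main\<close> is the
  integrand with its factor \<open>exp (B * u)\<close> at this point. For \<open>M = N + t\<close> it is \<open>laplace_scale\<close> up to a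
  relative error of order \<open>1 / sqrt N\<close>.
\<close>

definition laplace_main :: "real \<Rightarrow> real \<Rightarrow> real \<Rightarrow> real" where
  "laplace_main A B M = sqrt (M / (2 * A)) powr M * exp (- M / 2 + B * sqrt (M / (2 * A)))"

definition laplace_scale :: "real \<Rightarrow> real \<Rightarrow> real \<Rightarrow> real \<Rightarrow> real" where
  "laplace_scale A B t N = exp (B * sqrt (N / (2 * A))) * (N / (2 * A * exp 1)) powr (N / 2) * (N / (2 * A)) powr (t / 2)"

lemma laplace_scale_exp:
  assumes "0 < A" "0 < N"
  shows "laplace_scale A B t N = exp (B * sqrt (N / (2 * A)) + N / 2 * (ln N - ln (2 * A) - 1) + t / 2 * (ln N - ln (2 * A)))"
proof -
  have "ln (N / (2 * A * exp 1)) = ln N - ln (2 * A) - 1"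
    using assms by (simp add: ln_div ln_mult)
  moreover have "ln (N / (2 * A)) = ln N - ln (2 * A)"
    using assms by (simp add: ln_div)
  ultimately show ?thesis
    using assms unfolding laplace_scale_def by (simp add: powr_def exp_add)
qed

lemma laplace_scale_pos: "0 < A \<Longrightarrow> 0 < N \<Longrightarrow> 0 < laplace_scale A B t N"
  by (simp add: laplace_scale_exp)

lemma laplace_main_asymp:
  assumes A: "0 < A"
  shows "(\<lambda>N. laplace_main A B (real N + t) / laplace_scale A B t (real N) - 1) \<in> O(\<lambda>N. real N powr (-1/2))"
proof -
  define b where "b = B / sqrt (2 * A)"
  \<comment> \<open>The logarithm of the quotient. Its first two parts are O(1/N); the last, from
    exp(B u) at two different maxima, is in general of order N^(-1/2) and limits the
    precision.\<close>
  define E where "E = (\<lambda>N::nat. 1 / 2 * (real N * ln (1 + t / real N) - t) + t / 2 * ln (1 + t / real N) + b * (sqrt (real N + t) - sqrt (real N)))"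
  have "E \<in> O(\<lambda>N. real N powr (-1/2))"
  proof (cases "t = 0")
    case False
    have 1: "(\<lambda>N::nat. real N * ln (1 + t / real N) - t) \<in> O(\<lambda>N. real N powr (-1/2))"
      using False by real_asymp
    have 2: "(\<lambda>N::nat. ln (1 + t / real N)) \<in> O(\<lambda>N. real N powr (-1/2))"
      using False by real_asymp
    have 3: "(\<lambda>N::nat. sqrt (real N + t) - sqrt (real N)) \<in> O(\<lambda>N. real N powr (-1/2))"
      using False by real_asymp
    show ?thesis unfolding E_def
      by (intro sum_in_bigo(1) cmult_bigo 1 2 3)
  qed (simp add: E_def)
  then have "(\<lambda>n. exp (E n) - 1) \<in> O(\<lambda>N. real N powr (-1/2))"
    by (rule exp_minus_one_bigo)
  moreover have "eventually (\<lambda>N. exp (E N) - 1 = laplace_main A B (real N + t) / laplace_scale A B t (real N) - 1) sequentially"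
    using eventually_gt_at_top[of "nat \<lceil>\<bar>t\<bar>\<rceil>"]
  proof eventually_elim
    case (elim N)
    then have N: "0 < real N" "0 < real N + t" by linarith+
    have l: "ln (1 + t / real N) = ln (real N + t) - ln (real N)"
    proof -
      have "1 + t / real N = (real N + t) / real N" using N by (simp add: field_simps)
      then show ?thesis using N by (simp add: ln_div)
    qed
    have s: "B * sqrt ((real N + t) / (2 * A)) - B * sqrt (real N / (2 * A)) = b * (sqrt (real N + t) - sqrt (real N))"
      by (simp add: b_def real_sqrt_divide right_diff_distrib diff_divide_distrib)
    have "laplace_main A B (real N + t) = exp ((real N + t) * (ln (real N + t) - ln (2 * A)) / 2 - (real N + t) / 2 + B * sqrt ((real N + t) / (2 * A)))"
    proof -
      have "ln (sqrt ((real N + t) / (2 * A))) = (ln (real N + t) - ln (2 * A)) / 2"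
        using N A by (simp add: ln_sqrt ln_div)
      moreover have "sqrt ((real N + t) / (2 * A)) \<noteq> 0" using N A by simp
      ultimately have "sqrt ((real N + t) / (2 * A)) powr (real N + t) = exp ((real N + t) * ((ln (real N + t) - ln (2 * A)) / 2))"
        by (simp only: powr_def if_False)
      then show ?thesis unfolding laplace_main_def by (simp only: flip: exp_add) (simp add: field_simps)
    qed
    then have "laplace_main A B (real N + t) / laplace_scale A B t (real N) = exp (((real N + t) * (ln (real N + t) - ln (2 * A)) / 2 - (real N + t) / 2 + B * sqrt ((real N + t) / (2 * A)))
      - (B * sqrt (real N / (2 * A)) + real N / 2 * (ln (real N) - ln (2 * A) - 1) + t / 2 * (ln (real N) - ln (2 * A))))"
      using N A by (simp add: laplace_scale_exp exp_diff)
    also have "((real N + t) * (ln (real N + t) - ln (2 * A)) / 2 - (real N + t) / 2 + B * sqrt ((real N + t) / (2 * A)))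
      - (B * sqrt (real N / (2 * A)) + real N / 2 * (ln (real N) - ln (2 * A) - 1) + t / 2 * (ln (real N) - ln (2 * A))) = E N"
      unfolding E_def l s[symmetric] by (simp add: field_simps)
    finally show ?case by simp
  qed
  ultimately show ?thesis by (simp only: landau_o.big.in_cong)
qed

text \<open>The scale contains N^(N/2), which outgrows every D^N.\<close>

lemma power_negligible:
  assumes A: "0 < A" and D: "0 < D"
  shows "(\<lambda>N. D ^ N / laplace_scale A B t (real N)) \<in> O(\<lambda>N. real N powr (-1/2))"
proof -
  define d where "d = ln D + (ln (2 * A) + 1) / 2"
  define b where "b = B / sqrt (2 * A)"
  define t' where "t' = t / 2"
  define e where "e = t / 2 * ln (2 * A)"
  have "(\<lambda>N::nat. exp (d * real N - b * sqrt (real N) - real N * ln (real N) / 2 - t' * ln (real N) + e)) \<in> O(\<lambda>N. real N powr (-1/2))"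
    by real_asymp
  moreover have "eventually (\<lambda>N. exp (d * real N - b * sqrt (real N) - real N * ln (real N) / 2 - t' * ln (real N) + e)
      = D ^ N / laplace_scale A B t (real N)) sequentially"
    using eventually_gt_at_top[of 0]
  proof eventually_elim
    case (elim N)
    have "D ^ N = exp (real N * ln D)" using D by (simp add: exp_of_nat_mult)
    then have "D ^ N / laplace_scale A B t (real N) = exp (real N * ln D
      - (B * sqrt (real N / (2 * A)) + real N / 2 * (ln (real N) - ln (2 * A) - 1) + t / 2 * (ln (real N) - ln (2 * A))))"
      using elim A by (simp add: laplace_scale_exp exp_diff)
    then show ?case
      by (simp add: d_def b_def t'_def e_def real_sqrt_divide field_simps)
  qed
  ultimately show ?thesis by (simp only: landau_o.big.in_cong)
qed

definition gauss_moment :: "real \<Rightarrow> real \<Rightarrow> real \<Rightarrow> real" where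
  "gauss_moment A B M = (LINT u|lborel. indicator {0<..} u * (u powr M * exp (- A * u\<^sup>2 + B * u)))"

text \<open>The integral of exp(- 2 A y^2 + B y) over the line, the limit in Laplace's
  method.\<close>

definition gauss_const :: "real \<Rightarrow> real \<Rightarrow> real" where
  "gauss_const A B = sqrt (pi / (2 * A)) * exp (B\<^sup>2 / (8 * A))"

lemma powr_minus_half_bigo_1: "(\<lambda>n::nat. real n powr (-1/2)) \<in> O(\<lambda>_. 1)"
  by real_asymp

lemma gauss_moment_asymp:
  assumes A: "0 < A"
  shows "(\<lambda>N. gauss_moment A B (real N + t) / laplace_scale A B t (real N) - gauss_const A B) \<in> O(\<lambda>N. real N powr (-1/2))"
proof -
  obtain C where C: "0 \<le> C" "\<forall>M\<ge>1. integrable lborel (\<lambda>u. indicator {0<..} u * (u powr M * exp (- A * u\<^sup>2 + B * u))) \<and>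
     \<bar>(LINT u|lborel. indicator {0<..} u * (u powr M * exp (- A * u\<^sup>2 + B * u)))
       - sqrt (M / (2 * A)) powr M * exp (- M / 2 + B * sqrt (M / (2 * A))) * (sqrt (pi / (2 * A)) * exp (B\<^sup>2 / (8 * A)))\<bar>
      \<le> C / sqrt M * (sqrt (M / (2 * A)) powr M * exp (- M / 2 + B * sqrt (M / (2 * A))))"
    by (rule laplace_power_gauss[OF A])
  have b: "\<bar>gauss_moment A B M - laplace_main A B M * gauss_const A B\<bar> \<le> C / sqrt M * laplace_main A B M" if "1 \<le> M" for M
    using C(2)[rule_format, OF that] by (simp only: gauss_moment_def laplace_main_def gauss_const_def)
  have lmpos: "0 < laplace_main A B M" if "1 \<le> M" for M
    using that A by (simp add: laplace_main_def)
  define \<delta> where "\<delta> = (\<lambda>N::nat. gauss_moment A B (real N + t) / laplace_main A B (real N + t) - gauss_const A B)"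
  define r where "r = (\<lambda>N::nat. laplace_main A B (real N + t) / laplace_scale A B t (real N) - 1)"
  have big: "eventually (\<lambda>N::nat. 1 \<le> real N + t \<and> 0 < real N) sequentially"
    using eventually_gt_at_top[of "nat \<lceil>\<bar>t\<bar> + 1\<rceil>"] by eventually_elim linarith
  have "eventually (\<lambda>N. norm (\<delta> N) \<le> C * norm (1 / sqrt (real N + t))) sequentially"
    using big
  proof eventually_elim
    case (elim N)
    define M where "M = real N + t"
    have M: "1 \<le> M" using elim by (simp add: M_def)
    have "\<delta> N = (gauss_moment A B M - laplace_main A B M * gauss_const A B) / laplace_main A B M"
      using lmpos[OF M] by (simp add: \<delta>_def M_def diff_divide_distrib)
    then have "\<bar>\<delta> N\<bar> = \<bar>gauss_moment A B M - laplace_main A B M * gauss_const A B\<bar> / laplace_main A B M"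
      using lmpos[OF M] by simp
    also have "\<dots> \<le> (C / sqrt M * laplace_main A B M) / laplace_main A B M"
      using b[OF M] lmpos[OF M] by (intro divide_right_mono) auto
    also have "\<dots> = C / sqrt M" using lmpos[OF M] by simp
    finally show ?case using M by (simp add: M_def)
  qed
  then have "\<delta> \<in> O(\<lambda>N. 1 / sqrt (real N + t))" by (rule bigoI)
  also have "(\<lambda>N::nat. 1 / sqrt (real N + t)) \<in> O(\<lambda>N. real N powr (-1/2))"
    by real_asymp
  finally have \<delta>: "\<delta> \<in> O(\<lambda>N. real N powr (-1/2))" .
  have r: "r \<in> O(\<lambda>N. real N powr (-1/2))"
    unfolding r_def by (rule laplace_main_asymp[OF A])
  have "(\<lambda>N. gauss_const A B + \<delta> N) \<in> O(\<lambda>_. 1)"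
    by (intro sum_in_bigo(1) landau_o.big_trans[OF \<delta> powr_minus_half_bigo_1]) simp
  then have "(\<lambda>N. r N * (gauss_const A B + \<delta> N)) \<in> O(\<lambda>N. real N powr (-1/2) * 1)"
    by (intro landau_o.big.mult r)
  then have "(\<lambda>N. r N * (gauss_const A B + \<delta> N) + \<delta> N) \<in> O(\<lambda>N. real N powr (-1/2))"
    using \<delta> by (intro sum_in_bigo(1)) simp_all
  moreover have "eventually (\<lambda>N. r N * (gauss_const A B + \<delta> N) + \<delta> N =
      gauss_moment A B (real N + t) / laplace_scale A B t (real N) - gauss_const A B) sequentially"
    using big
  proof eventually_elim
    case (elim N)
    have "gauss_const A B + \<delta> N = gauss_moment A B (real N + t) / laplace_main A B (real N + t)"
      by (simp add: \<delta>_def)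
    then have "(r N + 1) * (gauss_const A B + \<delta> N) = gauss_moment A B (real N + t) / laplace_scale A B t (real N)"
      using lmpos[of "real N + t"] elim by (simp add: r_def)
    then show ?case by (simp add: algebra_simps)
  qed
  ultimately show ?thesis by (simp only: landau_o.big.in_cong)
qed

text \<open>Moving the lower limit from 0 to U costs at most a constant times U^(M+1), a geometric
  error in N for M = N + t.\<close>

lemma gauss_moment_truncate:
  fixes A B U M :: real
  assumes A: "0 < A" and U: "0 < U" and M: "1 \<le> M"
  defines "f \<equiv> \<lambda>u. u powr M * exp (- A * u\<^sup>2 + B * u)"
  shows "f integrable_on {U..}" "0 \<le> gauss_moment A B M - integral {U..} f"
    "gauss_moment A B M - integral {U..} f \<le> U powr (M + 1) * exp (\<bar>B\<bar> * U)"
proof -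
  obtain C where "0 \<le> C" "\<forall>M\<ge>1. integrable lborel (\<lambda>u. indicator {0<..} u * (u powr M * exp (- A * u\<^sup>2 + B * u))) \<and>
     \<bar>(LINT u|lborel. indicator {0<..} u * (u powr M * exp (- A * u\<^sup>2 + B * u)))
       - sqrt (M / (2 * A)) powr M * exp (- M / 2 + B * sqrt (M / (2 * A))) * (sqrt (pi / (2 * A)) * exp (B\<^sup>2 / (8 * A)))\<bar>
      \<le> C / sqrt M * (sqrt (M / (2 * A)) powr M * exp (- M / 2 + B * sqrt (M / (2 * A))))"
    by (rule laplace_power_gauss[OF A])
  with M have int: "integrable lborel (\<lambda>u. indicator {0<..} u * f u)" unfolding f_def by blast
  have fm: "f \<in> borel_measurable borel" unfolding f_def by measurable
  have f0: "0 \<le> f u" for u by (simp add: f_def)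
  have intU: "integrable lborel (\<lambda>u. indicator {U..} u * f u)"
    by (rule Bochner_Integration.integrable_bound[OF int])
       (use fm U in \<open>auto intro!: AE_I2 simp: indicator_def\<close>)
  have int0: "integrable lborel (\<lambda>u. indicator {0<..<U} u * f u)"
    by (rule Bochner_Integration.integrable_bound[OF int])
       (use fm U in \<open>auto intro!: AE_I2 simp: indicator_def\<close>)
  have si: "set_integrable lborel {U..} f" using intU by (simp add: set_integrable_def)
  show "f integrable_on {U..}" using set_borel_integral_eq_integral(1)[OF si] .
  have I: "integral {U..} f = (LINT u|lborel. indicator {U..} u * f u)"
    using set_borel_integral_eq_integral(2)[OF si] by (simp add: set_lebesgue_integral_def)
  have "gauss_moment A B M = (LINT u|lborel. indicator {0<..<U} u * f u + indicator {U..} u * f u)"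
    unfolding gauss_moment_def f_def using U by (intro Bochner_Integration.integral_cong) (auto simp: indicator_def)
  also have "\<dots> = (LINT u|lborel. indicator {0<..<U} u * f u) + (LINT u|lborel. indicator {U..} u * f u)"
    by (rule Bochner_Integration.integral_add[OF int0 intU])
  finally have d: "gauss_moment A B M - integral {U..} f = (LINT u|lborel. indicator {0<..<U} u * f u)"
    by (simp add: I)
  show "0 \<le> gauss_moment A B M - integral {U..} f"
    unfolding d by (intro integral_nonneg_AE AE_I2) (simp add: f0)
  have "(LINT u|lborel. indicator {0<..<U} u * f u) \<le> (LINT u|lborel. indicator {0<..<U} u * (U powr M * exp (\<bar>B\<bar> * U)))"
  proof (rule Bochner_Integration.integral_mono[OF int0])
    show "integrable lborel (\<lambda>u. indicator {0<..<U} u * (U powr M * exp (\<bar>B\<bar> * U)))" using U by simp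
    fix u :: real
    show "indicator {0<..<U} u * f u \<le> indicator {0<..<U} u * (U powr M * exp (\<bar>B\<bar> * U))"
    proof (cases "u \<in> {0<..<U}")
      case True
      have "B * u \<le> \<bar>B\<bar> * U" using True by (intro mult_mono) auto
      moreover have "0 \<le> A * u\<^sup>2" using A by simp
      ultimately have "- A * u\<^sup>2 + B * u \<le> \<bar>B\<bar> * U" by linarith
      then have "f u \<le> U powr M * exp (\<bar>B\<bar> * U)"
        unfolding f_def using True M by (intro mult_mono powr_mono2) auto
      then show ?thesis using True by simp
    qed simp
  qed
  also have "\<dots> = U powr (M + 1) * exp (\<bar>B\<bar> * U)"
    using U by (simp add: powr_add)
  finally show "gauss_moment A B M - integral {U..} f \<le> U powr (M + 1) * exp (\<bar>B\<bar> * U)"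
    unfolding d .
qed

text \<open>A correction of relative order 1/u becomes one of relative order N^(-1/2), since the
  mass sits at u of order sqrt N. The passage from s to s - 1 in the scale comes from u^(N+1)/u^2 =
  u^(N-1).\<close>

lemma laplace_tail:
  fixes \<Phi> :: "real \<Rightarrow> real"
  assumes A: "0 < A" and U: "0 < U" and C: "0 \<le> C"
    and \<Phi>: "\<And>u. U \<le> u \<Longrightarrow> \<bar>\<Phi> u - k * (u powr s * exp (- A * u\<^sup>2 + B * u))\<bar> \<le> C * (u powr (s - 1) * exp (- A * u\<^sup>2 + B * u))"
    and int: "\<And>N. (\<lambda>u. \<Phi> u * u ^ (N + 1) / u\<^sup>2) integrable_on {U..}"
  shows "(\<lambda>N. integral {U..} (\<lambda>u. \<Phi> u * u ^ (N + 1) / u\<^sup>2) / laplace_scale A B (s - 1) (real N) - k * gauss_const A B)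
     \<in> O(\<lambda>N. real N powr (-1/2))"
proof -
  define t where "t = s - 1"
  define f where "f = (\<lambda>M u. u powr M * exp (- A * u\<^sup>2 + B * u))"
  define I where "I = (\<lambda>N::nat. integral {U..} (\<lambda>u. \<Phi> u * u ^ (N + 1) / u\<^sup>2))"
  define Q where "Q = (\<lambda>N::nat. laplace_scale A B t (real N))"
  define a where "a = (\<lambda>N::nat. gauss_moment A B (real N + t))"
  define a' where "a' = (\<lambda>N::nat. gauss_moment A B (real N + (t - 1)))"
  define c where "c = U powr (t + 1) * exp (\<bar>B\<bar> * U)"
  have big: "eventually (\<lambda>N::nat. 1 \<le> real N + (t - 1) \<and> 0 < real N) sequentially"
    using eventually_gt_at_top[of "nat \<lceil>\<bar>t\<bar> + 2\<rceil>"] by eventually_elim linarith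
  have bound: "\<bar>I N - k * a N\<bar> \<le> C * a' N + \<bar>k\<bar> * (c * U ^ N)" if N: "1 \<le> real N + (t - 1)" for N
  proof -
    define M where "M = real N + t"
    have M: "1 \<le> M" "1 \<le> M - 1" using N by (auto simp: M_def)
    have tr': "f M' integrable_on {U..}" "0 \<le> gauss_moment A B M' - integral {U..} (f M')"
      "gauss_moment A B M' - integral {U..} (f M') \<le> U powr (M' + 1) * exp (\<bar>B\<bar> * U)" if "1 \<le> M'" for M'
      using gauss_moment_truncate[OF A U that, of B] by (simp_all only: f_def)
    note tr = tr'[OF M(1)] tr'[OF M(2)]
    have "norm (integral {U..} (\<lambda>u. \<Phi> u * u ^ (N + 1) / u\<^sup>2 - k * f M u)) \<le> integral {U..} (\<lambda>u. C * f (M - 1) u)"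
    proof (rule integral_norm_bound_integral)
      show "(\<lambda>u. \<Phi> u * u ^ (N + 1) / u\<^sup>2 - k * f M u) integrable_on {U..}"
        by (intro integrable_diff int integrable_on_mult_right tr)
      show "(\<lambda>u. C * f (M - 1) u) integrable_on {U..}" by (intro integrable_on_mult_right tr)
      fix u assume u: "u \<in> {U..}"
      with U have u0: "0 < u" by auto
      have p: "u ^ (N + 1) / u\<^sup>2 = u powr (real N - 1)"
        using u0 by (simp add: powr_diff powr_realpow field_simps power2_eq_square)
      have "\<Phi> u * u ^ (N + 1) / u\<^sup>2 - k * f M u = u powr (real N - 1) * (\<Phi> u - k * (u powr s * exp (- A * u\<^sup>2 + B * u)))"
      proof -
        have "M = (real N - 1) + s" by (simp add: M_def t_def)
        then have "u powr M = u powr (real N - 1) * u powr s"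
          by (simp only: powr_add)
        then show ?thesis using p by (simp add: f_def right_diff_distrib times_divide_eq_right[symmetric] del: times_divide_eq_right)
      qed
      then have "norm (\<Phi> u * u ^ (N + 1) / u\<^sup>2 - k * f M u) = u powr (real N - 1) * \<bar>\<Phi> u - k * (u powr s * exp (- A * u\<^sup>2 + B * u))\<bar>"
        by (simp add: abs_mult)
      also have "\<dots> \<le> u powr (real N - 1) * (C * (u powr (s - 1) * exp (- A * u\<^sup>2 + B * u)))"
        using \<Phi> u by (intro mult_left_mono) auto
      also have "\<dots> = C * f (M - 1) u"
      proof -
        have "M - 1 = (real N - 1) + (s - 1)" by (simp add: M_def t_def)
        then have "u powr (M - 1) = u powr (real N - 1) * u powr (s - 1)"
          by (simp only: powr_add)
        then show ?thesis by (simp add: f_def)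
      qed
      finally show "norm (\<Phi> u * u ^ (N + 1) / u\<^sup>2 - k * f M u) \<le> C * f (M - 1) u" .
    qed
    moreover have "integral {U..} (\<lambda>u. \<Phi> u * u ^ (N + 1) / u\<^sup>2 - k * f M u) = I N - k * integral {U..} (f M)"
      unfolding I_def integral_mult_right[symmetric] by (rule integral_diff[OF int integrable_on_mult_right[OF tr(1)]])
    moreover have "integral {U..} (\<lambda>u. C * f (M - 1) u) = C * integral {U..} (f (M - 1))" by simp
    moreover have "C * integral {U..} (f (M - 1)) \<le> C * a' N"
      using tr(5) C by (intro mult_left_mono) (auto simp: a'_def M_def algebra_simps)
    ultimately have 1: "\<bar>I N - k * integral {U..} (f M)\<bar> \<le> C * a' N" by simp
    have "\<bar>k * integral {U..} (f M) - k * a N\<bar> = \<bar>k\<bar> * (a N - integral {U..} (f M))"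
      using tr(2) by (simp add: a_def M_def abs_mult abs_minus_commute flip: right_diff_distrib)
    also have "\<dots> \<le> \<bar>k\<bar> * (U powr (M + 1) * exp (\<bar>B\<bar> * U))"
      using tr(3) by (intro mult_left_mono) (auto simp: a_def M_def)
    also have "U powr (M + 1) = U powr (t + 1) * U ^ N"
      using U by (simp add: M_def powr_add powr_realpow)
    finally have "\<bar>k * integral {U..} (f M) - k * a N\<bar> \<le> \<bar>k\<bar> * (c * U ^ N)" by (simp add: c_def mult_ac)
    with 1 show ?thesis by linarith
  qed
  have a: "(\<lambda>N. a N / Q N - gauss_const A B) \<in> O(\<lambda>N. real N powr (-1/2))"
    unfolding a_def Q_def by (rule gauss_moment_asymp[OF A])
  \<comment> \<open>One power of u less divides the scale by (N/(2A))^(1/2).\<close>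
  have a': "(\<lambda>N. a' N / Q N) \<in> O(\<lambda>N. real N powr (-1/2))"
  proof -
    define Q' where "Q' = (\<lambda>N::nat. laplace_scale A B (t - 1) (real N))"
    have "(\<lambda>N. a' N / Q' N - gauss_const A B) \<in> O(\<lambda>_. 1)"
      unfolding a'_def Q'_def by (rule landau_o.big_trans[OF gauss_moment_asymp[OF A] powr_minus_half_bigo_1])
    then have "(\<lambda>N. (a' N / Q' N - gauss_const A B) + gauss_const A B) \<in> O(\<lambda>_. 1)"
      by (intro sum_in_bigo(1)) simp_all
    then have "(\<lambda>N. a' N / Q' N) \<in> O(\<lambda>_. 1)" by simp
    moreover have "(\<lambda>N::nat. (real N / (2 * A)) powr (- 1 / 2)) \<in> O(\<lambda>N. real N powr (-1/2))"
      using A by real_asymp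
    ultimately have "(\<lambda>N. (a' N / Q' N) * (real N / (2 * A)) powr (- 1 / 2)) \<in> O(\<lambda>N. 1 * real N powr (-1/2))"
      by (rule landau_o.big.mult)
    moreover have "eventually (\<lambda>N. (a' N / Q' N) * (real N / (2 * A)) powr (- 1 / 2) = a' N / Q N) sequentially"
      using big
    proof eventually_elim
      case (elim N)
      have "(real N / (2 * A)) powr (t / 2) = (real N / (2 * A)) powr ((t - 1) / 2) / (real N / (2 * A)) powr (- 1 / 2)"
        by (simp add: diff_divide_distrib flip: powr_diff)
      then have "Q N = Q' N / (real N / (2 * A)) powr (- 1 / 2)"
        by (simp add: Q_def Q'_def laplace_scale_def)
      then show ?case by simp
    qed
    ultimately show ?thesis by (simp only: landau_o.big.in_cong mult_1)
  qed
  have u: "(\<lambda>N. U ^ N / Q N) \<in> O(\<lambda>N. real N powr (-1/2))"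
    unfolding Q_def by (rule power_negligible[OF A U])
  have E: "(\<lambda>N. C * (a' N / Q N) + \<bar>k\<bar> * c * (U ^ N / Q N)) \<in> O(\<lambda>N. real N powr (-1/2))"
    by (intro sum_in_bigo(1) cmult_bigo a' u)
  have "(\<lambda>N. I N / Q N - k * (a N / Q N)) \<in> O(\<lambda>N. C * (a' N / Q N) + \<bar>k\<bar> * c * (U ^ N / Q N))"
  proof (rule bigoI[where c = 1])
    show "eventually (\<lambda>N. norm (I N / Q N - k * (a N / Q N)) \<le> 1 * norm (C * (a' N / Q N) + \<bar>k\<bar> * c * (U ^ N / Q N))) sequentially"
      using big
    proof eventually_elim
      case (elim N)
      have Q: "0 < Q N" unfolding Q_def using elim by (intro laplace_scale_pos A) auto
      have "norm (I N / Q N - k * (a N / Q N)) = \<bar>I N - k * a N\<bar> / Q N"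
        using Q by (simp add: diff_divide_distrib[symmetric])
      also have "\<dots> \<le> (C * a' N + \<bar>k\<bar> * (c * U ^ N)) / Q N"
        using bound elim Q by (intro divide_right_mono) auto
      also have "\<dots> = C * (a' N / Q N) + \<bar>k\<bar> * c * (U ^ N / Q N)"
        by (simp add: add_divide_distrib)
      finally show ?case by simp
    qed
  qed
  from landau_o.big_trans[OF this E]
  have "(\<lambda>N. (I N / Q N - k * (a N / Q N)) + k * (a N / Q N - gauss_const A B)) \<in> O(\<lambda>N. real N powr (-1/2))"
    by (intro sum_in_bigo(1) cmult_bigo a)
  then show ?thesis by (simp add: I_def Q_def t_def algebra_simps)
qed

section \<open>The contribution of the remaining poles\<close>

text \<open>From (2n)! = binom(2n, n) n!^2, with the binomial at most 4^n and n! at most n^n. For 2n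
  <= N this yields the power (N/12)^n, which a power of w is to cancel.\<close>

lemma fact_double_le: "fact (2 * n + 1) / (24 ^ n * fact n) \<le> real (2 * n + 1) * (real n / 6) ^ n"
proof -
  have f: "fact (2 * n) = real (2 * n choose n) * fact n * fact n"
    using binomial_fact[of n "2 * n", where 'a = real] by simp
  have c: "real (2 * n choose n) \<le> 4 ^ n"
  proof -
    have "(2 * n choose n) \<le> 2 ^ (2 * n)" by (rule binomial_le_pow2)
    then have "real (2 * n choose n) \<le> real (2 ^ (2 * n))" by (rule of_nat_mono)
    then show ?thesis by (simp add: power_mult)
  qed
  have n: "fact n \<le> real n ^ n" using fact_le_power[of n, where 'a = real] by simp
  have "fact (2 * n + 1) / (24 ^ n * fact n) = real (2 * n + 1) * (real (2 * n choose n) * fact n) / 24 ^ n"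
    unfolding fact_Suc Suc_eq_plus1[symmetric] f by simp
  also have "\<dots> \<le> real (2 * n + 1) * (4 ^ n * real n ^ n) / 24 ^ n"
    using c n by (intro divide_right_mono mult_left_mono mult_mono) auto
  also have "\<dots> = real (2 * n + 1) * (real n / 6) ^ n"
  proof -
    have "4 ^ n * real n ^ n / 24 ^ n = (4 * real n / 24) ^ n"
      by (simp only: power_mult_distrib power_divide)
    also have "4 * real n / 24 = real n / 6" by simp
    finally show ?thesis by (simp only: times_divide_eq_right[symmetric])
  qed
  finally show ?thesis .
qed

lemma fps_compose_mult_nth:
  fixes w Y c :: "real fps"
  assumes "fps_nth w 0 = 0"
  shows "fps_nth (Y * (c oo w)) N = (\<Sum>n\<le>N. fps_nth c n * fps_nth (Y * w ^ n) N)"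
proof -
  have c: "fps_nth (c oo w) j = (\<Sum>k\<le>N. fps_nth c k * fps_nth (w ^ k) j)" if "j \<le> N" for j
    using that startsby_zero_power_prefix[OF assms] unfolding fps_compose_nth
    by (intro sum.mono_neutral_cong_left) auto
  have "fps_nth (Y * (c oo w)) N = (\<Sum>i\<le>N. fps_nth Y i * (\<Sum>k\<le>N. fps_nth c k * fps_nth (w ^ k) (N - i)))"
    unfolding fps_mult_nth atMost_atLeast0[symmetric] by (intro sum.cong refl) (simp add: c)
  also have "\<dots> = (\<Sum>k\<le>N. \<Sum>i\<le>N. fps_nth c k * (fps_nth Y i * fps_nth (w ^ k) (N - i)))"
    unfolding sum_distrib_left by (subst sum.swap) (simp add: mult_ac)
  also have "\<dots> = (\<Sum>k\<le>N. fps_nth c k * fps_nth (Y * w ^ k) N)"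
    by (simp add: fps_mult_nth atMost_atLeast0 sum_distrib_left)
  finally show ?thesis .
qed

text \<open>The coefficient of r^2 has to be exactly |w_2|, as the bound is raised to powers of
  order N. With r of order N^(-1/2) the remainder c r^3 then costs only exp(O(sqrt N)).\<close>

lemma fps_l1_quadratic:
  assumes w: "fps_nth w 0 = 0" "fps_nth w 1 = 0" "0 < R" "fps_l1 R w M"
  obtains c where "0 \<le> c" "\<And>r. 0 < r \<Longrightarrow> r \<le> R \<Longrightarrow> fps_l1 r w (\<bar>fps_nth w 2\<bar> * r\<^sup>2 + c * r ^ 3)"
proof -
  define a where "a = fps_nth w 2"
  define d where "d = w + fps_const (- a) * fps_X ^ 2"
  have X2: "fps_l1 r (fps_X ^ 2) (r\<^sup>2)" if "0 < r" for r :: real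
    unfolding fps_l1_def
  proof
    fix n
    have "(\<Sum>i\<le>n. \<bar>fps_nth (fps_X ^ 2) i\<bar> * r ^ i) = (\<Sum>i\<le>n. if i = 2 then r\<^sup>2 else 0)"
      by (intro sum.cong) (auto simp: fps_X_power_nth)
    also have "\<dots> \<le> r\<^sup>2" using that by simp
    finally show "(\<Sum>i\<le>n. \<bar>fps_nth (fps_X ^ 2) i\<bar> * r ^ i) \<le> r\<^sup>2" .
  qed
  define M' where "M' = M + \<bar>- a\<bar> * R\<^sup>2"
  have dl: "fps_l1 R d M'"
    unfolding d_def M'_def using w by (intro fps_l1_add fps_l1_mult fps_l1_const X2) auto
  have d0: "fps_nth d i = 0" if "i < 3" for i
    using that w by (auto simp: d_def a_def less_Suc_eq numeral_3_eq_3 fps_X_power_nth numeral_2_eq_2)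
  have "fps_l1 r w (\<bar>a\<bar> * r\<^sup>2 + M' / R ^ 3 * r ^ 3)" if r: "0 < r" "r \<le> R" for r
  proof -
    have "fps_l1 r d (M' * (r / R) ^ 3)"
      using r w d0 by (intro fps_l1_shrink[OF dl]) auto
    then have "fps_l1 r (fps_const a * fps_X ^ 2 + d) (\<bar>a\<bar> * r\<^sup>2 + M' * (r / R) ^ 3)"
      using r by (intro fps_l1_add fps_l1_mult fps_l1_const X2) auto
    moreover have "fps_const a * fps_X ^ 2 + d = w" by (simp add: d_def flip: fps_const_neg)
    ultimately show ?thesis by (simp add: power_divide)
  qed
  moreover have "0 \<le> M' / R ^ 3" using fps_l1_nonneg[OF dl] w(3) by simp
  ultimately show ?thesis by (intro that[of "M' / R ^ 3"]) (auto simp: a_def)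
qed

text \<open>Otherwise x = pi/6 would be so large that x - x^3/6 - x^4/24, a lower bound for sin x,
  exceeds 1/2 = sin(pi/6). The number 3.46 is just below sqrt 12.\<close>

lemma pi_square_less_12: "pi\<^sup>2 < 12"
proof (rule ccontr)
  assume "\<not> pi\<^sup>2 < 12"
  then have "(346 / 100)\<^sup>2 \<le> pi\<^sup>2" by (simp add: power2_eq_square)
  then have "346 / 100 \<le> pi" by (rule power2_le_imp_le) simp
  define x where "x = pi / 6"
  have x: "346 / 600 \<le> x" "x \<le> 2 / 3"
    using \<open>346 / 100 \<le> pi\<close> pi_less_4 by (auto simp: x_def)
  have B: "\<bar>sin x - (\<Sum>m<4. sin_coeff m * x ^ m)\<bar> \<le> inverse (fact 4) * \<bar>x\<bar> ^ 4"
    by (rule Maclaurin_sin_bound)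
  have sx: "sin x = 1 / 2" by (simp add: x_def sin_30)
  have S: "(\<Sum>m<4. sin_coeff m * x ^ m) = x - x ^ 3 / 6"
  proof -
    have "{..<4} = {0, 1, 2, 3 :: nat}" by auto
    then show ?thesis by (simp add: sin_coeff_def fact_numeral)
  qed
  have "inverse (fact 4) * \<bar>x\<bar> ^ 4 = x ^ 4 / 24" by (simp add: fact_numeral)
  then have "x - x ^ 3 / 6 - x ^ 4 / 24 \<le> 1 / 2"
    using B unfolding sx S by linarith
  moreover have "x - x ^ 3 / 6 - x ^ 4 / 24 = x * (1 - x\<^sup>2 / 6 - x ^ 3 / 24)"
    by (simp add: eval_nat_numeral field_simps)
  moreover have "x * (1 - (2 / 3)\<^sup>2 / 6 - (2 / 3) ^ 3 / 24) \<le> x * (1 - x\<^sup>2 / 6 - x ^ 3 / 24)"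
  proof (rule mult_left_mono)
    have "x\<^sup>2 \<le> (2 / 3)\<^sup>2" "x ^ 3 \<le> (2 / 3) ^ 3" using x by (intro power_mono; simp)+
    then show "1 - (2 / 3)\<^sup>2 / 6 - (2 / 3) ^ 3 / 24 \<le> 1 - x\<^sup>2 / 6 - x ^ 3 / 24" by linarith
  qed (use x in simp)
  ultimately have "x * (1 - (2 / 3)\<^sup>2 / 6 - (2 / 3) ^ 3 / 24) \<le> 1 / 2" by linarith
  then have "x * (148 / 162) \<le> 1 / 2" by (simp add: power2_eq_square power3_eq_cube)
  with x(1) show False by simp
qed

text \<open>This compares the exponential rates of two quantities of order N^(N/2): a/12 for the
  error in \<open>error_negligible\<close> and 3a/(e pi^2) for the main term.\<close>

lemma exp_1_pi_bound: "exp 1 * pi\<^sup>2 < 36"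
proof -
  have "exp 1 * pi\<^sup>2 \<le> 3 * pi\<^sup>2" by (intro mult_right_mono exp_le) auto
  with pi_square_less_12 show ?thesis by linarith
qed

text \<open>Cauchy's estimate at the radius r = sqrt(12/(a N)): there the norm of w is about 12/N,
  and its n-th power cancels the factor (N/12)^n of the coefficients for all n <= N/2 at once. What
  remains is r^(-N) = (a N/12)^(N/2) times exp(O(sqrt N)).\<close>

lemma error_negligible:
  fixes w Y e :: "real fps"
  assumes w: "fps_nth w 0 = 0" "fps_nth w 1 = 0" "fps_nth w 2 = a" "0 < a" and R: "0 < R" "fps_l1 R w M" "fps_l1 R Y M'"
    and e: "\<And>n. \<bar>fps_nth e n\<bar> \<le> C * (fact (2 * n + 1) / (24 ^ n * fact n))"
  shows "(\<lambda>N. fps_nth (Y * (e oo w)) N / laplace_scale (pi\<^sup>2 / (6 * a)) B t (real N)) \<in> O(\<lambda>N. real N powr (-1/2))"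
proof -
  obtain c where c: "0 \<le> c" "\<And>r. 0 < r \<Longrightarrow> r \<le> R \<Longrightarrow> fps_l1 r w (\<bar>fps_nth w 2\<bar> * r\<^sup>2 + c * r ^ 3)"
    by (rule fps_l1_quadratic[OF w(1,2) R(1,2)]) blast
  define A where "A = pi\<^sup>2 / (6 * a)"
  have A: "0 < A" using w(4) by (simp add: A_def)
  have C: "0 \<le> C" using e[of 0] by (auto intro: order_trans[OF abs_ge_zero])
  have M': "0 \<le> M'" by (rule fps_l1_nonneg[OF R(3)])
  define \<kappa> where "\<kappa> = sqrt (12 / a)"
  have \<kappa>: "0 < \<kappa>" "\<kappa>\<^sup>2 = 12 / a" using w(4) by (auto simp: \<kappa>_def)
  define c' where "c' = c / a * \<kappa>"
  have c': "0 \<le> c'" using c w \<kappa> by (simp add: c'_def)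
  have big: "eventually (\<lambda>N::nat. 1 \<le> real N \<and> (\<kappa> / R)\<^sup>2 \<le> real N) sequentially"
    using eventually_gt_at_top[of "nat \<lceil>(\<kappa> / R)\<^sup>2 + 1\<rceil>"] by eventually_elim linarith
  define S where "S = (\<lambda>N::nat. C * M' * (real N + 1) ^ 2 * exp (c' * sqrt (real N)) * (real N * a / 12) powr (real N / 2))"
  have bound: "\<bar>fps_nth (Y * (e oo w)) N\<bar> \<le> S N" if N: "1 \<le> real N" "(\<kappa> / R)\<^sup>2 \<le> real N" for N
  proof -
    define r where "r = \<kappa> / sqrt (real N)"
    have r: "0 < r" "r\<^sup>2 = 12 / (a * real N)" using N \<kappa> by (auto simp: r_def power_divide)
    have "\<kappa> / R \<le> sqrt (real N)" using N \<kappa> R by (intro real_le_rsqrt)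
    then have rR: "r \<le> R" using N \<kappa> R by (simp add: r_def field_simps)
    have Yr: "fps_l1 r Y M'" using fps_l1_shrink[OF R(3), of 0 r] r rR R by simp
    define b where "b = a * r\<^sup>2 * (1 + c / a * r)"
    have wr: "fps_l1 r w b"
    proof -
      have "\<bar>fps_nth w 2\<bar> * r\<^sup>2 + c * r ^ 3 = b"
        using w(3,4) by (simp add: b_def distrib_left power2_eq_square power3_eq_cube)
      then show ?thesis using c(2)[OF r(1) rR] by simp
    qed
    have b: "b = 12 / real N * (1 + c / a * r)" using w(4) by (simp add: b_def r(2))
    have pr: "(1 + c / a * r) ^ n \<le> exp (c' * sqrt (real N))" if "n \<le> N" for n
    proof -
      have "0 \<le> c / a * r" using c w r by simp
      then have "(1 + c / a * r) ^ n \<le> (1 + c / a * r) ^ N" using that by (intro power_increasing) auto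
      also have "\<dots> \<le> exp (c / a * r) ^ N"
        using \<open>0 \<le> c / a * r\<close> by (intro power_mono exp_ge_add_one_self) auto
      also have "\<dots> = exp (real N * (c / a * r))" by (rule exp_of_nat_mult[symmetric])
      also have "real N * (c / a * r) = c' * sqrt (real N)"
      proof -
        have "real N / sqrt (real N) = sqrt (real N)" by (rule real_div_sqrt) simp
        moreover have "real N * (c / a * r) = c / a * \<kappa> * (real N / sqrt (real N))"
          by (simp add: r_def)
        ultimately show ?thesis by (simp only: c'_def)
      qed
      finally show ?thesis .
    qed
    have rN: "1 / r ^ N = (real N * a / 12) powr (real N / 2)"
    proof -
      have "r = (12 / (a * real N)) powr (1 / 2)"
        using w(4) by (simp add: powr_half_sqrt r_def \<kappa>_def real_sqrt_divide real_sqrt_mult)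
      then have "r ^ N = (12 / (a * real N)) powr (real N / 2)"
        using r(1) by (simp add: powr_powr flip: powr_realpow)
      also have "\<dots> = 1 / (real N * a / 12) powr (real N / 2)"
      proof -
        have "12 / (a * real N) = 1 / (real N * a / 12)" by simp
        then show ?thesis using w(4) by (simp only: powr_divide powr_one_eq_one)
      qed
      finally show ?thesis by simp
    qed
    have summand: "\<bar>fps_nth e n * fps_nth (Y * w ^ n) N\<bar> \<le> C * M' * (real N + 1) * exp (c' * sqrt (real N)) * (real N * a / 12) powr (real N / 2)"
      if n: "n \<le> N" for n
    proof (cases "2 * n \<le> N")
      case True
      have "fps_l1 r (Y * w ^ n) (M' * b ^ n)"
        using r by (intro fps_l1_mult Yr fps_l1_power wr) auto
      from fps_l1_nth[OF this r(1), of N]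
      have 1: "\<bar>fps_nth (Y * w ^ n) N\<bar> \<le> M' * b ^ n * (1 / r ^ N)" by simp
      have "\<bar>fps_nth e n\<bar> \<le> C * (real (2 * n + 1) * (real n / 6) ^ n)"
        using e[of n] fact_double_le[of n] C by (meson mult_left_mono order_trans)
      also have "\<dots> \<le> C * ((real N + 1) * (real N / 12) ^ n)"
        using True C by (intro mult_left_mono mult_mono power_mono) auto
      finally have 2: "\<bar>fps_nth e n\<bar> \<le> C * ((real N + 1) * (real N / 12) ^ n)" .
      have "\<bar>fps_nth e n * fps_nth (Y * w ^ n) N\<bar> \<le> (C * ((real N + 1) * (real N / 12) ^ n)) * (M' * b ^ n * (1 / r ^ N))"
        unfolding abs_mult using 1 2 C by (intro mult_mono) auto
      also have "\<dots> = C * M' * (real N + 1) * ((real N / 12) ^ n * b ^ n) * (1 / r ^ N)" by (simp add: mult_ac)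
      also have "(real N / 12) ^ n * b ^ n = (1 + c / a * r) ^ n"
      proof -
        have "real N / 12 * (12 / real N * X) = X" for X using N by simp
        then show ?thesis unfolding b power_mult_distrib[symmetric] by presburger
      qed
      also have "C * M' * (real N + 1) * (1 + c / a * r) ^ n * (1 / r ^ N) \<le> C * M' * (real N + 1) * exp (c' * sqrt (real N)) * (1 / r ^ N)"
        using pr[OF n] C M' r by (intro mult_right_mono mult_left_mono) auto
      finally show ?thesis unfolding rN .
    next
      case False
      \<comment> \<open>w^n has order at least 2n, so for 2n > N nothing is left.\<close>
      have "fps_nth (Y * w ^ n) N = 0"
      proof -
        have "fps_nth (w ^ n) i = 0" if "i \<le> N" for i
        proof -
          define g where "g = fps_shift 2 w"
          have wg: "w = fps_X ^ 2 * g"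
            using w(1,2) unfolding g_def
            by (intro fps_ext) (auto simp: fps_X_power_mult_nth less_2_cases_iff intro!: arg_cong[of _ _ "fps_nth w"])
          have "w ^ n = fps_X ^ (2 * n) * g ^ n"
            by (subst wg) (simp only: power_mult power_mult_distrib)
          then show ?thesis using that False by (simp add: fps_X_power_mult_nth)
        qed
        then show ?thesis by (simp add: fps_mult_nth)
      qed
      then show ?thesis using C M' by simp
    qed
    have "\<bar>fps_nth (Y * (e oo w)) N\<bar> \<le> (\<Sum>n\<le>N. \<bar>fps_nth e n * fps_nth (Y * w ^ n) N\<bar>)"
      unfolding fps_compose_mult_nth[OF w(1)] by (rule sum_abs)
    also have "\<dots> \<le> (\<Sum>n\<le>N. C * M' * (real N + 1) * exp (c' * sqrt (real N)) * (real N * a / 12) powr (real N / 2))"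
      by (intro sum_mono summand) simp
    also have "\<dots> = S N" by (simp add: S_def power2_eq_square mult_ac)
    finally show ?thesis .
  qed
  have "(\<lambda>N. S N / laplace_scale A B t (real N)) \<in> O(\<lambda>N. real N powr (-1/2))"
  proof -
    \<comment> \<open>Half the logarithm of the quotient 36/(e pi^2) of the two rates, positive by
      \<open>exp_1_pi_bound\<close>.\<close>
    define d where "d = - (1 + ln (2 * A) + ln (a / 12)) / 2"
    have d: "0 < d"
    proof -
      have "1 + ln (2 * A) + ln (a / 12) = ln (exp 1 * (2 * A) * (a / 12))"
      proof -
        have "ln (exp 1 * (2 * A) * (a / 12)) = ln (exp 1 * (2 * A)) + ln (a / 12)"
          by (rule ln_mult_pos) (use A w(4) in auto)
        moreover have "ln (exp 1 * (2 * A)) = ln (exp 1) + ln (2 * A)"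
          by (rule ln_mult_pos) (use A in auto)
        ultimately show ?thesis by simp
      qed
      also have "exp 1 * (2 * A) * (a / 12) = exp 1 * pi\<^sup>2 / 36" using w(4) by (simp add: A_def)
      also have "ln (exp 1 * pi\<^sup>2 / 36) < ln 1" using exp_1_pi_bound by (subst ln_less_cancel_iff) auto
      finally show ?thesis by (simp add: d_def)
    qed
    define b where "b = c' - B / sqrt (2 * A)"
    define t' where "t' = t / 2"
    define f where "f = t / 2 * ln (2 * A)"
    have "(\<lambda>N::nat. (real N + 1) ^ 2 * exp (b * sqrt (real N) - d * real N - t' * ln (real N) + f)) \<in> O(\<lambda>N. real N powr (-1/2))"
      using d by real_asymp
    then have "(\<lambda>N. C * M' * ((real N + 1) ^ 2 * exp (b * sqrt (real N) - d * real N - t' * ln (real N) + f))) \<in> O(\<lambda>N. real N powr (-1/2))"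
      by (rule cmult_bigo)
    moreover have "eventually (\<lambda>N. C * M' * ((real N + 1) ^ 2 * exp (b * sqrt (real N) - d * real N - t' * ln (real N) + f)) = S N / laplace_scale A B t (real N)) sequentially"
      using eventually_gt_at_top[of 0]
    proof eventually_elim
      case (elim N)
      have "(real N * a / 12) powr (real N / 2) = exp (real N / 2 * (ln (real N) + ln (a / 12)))"
      proof -
        have "real N * a / 12 = real N * (a / 12)" by simp
        then show ?thesis using elim w(4) by (simp only: powr_def ln_mult) auto
      qed
      then have "S N / laplace_scale A B t (real N) = C * M' * (real N + 1) ^ 2 * exp (c' * sqrt (real N) + real N / 2 * (ln (real N) + ln (a / 12))
        - (B * sqrt (real N / (2 * A)) + real N / 2 * (ln (real N) - ln (2 * A) - 1) + t / 2 * (ln (real N) - ln (2 * A))))"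
        using elim A by (simp add: S_def laplace_scale_exp exp_diff exp_add)
      also have "c' * sqrt (real N) + real N / 2 * (ln (real N) + ln (a / 12))
        - (B * sqrt (real N / (2 * A)) + real N / 2 * (ln (real N) - ln (2 * A) - 1) + t / 2 * (ln (real N) - ln (2 * A)))
        = b * sqrt (real N) - d * real N - t' * ln (real N) + f"
        by (simp add: d_def b_def t'_def f_def real_sqrt_divide) (simp add: field_simps)
      finally show ?case by (simp add: mult_ac)
    qed
    ultimately show ?thesis by (simp only: landau_o.big.in_cong)
  qed
  moreover have "(\<lambda>N. fps_nth (Y * (e oo w)) N / laplace_scale A B t (real N)) \<in> O(\<lambda>N. S N / laplace_scale A B t (real N))"
  proof (rule bigoI[where c = 1])
    show "eventually (\<lambda>N. norm (fps_nth (Y * (e oo w)) N / laplace_scale A B t (real N)) \<le> 1 * norm (S N / laplace_scale A B t (real N))) sequentially"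
      using big
    proof eventually_elim
      case (elim N)
      have "0 < laplace_scale A B t (real N)" using elim A by (intro laplace_scale_pos) auto
      moreover have "\<bar>fps_nth (Y * (e oo w)) N\<bar> \<le> \<bar>S N\<bar>"
        using bound[of N] elim by linarith
      ultimately show ?case by (simp add: abs_divide divide_right_mono)
    qed
  qed
  ultimately show ?thesis unfolding A_def by (rule landau_o.big_trans[rotated])
qed

section \<open>Local expansion of the integrand\<close>

lemma fps_radius_mult:
  fixes f g :: "real fps"
  shows "r \<le> fps_conv_radius f \<Longrightarrow> r \<le> fps_conv_radius g \<Longrightarrow> r \<le> fps_conv_radius (f * g)"
  using fps_conv_radius_mult[of f g] by (meson min.boundedI order_trans)

lemma fps_radius_diff:
  fixes f g :: "real fps"
  shows "r \<le> fps_conv_radius f \<Longrightarrow> r \<le> fps_conv_radius g \<Longrightarrow> r \<le> fps_conv_radius (f - g)"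
  using fps_conv_radius_diff[of f g] by (meson min.boundedI order_trans)

text \<open>The product of the composed series with exp(- c w(x)) has derivative 0 on the interval
  and value 1 at 0.\<close>

lemma eval_fps_exp_compose:
  fixes w :: "real fps"
  assumes w0: "fps_nth w 0 = 0"
    and r: "0 < R" "ereal R \<le> fps_conv_radius w" "ereal R \<le> fps_conv_radius (fps_exp c oo w)"
    and x: "\<bar>x\<bar> < R"
  shows "eval_fps (fps_exp c oo w) x = exp (c * eval_fps w x)"
proof -
  define Y where "Y = fps_exp c oo w"
  define g where "g = (\<lambda>x. eval_fps Y x * exp (- (c * eval_fps w x)))"
  have lr: "ereal (norm y) < fps_conv_radius f" if "ereal R \<le> fps_conv_radius f" "\<bar>y\<bar> < R" for y :: real and f :: "real fps"
    by (rule less_le_trans[OF _ that(1)]) (use that(2) in simp)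
  have dY: "fps_deriv Y = fps_const c * (Y * fps_deriv w)"
    unfolding Y_def using fps_compose_deriv[OF w0, of "fps_exp c"]
    by (simp add: fps_compose_mult_distrib[OF w0] mult.assoc)
  have "(g has_real_derivative 0) (at y)" if y: "\<bar>y\<bar> < R" for y
  proof -
    have rd: "ereal R \<le> fps_conv_radius (fps_deriv w)" using order_trans[OF r(2) fps_conv_radius_deriv] .
    have rY: "ereal R \<le> fps_conv_radius Y" using r by (simp add: Y_def)
    have e: "eval_fps (fps_deriv Y) y = c * (eval_fps Y y * eval_fps (fps_deriv w) y)"
    proof -
      have "ereal (norm y) < fps_conv_radius (fps_const c)" by simp
      from eval_fps_mult[OF this lr[OF fps_radius_mult[OF rY rd] y]]
      show ?thesis unfolding dY using eval_fps_mult[OF lr[OF rY y] lr[OF rd y]] by simp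
    qed
    have 1: "(eval_fps Y has_real_derivative eval_fps (fps_deriv Y) y) (at y)"
      using lr[OF rY y] by (rule has_field_derivative_eval_fps)
    have 2: "(eval_fps w has_real_derivative eval_fps (fps_deriv w) y) (at y)"
      using lr[OF r(2) y] by (rule has_field_derivative_eval_fps)
    have "((\<lambda>x. exp (- (c * eval_fps w x))) has_real_derivative exp (- (c * eval_fps w y)) * (- (c * eval_fps (fps_deriv w) y))) (at y)"
      by (rule derivative_eq_intros 2 refl)+ simp
    from DERIV_mult[OF 1 this] show ?thesis
      unfolding g_def e by (simp add: algebra_simps)
  qed
  then have "g x = g 0"
    using DERIV_isconst3[of "- R" R x 0 g] x r(1) by (auto simp: abs_less_iff)
  then have "eval_fps Y x * exp (- (c * eval_fps w x)) = 1"
    by (simp add: g_def eval_fps_at_0 w0 Y_def)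
  then show ?thesis by (simp add: Y_def exp_minus field_simps)
qed

lemma deriv_bound_at_right:
  fixes g :: "real \<Rightarrow> real"
  assumes "(g has_real_derivative D) (at 0)"
  obtains c where "0 \<le> c" "eventually (\<lambda>x. \<bar>g x - g 0\<bar> \<le> c * x) (at_right 0)"
proof
  have "((\<lambda>x. (g x - g 0) / x) \<longlongrightarrow> D) (at 0)"
    using assms by (simp add: has_field_derivative_iff)
  then have "((\<lambda>x. (g x - g 0) / x) \<longlongrightarrow> D) (at_right 0)"
    by (rule tendsto_within_subset) simp
  then have "((\<lambda>x. \<bar>(g x - g 0) / x\<bar>) \<longlongrightarrow> \<bar>D\<bar>) (at_right 0)"
    by (rule tendsto_rabs)
  then have "eventually (\<lambda>x. \<bar>(g x - g 0) / x\<bar> < \<bar>D\<bar> + 1) (at_right 0)"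
    by (rule order_tendstoD) simp
  then show "eventually (\<lambda>x. \<bar>g x - g 0\<bar> \<le> (\<bar>D\<bar> + 1) * x) (at_right 0)"
    using eventually_at_right_less[of 0]
  proof eventually_elim
    case (elim x)
    then show ?case by (simp add: abs_divide field_simps)
  qed
qed simp

lemma eval_fps_diffable:
  fixes f :: "real fps"
  assumes "0 < R" "ereal R \<le> fps_conv_radius f"
  shows "(eval_fps f has_real_derivative eval_fps (fps_deriv f) 0) (at 0)"
  by (rule has_field_derivative_eval_fps, rule less_le_trans[OF _ assms(2)]) (use assms(1) in simp)

lemma eval_fps_shift_eq:
  fixes f :: "real fps"
  assumes "\<And>i. i < k \<Longrightarrow> fps_nth f i = 0" "ereal R \<le> fps_conv_radius f" "\<bar>x\<bar> < R"
  shows "eval_fps f x = x ^ k * eval_fps (fps_shift k f) x"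
proof -
  have f: "f = fps_X ^ k * fps_shift k f"
    using assms(1) by (intro fps_ext) (auto simp: fps_X_power_mult_nth)
  have "ereal (norm x) < fps_conv_radius f"
    by (rule less_le_trans[OF _ assms(2)]) (use assms(3) in simp)
  then have "eval_fps (fps_X ^ k * fps_shift k f) x = x ^ k * eval_fps (fps_shift k f) x"
    by (subst eval_fps_mult) auto
  with f show ?thesis by simp
qed

text \<open>
  The constants come from \<open>- K / w x = - A / x\<^sup>2 + B / x + D + O(x)\<close>.
\<close>

lemma theta_asymp:
  fixes w v Y :: "real fps" and K :: real
  assumes R: "0 < R" "ereal R \<le> fps_conv_radius v" "ereal R \<le> fps_conv_radius w" "ereal R \<le> fps_conv_radius Y"
    and v: "v ^ 2 = w" "fps_nth v 0 = 0" "0 < fps_nth v 1" and Y: "fps_nth Y 0 = 1"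
  defines "a \<equiv> fps_nth w 2"
  defines "A \<equiv> K / a" and "B \<equiv> K * fps_nth w 3 / a\<^sup>2" and "D \<equiv> K * (fps_nth w 4 / a\<^sup>2 - (fps_nth w 3)\<^sup>2 / a ^ 3)"
  obtains C where "0 \<le> C"
    "eventually (\<lambda>x. \<bar>exp (- K / (eval_fps v x)\<^sup>2) / eval_fps v x ^ 3 * eval_fps Y x
        - exp D / fps_nth v 1 ^ 3 * (1 / x ^ 3 * exp (- A / x\<^sup>2 + B / x))\<bar>
      \<le> C * (1 / x\<^sup>2 * exp (- A / x\<^sup>2 + B / x))) (at_right 0)"
proof -
  define \<nu> where "\<nu> = fps_shift 1 v"
  define \<omega> where "\<omega> = fps_shift 2 w"
  have w01: "fps_nth w 0 = 0" "fps_nth w 1 = 0" "a = (fps_nth v 1)\<^sup>2"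
    using v unfolding a_def v(1)[symmetric] power2_eq_square
    by (simp_all add: fps_mult_nth numeral_2_eq_2)
  have a: "0 < a" using w01 v by simp
  \<comment> \<open>The expansion cleared of denominators: with w = x^2 \<omega>, the constants A,
    B, D are those for which P has order 3, and P = x^3 S gives K/w = A/x^2 - B/x - D + x
    S/\<omega>.\<close>
  define P where "P = fps_const K - (fps_const A - fps_const B * fps_X - fps_const D * fps_X ^ 2) * \<omega>"
  define S where "S = fps_shift 3 P"
  have P0: "fps_nth P i = 0" if "i < 3" for i
  proof -
    have om: "fps_nth \<omega> 0 = a" "fps_nth \<omega> 1 = fps_nth w 3" "fps_nth \<omega> 2 = fps_nth w 4"
      by (simp_all add: \<omega>_def a_def eval_nat_numeral)
    have "fps_nth P 0 = 0" using a by (simp add: P_def \<omega>_def A_def a_def numeral_2_eq_2)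
    moreover have "fps_nth P 1 = 0"
      using a om by (simp add: P_def left_diff_distrib mult.assoc A_def B_def power2_eq_square fps_X_power_mult_nth)
    moreover have "fps_nth P 2 = 0"
    proof -
      have "fps_nth P 2 = - (A * fps_nth w 4 - B * fps_nth w 3 - D * a)"
        using om by (simp add: P_def left_diff_distrib mult.assoc fps_X_power_mult_nth)
      also have "A * fps_nth w 4 - B * fps_nth w 3 - D * a = 0"
        using a by (simp add: A_def B_def D_def power2_eq_square power3_eq_cube field_simps)
      finally show ?thesis by simp
    qed
    ultimately show ?thesis using that by (auto simp: less_Suc_eq numeral_3_eq_3 numeral_2_eq_2)
  qed
  have r\<nu>: "ereal R \<le> fps_conv_radius \<nu>" and r\<omega>: "ereal R \<le> fps_conv_radius \<omega>"
    using R by (simp_all add: \<nu>_def \<omega>_def)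
  have rq: "ereal R \<le> fps_conv_radius (fps_const A - fps_const B * fps_X - fps_const D * fps_X ^ 2)"
    by (intro fps_radius_diff fps_radius_mult) auto
  have rP: "ereal R \<le> fps_conv_radius P"
    unfolding P_def by (intro fps_radius_diff fps_radius_mult[OF rq r\<omega>]) auto
  have rS: "ereal R \<le> fps_conv_radius S" using rP by (simp add: S_def)
  have lr: "ereal (norm y) < fps_conv_radius f" if "ereal R \<le> fps_conv_radius f" "\<bar>y\<bar> < R" for y :: real and f :: "real fps"
    by (rule less_le_trans[OF _ that(1)]) (use that(2) in simp)
  have \<nu>0: "eval_fps \<nu> 0 = fps_nth v 1" "eval_fps \<omega> 0 = a" "eval_fps Y 0 = 1"
    by (simp_all add: eval_fps_at_0 \<nu>_def \<omega>_def a_def Y numeral_2_eq_2)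
  \<comment> \<open>All factors other than x^(-3) exp(- A/x^2 + B/x + D). It is differentiable at 0,
    so replacing it by its value there costs a relative error O(x).\<close>
  define g where "g = (\<lambda>x. exp (- (x * eval_fps S x / eval_fps \<omega> x)) * eval_fps Y x / eval_fps \<nu> x ^ 3)"
  have nz: "eval_fps \<omega> 0 \<noteq> 0" "eval_fps \<nu> 0 ^ 3 \<noteq> 0" using a v \<nu>0 by auto
  have "\<exists>D'. (g has_real_derivative D') (at 0)"
    unfolding g_def
    by (rule exI, rule DERIV_divide[OF DERIV_mult[OF DERIV_fun_exp[OF DERIV_minus[OF DERIV_divide[OF
          DERIV_mult[OF DERIV_ident eval_fps_diffable[OF R(1) rS]] eval_fps_diffable[OF R(1) r\<omega>] nz(1)]]]
        eval_fps_diffable[OF R(1) R(4)]] DERIV_power[OF eval_fps_diffable[OF R(1) r\<nu>]] nz(2)])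
  then obtain D' where "(g has_real_derivative D') (at 0)" by blast
  then obtain c where c: "0 \<le> c" "eventually (\<lambda>x. \<bar>g x - g 0\<bar> \<le> c * x) (at_right 0)"
    by (rule deriv_bound_at_right)
  have g0: "g 0 = 1 / fps_nth v 1 ^ 3" by (simp add: g_def \<nu>0)
  have "isCont (eval_fps \<omega>) 0" by (rule DERIV_isCont[OF eval_fps_diffable[OF R(1) r\<omega>]])
  then have "(eval_fps \<omega> \<longlongrightarrow> a) (at_right 0)"
    unfolding isCont_def \<nu>0 by (rule tendsto_within_subset) simp
  then have \<omega>pos: "eventually (\<lambda>x. 0 < eval_fps \<omega> x) (at_right 0)"
    using a by (rule order_tendstoD)
  have "eventually (\<lambda>x. 0 < x \<and> x < R) (at_right 0)"
    using eventually_at_right_real[OF R(1)] by simp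
  with c(2) \<omega>pos have "eventually (\<lambda>x. \<bar>exp (- K / (eval_fps v x)\<^sup>2) / eval_fps v x ^ 3 * eval_fps Y x
        - exp D / fps_nth v 1 ^ 3 * (1 / x ^ 3 * exp (- A / x\<^sup>2 + B / x))\<bar>
      \<le> (exp D * c) * (1 / x\<^sup>2 * exp (- A / x\<^sup>2 + B / x))) (at_right 0)"
  proof eventually_elim
    case (elim x)
    then have x: "0 < x" "\<bar>x\<bar> < R" and om: "0 < eval_fps \<omega> x" by auto
    have ev: "eval_fps v x = x * eval_fps \<nu> x"
      using eval_fps_shift_eq[of 1 v R x] R x v by (simp add: \<nu>_def)
    have ew: "eval_fps w x = x\<^sup>2 * eval_fps \<omega> x"
      unfolding \<omega>_def by (rule eval_fps_shift_eq[OF _ R(3) x(2)]) (use w01 in \<open>auto simp: less_2_cases_iff\<close>)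
    have "eval_fps w x = (eval_fps v x)\<^sup>2"
      unfolding v(1)[symmetric] by (rule eval_fps_power, rule lr[OF R(2) x(2)])
    with ew have v2: "(eval_fps v x)\<^sup>2 = x\<^sup>2 * eval_fps \<omega> x" by simp
    have eP: "eval_fps P x = K - (A - B * x - D * x\<^sup>2) * eval_fps \<omega> x"
    proof -
      have q: "eval_fps (fps_const A - fps_const B * fps_X - fps_const D * fps_X ^ 2) x = A - B * x - D * x\<^sup>2"
      proof -
        have e: "fps_const A - fps_const B * fps_X - fps_const D * fps_X ^ 2 = fps_of_poly [:A, - B, - D:]"
          by (simp add: fps_of_poly_pCons algebra_simps power2_eq_square flip: fps_const_neg)
        show ?thesis unfolding e eval_fps_of_poly by (simp add: algebra_simps power2_eq_square)
      qed
      show ?thesis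
        unfolding P_def using lr[OF rq x(2)] lr[OF r\<omega> x(2)] lr[OF fps_radius_mult[OF rq r\<omega>] x(2)]
        by (subst eval_fps_diff) (auto simp: eval_fps_mult q)
    qed
    have eS: "eval_fps P x = x ^ 3 * eval_fps S x"
      using eval_fps_shift_eq[of 3 P R x] rP x P0 by (simp add: S_def)
    have "- K / (eval_fps v x)\<^sup>2 = - A / x\<^sup>2 + B / x + D - x * eval_fps S x / eval_fps \<omega> x"
    proof -
      have "K = (A - B * x - D * x\<^sup>2) * eval_fps \<omega> x + x ^ 3 * eval_fps S x"
        using eP eS by simp
      then have "K / (x\<^sup>2 * eval_fps \<omega> x) = ((A - B * x - D * x\<^sup>2) * eval_fps \<omega> x + x ^ 3 * eval_fps S x) / (x\<^sup>2 * eval_fps \<omega> x)"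
        by simp
      also have "\<dots> = A / x\<^sup>2 - B / x - D + x * eval_fps S x / eval_fps \<omega> x"
        using x om by (simp add: field_simps power2_eq_square power3_eq_cube)
      finally show ?thesis unfolding v2 by simp
    qed
    then have "exp (- K / (eval_fps v x)\<^sup>2) = exp D * exp (- A / x\<^sup>2 + B / x) * exp (- (x * eval_fps S x / eval_fps \<omega> x))"
      by (simp add: exp_add[symmetric] algebra_simps)
    then have "exp (- K / (eval_fps v x)\<^sup>2) / eval_fps v x ^ 3 * eval_fps Y x = exp D * (1 / x ^ 3 * exp (- A / x\<^sup>2 + B / x)) * g x"
      by (simp add: ev g_def power_mult_distrib)
    then have "exp (- K / (eval_fps v x)\<^sup>2) / eval_fps v x ^ 3 * eval_fps Y x
        - exp D / fps_nth v 1 ^ 3 * (1 / x ^ 3 * exp (- A / x\<^sup>2 + B / x))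
        = exp D * (1 / x ^ 3 * exp (- A / x\<^sup>2 + B / x)) * (g x - g 0)"
      by (simp add: g0 right_diff_distrib)
    then have "\<bar>exp (- K / (eval_fps v x)\<^sup>2) / eval_fps v x ^ 3 * eval_fps Y x
        - exp D / fps_nth v 1 ^ 3 * (1 / x ^ 3 * exp (- A / x\<^sup>2 + B / x))\<bar>
        = exp D * (1 / x ^ 3 * exp (- A / x\<^sup>2 + B / x)) * \<bar>g x - g 0\<bar>"
      using x by (simp only: abs_mult abs_exp_cancel abs_of_nonneg) (simp add: abs_mult)
    also have "\<dots> \<le> exp D * (1 / x ^ 3 * exp (- A / x\<^sup>2 + B / x)) * (c * x)"
      using elim x by (intro mult_left_mono) auto
    also have "\<dots> = (exp D * c) * (1 / x\<^sup>2 * exp (- A / x\<^sup>2 + B / x))"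
      using x by (simp add: power2_eq_square power3_eq_cube)
    finally show ?case .
  qed
  with c(1) show ?thesis by (intro that[of "exp D * c"]) auto
qed

lemma abs_exp_minus_one_minus_le:
  fixes x :: real
  assumes "\<bar>x\<bar> \<le> 1"
  shows "\<bar>exp x - 1 - x\<bar> \<le> exp 1 * x\<^sup>2"
proof -
  have "1 + x \<le> exp x" by (rule exp_ge_add_one_self)
  moreover have "exp x - 1 \<le> x * exp x"
  proof -
    have "1 - x \<le> exp (- x)" using exp_ge_add_one_self[of "- x"] by simp
    then have "exp x * (1 - x) \<le> exp x * exp (- x)" by (intro mult_left_mono) auto
    then show ?thesis by (simp add: right_diff_distrib mult.commute flip: exp_add)
  qed
  ultimately have "\<bar>exp x - 1 - x\<bar> \<le> x * (exp x - 1)"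
    unfolding right_diff_distrib by linarith
  also have "\<dots> \<le> \<bar>x\<bar> * \<bar>exp x - 1\<bar>" by (metis abs_ge_self abs_mult)
  also have "\<dots> \<le> \<bar>x\<bar> * (\<bar>x\<bar> * exp 1)"
    using abs_exp_diff_le[of x 1 0] assms by (intro mult_left_mono) simp_all
  also have "\<dots> = exp 1 * x\<^sup>2"
    by (subst mult.assoc[symmetric], subst abs_mult_self_eq) (simp add: power2_eq_square)
  finally show ?thesis .
qed

lemma abs_ln_diff_le:
  fixes x y e :: real
  assumes "0 < e" "e \<le> x" "e \<le> y"
  shows "\<bar>ln x - ln y\<bar> \<le> \<bar>x - y\<bar> / e"
proof -
  have *: "ln p - ln q \<le> \<bar>p - q\<bar> / e" if "e \<le> p" "e \<le> q" for p q
  proof -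
    have pq: "0 < p" "0 < q" using that assms(1) by auto
    have "ln p - ln q = ln (p / q)" using pq by (simp add: ln_div)
    also have "\<dots> \<le> p / q - 1" using pq by (intro ln_le_minus_one) simp
    also have "\<dots> = (p - q) / q" using pq by (simp add: field_simps)
    also have "\<dots> \<le> \<bar>p - q\<bar> / q" using pq by (intro divide_right_mono) auto
    also have "\<dots> \<le> \<bar>p - q\<bar> / e" using assms(1) that by (intro divide_left_mono) auto
    finally show ?thesis .
  qed
  from *[of x y] *[of y x] assms show ?thesis by (simp add: abs_minus_commute abs_le_iff)
qed

text \<open>The integrands are compared through their quotient e^\<delta>. In \<delta> the term -
  K/w + K/w' dominates: w - w' has order at least q and w w' has order 4, which gives \<eta>
  x^(q-4). The cubes of v, v' and the factors Y, Y' change \<delta> only by O(x^(q-3)). The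
  difference is thus \<eta> x^(q-4) times either integrand, to leading order.\<close>

lemma theta_diff_asymp:
  fixes w v w' v' :: "real fps" and K :: real
  defines "Y \<equiv> fps_exp (1 / 24) oo w" and "Y' \<equiv> fps_exp (1 / 24) oo w'"
  assumes R: "0 < R" "ereal R \<le> fps_conv_radius v" "ereal R \<le> fps_conv_radius w" "ereal R \<le> fps_conv_radius Y"
    and R': "ereal R \<le> fps_conv_radius v'" "ereal R \<le> fps_conv_radius w'" "ereal R \<le> fps_conv_radius Y'"
    and v: "v ^ 2 = w" "fps_nth v 0 = 0" "0 < fps_nth v 1"
    and v': "v' ^ 2 = w'" "fps_nth v' 0 = 0" "0 < fps_nth v' 1"
    and q: "5 \<le> q" "\<And>i. i < q \<Longrightarrow> fps_nth w i = fps_nth w' i" and w3: "fps_nth w 3 = 0"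
  defines "a \<equiv> fps_nth w 2"
  defines "A \<equiv> K / a" and "D \<equiv> K * fps_nth w 4 / a\<^sup>2" and "\<eta> \<equiv> K * (fps_nth w q - fps_nth w' q) / a\<^sup>2"
  obtains C where "0 \<le> C"
    "eventually (\<lambda>x. \<bar>exp (- K / (eval_fps v x)\<^sup>2) / eval_fps v x ^ 3 * eval_fps Y x
        - exp (- K / (eval_fps v' x)\<^sup>2) / eval_fps v' x ^ 3 * eval_fps Y' x
        - exp D / fps_nth v 1 ^ 3 * \<eta> * (x ^ (q - 4) / x ^ 3 * exp (- A / x\<^sup>2))\<bar>
      \<le> C * (x ^ (q - 4) / x\<^sup>2 * exp (- A / x\<^sup>2))) (at_right 0)"
proof -
  have lr: "ereal (norm y) < fps_conv_radius f" if "ereal R \<le> fps_conv_radius f" "\<bar>y\<bar> < R" for y :: real and f :: "real fps"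
    by (rule less_le_trans[OF _ that(1)]) (use that(2) in simp)
  have w01: "fps_nth w 0 = 0" "fps_nth w 1 = 0" "a = (fps_nth v 1)\<^sup>2"
    using v unfolding a_def v(1)[symmetric] power2_eq_square
    by (simp_all add: fps_mult_nth numeral_2_eq_2)
  have w01': "fps_nth w' 0 = 0" "fps_nth w' 1 = 0" "fps_nth w' 2 = (fps_nth v' 1)\<^sup>2"
    using v' unfolding v'(1)[symmetric] power2_eq_square
    by (simp_all add: fps_mult_nth numeral_2_eq_2)
  have a: "0 < a" using w01 v by simp
  have a': "fps_nth w' 2 = a" using q by (simp add: a_def)
  have "(fps_nth v' 1)\<^sup>2 = (fps_nth v 1)\<^sup>2" using w01 w01' a' by simp
  then have v1: "fps_nth v' 1 = fps_nth v 1" using v(3) v'(3) by (simp add: power2_eq_iff)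
  define \<omega> where "\<omega> = fps_shift 2 w"
  define \<omega>' where "\<omega>' = fps_shift 2 w'"
  define d where "d = w - w'"
  define Wd where "Wd = fps_shift q d"
  have rd: "ereal R \<le> fps_conv_radius d" unfolding d_def by (intro fps_radius_diff R R')
  have r: "ereal R \<le> fps_conv_radius \<omega>" "ereal R \<le> fps_conv_radius \<omega>'" "ereal R \<le> fps_conv_radius Wd"
    using R R' rd by (simp_all add: \<omega>_def \<omega>'_def Wd_def)
  have e0: "eval_fps \<omega> 0 = a" "eval_fps \<omega>' 0 = a" "eval_fps Wd 0 = fps_nth w q - fps_nth w' q"
    using a' by (simp_all add: eval_fps_at_0 \<omega>_def \<omega>'_def Wd_def d_def a_def eval_nat_numeral)
  define e1 where "e1 = (\<lambda>x. K * eval_fps Wd x / (eval_fps \<omega> x * eval_fps \<omega>' x))"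
  have "eval_fps \<omega> 0 * eval_fps \<omega>' 0 \<noteq> 0" using a e0 by simp
  then obtain D1 where "(e1 has_real_derivative D1) (at 0)"
    unfolding e1_def
    using DERIV_divide[OF DERIV_cmult[OF eval_fps_diffable[OF R(1) r(3)], of K] DERIV_mult[OF eval_fps_diffable[OF R(1) r(1)] eval_fps_diffable[OF R(1) r(2)]]]
    by blast
  then obtain c1 where c1: "0 \<le> c1" "eventually (\<lambda>x. \<bar>e1 x - e1 0\<bar> \<le> c1 * x) (at_right 0)"
    by (rule deriv_bound_at_right)
  have e10: "e1 0 = \<eta>" by (simp add: e1_def e0 \<eta>_def power2_eq_square)
  have lim: "(eval_fps f \<longlongrightarrow> eval_fps f 0) (at_right 0)" if "ereal R \<le> fps_conv_radius f" for f :: "real fps"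
    using DERIV_isCont[OF eval_fps_diffable[OF R(1) that]] unfolding isCont_def by (rule tendsto_within_subset) simp
  have \<omega>pos: "eventually (\<lambda>x. a / 2 < eval_fps \<omega> x) (at_right 0)" "eventually (\<lambda>x. a / 2 < eval_fps \<omega>' x) (at_right 0)"
    by (rule order_tendstoD(1)[OF lim[OF r(1)]], use a e0 in simp,
        rule order_tendstoD(1)[OF lim[OF r(2)]], use a e0 in simp)
  define b where "b = \<bar>eval_fps Wd 0\<bar> + 1"
  have Wb: "eventually (\<lambda>x. \<bar>eval_fps Wd x\<bar> < b) (at_right 0)"
    using tendsto_rabs[OF lim[OF r(3)]] by (rule order_tendstoD) (simp add: b_def)
  have b: "0 \<le> b" by (simp add: b_def)
  define \<nu> where "\<nu> = fps_shift 1 v"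
  define \<nu>' where "\<nu>' = fps_shift 1 v'"
  have r\<nu>: "ereal R \<le> fps_conv_radius \<nu>" "ereal R \<le> fps_conv_radius \<nu>'"
    using R R' by (simp_all add: \<nu>_def \<nu>'_def)
  have \<nu>pos: "eventually (\<lambda>x. 0 < eval_fps \<nu> x) (at_right 0)" "eventually (\<lambda>x. 0 < eval_fps \<nu>' x) (at_right 0)"
    using lim[OF r\<nu>(1)] lim[OF r\<nu>(2)] v v' by (auto intro!: order_tendstoD simp: eval_fps_at_0 \<nu>_def \<nu>'_def)
  obtain C' where C': "0 \<le> C'"
    "eventually (\<lambda>x. \<bar>exp (- K / (eval_fps v' x)\<^sup>2) / eval_fps v' x ^ 3 * eval_fps Y' x
        - exp (K * (fps_nth w' 4 / (fps_nth w' 2)\<^sup>2 - (fps_nth w' 3)\<^sup>2 / fps_nth w' 2 ^ 3)) / fps_nth v' 1 ^ 3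
          * (1 / x ^ 3 * exp (- (K / fps_nth w' 2) / x\<^sup>2 + (K * fps_nth w' 3 / (fps_nth w' 2)\<^sup>2) / x))\<bar>
      \<le> C' * (1 / x\<^sup>2 * exp (- (K / fps_nth w' 2) / x\<^sup>2 + (K * fps_nth w' 3 / (fps_nth w' 2)\<^sup>2) / x))) (at_right 0)"
    by (rule theta_asymp[OF R(1) R' v', of K]) (auto simp: Y'_def)
  have w34': "fps_nth w' 3 = 0" "fps_nth w' 4 = fps_nth w 4" using q w3 by auto
  define \<kappa> where "\<kappa> = exp D / fps_nth v 1 ^ 3"
  have \<kappa>: "0 < \<kappa>" using v(3) by (simp add: \<kappa>_def)
  define G where "G = (\<lambda>x::real. exp (- A / x\<^sup>2))"
  define \<Phi> where "\<Phi> = (\<lambda>x. exp (- K / (eval_fps v x)\<^sup>2) / eval_fps v x ^ 3 * eval_fps Y x)"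
  define \<Phi>' where "\<Phi>' = (\<lambda>x. exp (- K / (eval_fps v' x)\<^sup>2) / eval_fps v' x ^ 3 * eval_fps Y' x)"
  have P': "eventually (\<lambda>x. \<bar>\<Phi>' x - \<kappa> * (1 / x ^ 3 * G x)\<bar> \<le> C' * (1 / x\<^sup>2 * G x)) (at_right 0)"
    using C'(2) by (simp add: w34' a' v1[unfolded One_nat_def] \<Phi>'_def \<kappa>_def G_def D_def A_def)
  define c2 where "c2 = c1 + 3 * b / a + b / 24"
  have c2: "0 \<le> c2" using c1 a b by (simp add: c2_def)
  define c3 where "c3 = \<bar>\<eta>\<bar> + c2"
  define c4 where "c4 = exp 1 * c3\<^sup>2 + c2"
  have c34: "0 \<le> c3" "0 \<le> c4" using c2 by (auto simp: c3_def c4_def)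
  \<comment> \<open>The bound 1/(c3 + 1) forces |\<delta>| <= 1, as the quadratic estimate for exp
    requires.\<close>
  have small: "eventually (\<lambda>x. 0 < x \<and> x < min R (min 1 (1 / (c3 + 1)))) (at_right 0)"
    using eventually_at_right_real[of 0 "min R (min 1 (1 / (c3 + 1)))"] R(1) c34 by simp
  have "eventually (\<lambda>x. \<bar>\<Phi> x - \<Phi>' x - \<kappa> * \<eta> * (x ^ (q - 4) / x ^ 3 * G x)\<bar>
      \<le> (C' * (\<bar>\<eta>\<bar> + c4) + \<kappa> * c4) * (x ^ (q - 4) / x\<^sup>2 * G x)) (at_right 0)"
    using small P' Wb \<omega>pos \<nu>pos c1(2)
  proof eventually_elim
    case (elim x)
    have "0 < x" "x < R" "x \<le> 1" "x < 1 / (c3 + 1)" using elim(1) by auto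
    moreover from this have "x * (c3 + 1) \<le> 1" using c34 by (simp add: field_simps)
    ultimately have x: "0 < x" "x < R" "x \<le> 1" "x * (c3 + 1) \<le> 1" "\<bar>x\<bar> < R" by auto
    define V where "V = eval_fps v x"
    define V' where "V' = eval_fps v' x"
    define W where "W = eval_fps w x"
    define W' where "W' = eval_fps w' x"
    have VV: "V = x * eval_fps \<nu> x" "V' = x * eval_fps \<nu>' x"
    proof -
      have "eval_fps v x = x ^ 1 * eval_fps (fps_shift 1 v) x"
        by (rule eval_fps_shift_eq[OF _ R(2) x(5)]) (use v(2) in simp)
      then show "V = x * eval_fps \<nu> x" by (simp only: V_def \<nu>_def power_one_right)
      have "eval_fps v' x = x ^ 1 * eval_fps (fps_shift 1 v') x"
        by (rule eval_fps_shift_eq[OF _ R'(1) x(5)]) (use v'(2) in simp)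
      then show "V' = x * eval_fps \<nu>' x" by (simp only: V'_def \<nu>'_def power_one_right)
    qed
    have Vpos: "0 < V" "0 < V'" using VV elim x by auto
    have W: "W = x\<^sup>2 * eval_fps \<omega> x"
      unfolding W_def \<omega>_def by (rule eval_fps_shift_eq[OF _ R(3) x(5)]) (use w01 in \<open>auto simp: less_2_cases_iff\<close>)
    have W': "W' = x\<^sup>2 * eval_fps \<omega>' x"
      unfolding W'_def \<omega>'_def by (rule eval_fps_shift_eq[OF _ R'(2) x(5)]) (use w01' in \<open>auto simp: less_2_cases_iff\<close>)
    have VW: "V\<^sup>2 = W" "V'\<^sup>2 = W'"
      unfolding V_def V'_def W_def W'_def v(1)[symmetric] v'(1)[symmetric]
      using eval_fps_power[OF lr[OF R(2) x(5)]] eval_fps_power[OF lr[OF R'(1) x(5)]] by simp_all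
    have Wdiff: "W - W' = x ^ q * eval_fps Wd x"
    proof -
      have "W - W' = eval_fps d x"
        unfolding W_def W'_def d_def using lr[OF R(3) x(5)] lr[OF R'(2) x(5)] by (subst eval_fps_diff) auto
      also have "\<dots> = x ^ q * eval_fps Wd x"
        unfolding Wd_def by (rule eval_fps_shift_eq[OF _ rd x(5)]) (use q in \<open>auto simp: d_def\<close>)
      finally show ?thesis .
    qed
    have YY: "eval_fps Y x = exp (W / 24)" "eval_fps Y' x = exp (W' / 24)"
      using eval_fps_exp_compose[OF w01(1) R(1,3) R(4)[unfolded Y_def] x(5)]
        eval_fps_exp_compose[OF w01'(1) R(1) R'(2) R'(3)[unfolded Y'_def] x(5)]
      by (simp_all add: Y_def Y'_def W_def W'_def)
    define \<delta> where "\<delta> = (- K / W + K / W') - 3 * (ln V - ln V') + (W - W') / 24"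
    have \<Phi>\<delta>: "\<Phi> x = \<Phi>' x * exp \<delta>"
    proof -
      have "exp \<delta> = exp (- K / W) / exp (- K / W') * (V' ^ 3 / V ^ 3) * (exp (W / 24) / exp (W' / 24))"
      proof -
        have "exp (- 3 * (ln V - ln V')) = V' ^ 3 / V ^ 3"
        proof -
          have "- 3 * (ln V - ln V') = ln (V' ^ 3) - ln (V ^ 3)" using Vpos by (simp add: ln_realpow)
          then show ?thesis using Vpos by (simp only: exp_diff) simp
        qed
        moreover have "\<delta> = (- K / W - - K / W') + (- 3 * (ln V - ln V')) + (W / 24 - W' / 24)"
          by (simp add: \<delta>_def diff_divide_distrib)
        ultimately show ?thesis by (simp only: exp_add exp_diff)
      qed
      then show ?thesis
        using Vpos unfolding \<Phi>_def \<Phi>'_def YY V_def[symmetric] V'_def[symmetric] VW by simp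
    qed
    have xq: "x ^ q = x ^ (q - 4) * x ^ 4" "x ^ q = x ^ (q - 2) * x ^ 2" "x ^ (q - 3) = x ^ (q - 4) * x"
    proof -
      have "q = (q - 4) + 4" "q = (q - 2) + 2" "q - 3 = Suc (q - 4)" using q(1) by auto
      then show "x ^ q = x ^ (q - 4) * x ^ 4" "x ^ q = x ^ (q - 2) * x ^ 2" "x ^ (q - 3) = x ^ (q - 4) * x"
        by (metis power_add power_Suc2)+
    qed
    have t1: "- K / W + K / W' = x ^ (q - 4) * e1 x"
    proof -
      have pos: "0 < W" "0 < W'" using VW Vpos by (metis zero_less_power)+
      have "- K / W + K / W' = K * (W - W') / (W * W')" using pos by (simp add: field_simps)
      also have "\<dots> = x ^ (q - 4) * e1 x"
        unfolding Wdiff unfolding W W' xq(1) e1_def using x(1) by (simp add: power2_eq_square power4_eq_xxxx)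
      finally show ?thesis .
    qed
    \<comment> \<open>\<omega> - \<omega>' = O(x^(q-2)) would give one order more; x^(q-3) is all
      that is needed.\<close>
    have t2: "\<bar>3 * (ln V - ln V')\<bar> \<le> (3 * b / a) * x ^ (q - 3)"
    proof -
      have l1: "ln V - ln V' = (ln (eval_fps \<omega> x) - ln (eval_fps \<omega>' x)) / 2"
      proof -
        have "2 * ln V = ln (x\<^sup>2) + ln (eval_fps \<omega> x)"
        proof -
          have "2 * ln V = ln (V\<^sup>2)" using Vpos by (simp add: ln_realpow)
          also have "\<dots> = ln (x\<^sup>2) + ln (eval_fps \<omega> x)"
            unfolding VW(1) W by (rule ln_mult_pos) (use x elim a in auto)
          finally show ?thesis .
        qed
        moreover have "2 * ln V' = ln (x\<^sup>2) + ln (eval_fps \<omega>' x)"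
        proof -
          have "2 * ln V' = ln (V'\<^sup>2)" using Vpos by (simp add: ln_realpow)
          also have "\<dots> = ln (x\<^sup>2) + ln (eval_fps \<omega>' x)"
            unfolding VW(2) W' by (rule ln_mult_pos) (use x elim a in auto)
          finally show ?thesis .
        qed
        ultimately show ?thesis by simp
      qed
      have l2: "\<bar>ln (eval_fps \<omega> x) - ln (eval_fps \<omega>' x)\<bar> \<le> \<bar>eval_fps \<omega> x - eval_fps \<omega>' x\<bar> / (a / 2)"
        using elim a by (intro abs_ln_diff_le) auto
      have l3: "eval_fps \<omega> x - eval_fps \<omega>' x = x ^ (q - 2) * eval_fps Wd x"
      proof -
        have "x\<^sup>2 * (eval_fps \<omega> x - eval_fps \<omega>' x) = x\<^sup>2 * (x ^ (q - 2) * eval_fps Wd x)"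
          using Wdiff unfolding W W' xq(2) by (simp add: algebra_simps)
        then show ?thesis using x(1) by simp
      qed
      have l4: "\<bar>x ^ (q - 2) * eval_fps Wd x\<bar> \<le> x ^ (q - 3) * b"
        unfolding abs_mult using elim x q(1) by (intro mult_mono) (auto intro!: power_decreasing)
      have "\<bar>3 * (ln V - ln V')\<bar> = 3 / 2 * \<bar>ln (eval_fps \<omega> x) - ln (eval_fps \<omega>' x)\<bar>"
        unfolding l1 by (simp only: abs_mult abs_divide abs_numeral)
      also have "\<dots> \<le> 3 / 2 * (x ^ (q - 3) * b / (a / 2))"
        using order_trans[OF l2 divide_right_mono[OF l4[folded l3]]] a by (intro mult_left_mono) auto
      also have "\<dots> = (3 * b / a) * x ^ (q - 3)" by simp
      finally show ?thesis .
    qed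
    have t3: "\<bar>(W - W') / 24\<bar> \<le> (b / 24) * x ^ (q - 3)"
    proof -
      have "\<bar>x ^ q * eval_fps Wd x\<bar> \<le> x ^ (q - 3) * b"
        unfolding abs_mult using elim x q(1) by (intro mult_mono) (auto intro!: power_decreasing)
      then show ?thesis unfolding Wdiff by (simp add: mult.commute[of b])
    qed
    have t4: "\<bar>x ^ (q - 4) * e1 x - \<eta> * x ^ (q - 4)\<bar> \<le> c1 * x ^ (q - 3)"
    proof -
      have "\<bar>x ^ (q - 4) * e1 x - \<eta> * x ^ (q - 4)\<bar> = x ^ (q - 4) * \<bar>e1 x - e1 0\<bar>"
        using x by (simp add: e10 abs_mult mult.commute[of \<eta>] flip: right_diff_distrib)
      also have "\<dots> \<le> x ^ (q - 4) * (c1 * x)" using elim x by (intro mult_left_mono) auto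
      finally show ?thesis by (simp add: xq mult_ac)
    qed
    have d1: "\<bar>\<delta> - \<eta> * x ^ (q - 4)\<bar> \<le> c2 * x ^ (q - 3)"
      using t2 t3 t4 unfolding \<delta>_def t1 c2_def distrib_right by linarith
    have "c2 * x ^ (q - 3) \<le> c2 * x ^ (q - 4)"
      using c2 x by (intro mult_left_mono power_decreasing) auto
    moreover have "\<bar>\<eta> * x ^ (q - 4)\<bar> = \<bar>\<eta>\<bar> * x ^ (q - 4)" using x by (simp add: abs_mult)
    ultimately have d2: "\<bar>\<delta>\<bar> \<le> c3 * x ^ (q - 4)"
      using d1 unfolding c3_def distrib_right by linarith
    have "x ^ (q - 4) \<le> x ^ 1" using x q(1) by (intro power_decreasing) auto
    then have "c3 * x ^ (q - 4) \<le> c3 * x" using c34 by (intro mult_left_mono) auto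
    also have "\<dots> \<le> 1" using x c34 by (simp add: algebra_simps)
    finally have d3: "\<bar>\<delta>\<bar> \<le> 1" using d2 by simp
    have "\<bar>exp \<delta> - 1 - \<delta>\<bar> \<le> exp 1 * \<delta>\<^sup>2" by (rule abs_exp_minus_one_minus_le[OF d3])
    also have "\<dots> \<le> exp 1 * (c3\<^sup>2 * x ^ (q - 3))"
    proof (rule mult_left_mono)
      have "\<bar>\<delta>\<bar>\<^sup>2 \<le> (c3 * x ^ (q - 4))\<^sup>2" using d2 by (rule power_mono) simp
      then have "\<delta>\<^sup>2 \<le> (c3 * x ^ (q - 4))\<^sup>2" by simp
      also have "\<dots> = c3\<^sup>2 * x ^ (2 * (q - 4))" by (simp add: power_mult_distrib mult.commute flip: power_mult)
      \<comment> \<open>2 (q - 4) >= q - 3 because q >= 5.\<close>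
      also have "\<dots> \<le> c3\<^sup>2 * x ^ (q - 3)" using x q(1) by (intro mult_left_mono power_decreasing) auto
      finally show "\<delta>\<^sup>2 \<le> c3\<^sup>2 * x ^ (q - 3)" .
    qed simp
    finally have E: "\<bar>exp \<delta> - 1 - \<eta> * x ^ (q - 4)\<bar> \<le> c4 * x ^ (q - 3)"
      using d1 unfolding c4_def distrib_right mult.assoc by linarith
    have "c4 * x ^ (q - 3) \<le> c4 * x ^ (q - 4)"
      using c34 x by (intro mult_left_mono power_decreasing) auto
    with E \<open>\<bar>\<eta> * x ^ (q - 4)\<bar> = \<bar>\<eta>\<bar> * x ^ (q - 4)\<close> have E2: "\<bar>exp \<delta> - 1\<bar> \<le> (\<bar>\<eta>\<bar> + c4) * x ^ (q - 4)"
      unfolding distrib_right by linarith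
    have Gp: "0 < G x" by (simp add: G_def)
    have "\<Phi> x - \<Phi>' x - \<kappa> * \<eta> * (x ^ (q - 4) / x ^ 3 * G x)
       = (\<Phi>' x - \<kappa> * (1 / x ^ 3 * G x)) * (exp \<delta> - 1) + \<kappa> * (1 / x ^ 3 * G x) * (exp \<delta> - 1 - \<eta> * x ^ (q - 4))"
    proof -
      have "p * e - p - h * t = (p - h) * (e - 1) + h * (e - 1 - t)" for p e h t :: real
        by (simp add: algebra_simps)
      moreover have "\<kappa> * \<eta> * (x ^ (q - 4) / x ^ 3 * G x) = \<kappa> * (1 / x ^ 3 * G x) * (\<eta> * x ^ (q - 4))"
        by simp
      ultimately show ?thesis unfolding \<Phi>\<delta> by presburger
    qed
    also have "\<bar>\<dots>\<bar> \<le> (C' * (1 / x\<^sup>2 * G x)) * ((\<bar>\<eta>\<bar> + c4) * x ^ (q - 4)) + \<kappa> * (1 / x ^ 3 * G x) * (c4 * x ^ (q - 3))"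
    proof (rule order_trans[OF abs_triangle_ineq add_mono])
      show "\<bar>(\<Phi>' x - \<kappa> * (1 / x ^ 3 * G x)) * (exp \<delta> - 1)\<bar> \<le> (C' * (1 / x\<^sup>2 * G x)) * ((\<bar>\<eta>\<bar> + c4) * x ^ (q - 4))"
        unfolding abs_mult using elim E2 C'(1) Gp by (intro mult_mono) auto
      have k0: "0 \<le> \<kappa> * (1 / x ^ 3 * G x)" using \<kappa> x Gp by simp
      show "\<bar>\<kappa> * (1 / x ^ 3 * G x) * (exp \<delta> - 1 - \<eta> * x ^ (q - 4))\<bar> \<le> \<kappa> * (1 / x ^ 3 * G x) * (c4 * x ^ (q - 3))"
        unfolding abs_mult[of "\<kappa> * (1 / x ^ 3 * G x)"] abs_of_nonneg[OF k0] by (rule mult_left_mono[OF E k0])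
    qed
    also have "\<dots> = (C' * (\<bar>\<eta>\<bar> + c4) + \<kappa> * c4) * (x ^ (q - 4) / x\<^sup>2 * G x)"
      unfolding xq(3) using x(1) by (simp add: field_simps power2_eq_square power3_eq_cube)
    finally show ?case .
  qed
  then have ev: "eventually (\<lambda>x. \<bar>exp (- K / (eval_fps v x)\<^sup>2) / eval_fps v x ^ 3 * eval_fps Y x
        - exp (- K / (eval_fps v' x)\<^sup>2) / eval_fps v' x ^ 3 * eval_fps Y' x
        - exp D / fps_nth v 1 ^ 3 * \<eta> * (x ^ (q - 4) / x ^ 3 * exp (- A / x\<^sup>2))\<bar>
      \<le> (C' * (\<bar>\<eta>\<bar> + c4) + \<kappa> * c4) * (x ^ (q - 4) / x\<^sup>2 * exp (- A / x\<^sup>2))) (at_right 0)"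
    unfolding \<Phi>_def \<Phi>'_def \<kappa>_def G_def .
  have "0 \<le> C' * (\<bar>\<eta>\<bar> + c4) + \<kappa> * c4"
    using C'(1) \<kappa> c34 by (intro add_nonneg_nonneg mult_nonneg_nonneg) auto
  from this ev show ?thesis by (rule that)
qed

section \<open>Coefficients as Gaussian integrals\<close>

definition fps_reflect :: "real fps \<Rightarrow> real fps" where
  "fps_reflect f = Abs_fps (\<lambda>n. (- 1) ^ n * fps_nth f n)"

lemma fps_reflect_nth [simp]: "fps_nth (fps_reflect f) n = (- 1) ^ n * fps_nth f n"
  by (simp add: fps_reflect_def)

lemma fps_reflect_mult: "fps_reflect (f * g) = fps_reflect f * fps_reflect g"
proof (rule fps_ext)
  fix n
  have *: "(- 1) ^ n * (fps_nth f i * fps_nth g (n - i)) = ((- 1) ^ i * fps_nth f i) * ((- 1) ^ (n - i) * fps_nth g (n - i))"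
    if "i \<le> n" for i
  proof -
    have "(- 1 :: real) ^ n = (- 1) ^ i * (- 1) ^ (n - i)" using that by (simp flip: power_add)
    then show ?thesis by simp
  qed
  show "fps_nth (fps_reflect (f * g)) n = fps_nth (fps_reflect f * fps_reflect g) n"
    unfolding fps_reflect_nth fps_mult_nth sum_distrib_left
    by (rule sum.cong[OF refl], rule *) simp
qed

lemma fps_reflect_power: "fps_reflect (f ^ n) = fps_reflect f ^ n"
proof (induction n)
  case 0
  show ?case by (rule fps_ext) simp
qed (simp add: fps_reflect_mult)

lemma fps_reflect_compose: "fps_reflect (c oo w) = c oo fps_reflect w"
  by (rule fps_ext) (simp add: fps_compose_nth sum_distrib_left mult.left_commute flip: fps_reflect_power)

lemma fps_l1_reflect:
  assumes "fps_l1 r f M"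
  shows "fps_l1 r (fps_reflect f) M"
  using assms by (simp add: fps_l1_def abs_mult)

lemma fps_l1_uminus:
  assumes "fps_l1 r f M"
  shows "fps_l1 r (- f) M"
  using assms by (simp add: fps_l1_def)

lemma fps_l1_le:
  assumes "fps_l1 r f M" "0 < s" "s \<le> r"
  shows "fps_l1 s f M"
  using fps_l1_shrink[OF assms(1), of 0 s] assms by simp

text \<open>The exponent pi^2/6 and the factor 2 sqrt(2 pi) are found by matching: with them the
  Gaussian moments reproduce exactly the pole term (sqrt 3/3) (6/pi)^(2n+2) of
  \<open>chi_egf_asymp\<close> with its factor (2n+1)!/(2 24^n n!). What is left is that factor
  times a bounded one.\<close>

lemma glaisher_split:
  defines "g \<equiv> Abs_fps (\<lambda>n. sqrt (2 * pi) * 2 * integral {0..} (\<lambda>p. p ^ (2 * n + 2) * exp (- (pi\<^sup>2 / 6) * p\<^sup>2)))"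
  obtains C where "\<forall>n. \<bar>fps_nth (glaisher_fps - g) n\<bar> \<le> C * (fact (2 * n + 1) / (24 ^ n * fact n))"
proof -
  obtain C where C: "\<forall>j. \<bar>(-1) ^ (j + 1) * fps_nth chi_egf (2 * j + 1) - sqrt 3 / 3 * (6 / pi) ^ (2 * j + 2)\<bar> \<le> C"
    using chi_egf_asymp by blast
  define F where "F = (\<lambda>n. fact (2 * n + 1) / (24 ^ n * fact n) :: real)"
  have F0: "0 \<le> F n" for n by (simp add: F_def)
  have gl: "fps_nth glaisher_fps n = F n / 2 * ((-1) ^ (n + 1) * fps_nth chi_egf (2 * n + 1))" for n
  proof -
    have "(- 1 / 24 :: real) ^ n = (-1) ^ n / 24 ^ n" by (simp only: power_divide)
    then show ?thesis by (simp add: glaisher_fps_def F_def mult_ac del: fact_Suc)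
  qed
  have gn: "fps_nth g n = F n / 2 * (sqrt 3 / 3 * (6 / pi) ^ (2 * n + 2))" for n
  proof -
    define f where "f = (fact (2 * n + 1) :: real)"
    define P where "P = pi ^ (2 * n)"
    have P: "0 < P" by (simp add: P_def)
    have K: "0 < pi\<^sup>2 / 6" by simp
    have "integral {0..} (\<lambda>p. p ^ (2 * n + 2) * exp (- (pi\<^sup>2 / 6) * p\<^sup>2))
        = sqrt pi / 4 * (f / (4 ^ n * fact n)) / ((pi\<^sup>2 / 6) ^ (n + 1) * sqrt (pi\<^sup>2 / 6))"
      unfolding f_def by (rule integral_unique[OF has_integral_gauss_moment[OF K]])
    then have "fps_nth g n = sqrt (2 * pi) * 2 * (sqrt pi / 4 * (f / (4 ^ n * fact n)) / ((pi\<^sup>2 / 6) ^ (n + 1) * sqrt (pi\<^sup>2 / 6)))"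
      by (simp add: g_def)
    also have "(pi\<^sup>2 / 6) ^ (n + 1) = P * pi\<^sup>2 / (6 ^ n * 6)"
    proof -
      have "(pi\<^sup>2) ^ n = P" by (simp only: P_def power_mult)
      then show ?thesis by (simp only: power_divide power_add power_one_right times_divide_times_eq)
    qed
    also have "sqrt (pi\<^sup>2 / 6) = pi / sqrt 6" by (simp add: real_sqrt_divide)
    also have "sqrt (2 * pi) = sqrt 2 * sqrt pi" by (rule real_sqrt_mult)
    also have "sqrt 2 * sqrt pi * 2 * (sqrt pi / 4 * (f / (4 ^ n * fact n)) / (P * pi\<^sup>2 / (6 ^ n * 6) * (pi / sqrt 6)))
        = (sqrt 2 * sqrt 6) * (sqrt pi * sqrt pi) / pi * 3 * f * (6 ^ n / 4 ^ n) / (fact n * P * pi\<^sup>2)"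
      using P by (simp add: field_simps)
    also have "sqrt 2 * sqrt 6 = 2 * sqrt 3"
    proof -
      have "sqrt 2 * sqrt 6 = sqrt (4 * 3)" by (simp flip: real_sqrt_mult)
      also have "\<dots> = 2 * sqrt 3" by (subst real_sqrt_mult) simp
      finally show ?thesis .
    qed
    also have "sqrt pi * sqrt pi = pi" by simp
    also have "(6 :: real) ^ n / 4 ^ n = 36 ^ n / 24 ^ n"
      by (simp flip: power_divide)
    finally have 1: "fps_nth g n = 6 * sqrt 3 * f * (36 ^ n / 24 ^ n) / (fact n * P * pi\<^sup>2)"
      by simp
    have "(6 / pi) ^ (2 * n + 2) = ((6 / pi)\<^sup>2) ^ n * (6 / pi)\<^sup>2"
      by (simp only: power_add power_mult)
    also have "\<dots> = 36 ^ n * 36 / (P * pi\<^sup>2)"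
      by (simp add: P_def power_divide power_mult)
    finally have 2: "(6 / pi) ^ (2 * n + 2) = 36 ^ n * 36 / (P * pi\<^sup>2)" .
    show ?thesis unfolding 1 2 F_def f_def[symmetric] by (simp add: ac_simps)
  qed
  have "\<bar>fps_nth (glaisher_fps - g) n\<bar> \<le> C / 2 * F n" for n
  proof -
    have "fps_nth (glaisher_fps - g) n = F n / 2 * ((-1) ^ (n + 1) * fps_nth chi_egf (2 * n + 1) - sqrt 3 / 3 * (6 / pi) ^ (2 * n + 2))"
      by (simp only: fps_sub_nth gl gn right_diff_distrib)
    then have "\<bar>fps_nth (glaisher_fps - g) n\<bar> = F n / 2 * \<bar>(-1) ^ (n + 1) * fps_nth chi_egf (2 * n + 1) - sqrt 3 / 3 * (6 / pi) ^ (2 * n + 2)\<bar>"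
      using F0[of n] by (simp only: abs_mult)
    also have "\<dots> \<le> F n / 2 * C" using C F0[of n] by (intro mult_left_mono) auto
    finally show ?thesis by (simp add: mult.commute)
  qed
  then show ?thesis unfolding F_def by (intro that[of "C / 2"] allI)
qed

lemma sum_even_part:
  fixes b :: "nat \<Rightarrow> real"
  assumes "\<And>k. N < k \<Longrightarrow> b k = 0"
  shows "(\<Sum>k\<le>N. b k) + (\<Sum>k\<le>N. (-1) ^ k * b k) = 2 * (\<Sum>n\<le>N. b (2 * n))"
proof -
  have e: "(\<Sum>k\<le>2 * M + 1. (1 + (-1) ^ k) * b k) = 2 * (\<Sum>n\<le>M. b (2 * n))" for M
    by (induction M) simp_all
  have "(\<Sum>k\<le>N. b k) + (\<Sum>k\<le>N. (-1) ^ k * b k) = (\<Sum>k\<le>N. (1 + (-1) ^ k) * b k)"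
    by (simp add: distrib_right sum.distrib)
  also have "\<dots> = (\<Sum>k\<le>2 * N + 1. (1 + (-1) ^ k) * b k)"
    using assms by (intro sum.mono_neutral_left) auto
  finally show ?thesis by (simp only: e)
qed

text \<open>As w^n = v^(2n), only even powers of v are wanted, and the odd ones cancel between p and
  -p. The kernel at (-p, -z) is that of the root -v(-z), which has the same linear coefficient as v;
  the change of sign of z puts (-1)^N in front.\<close>

lemma moment_series_eq:
  fixes v Y w :: "real fps" and K c :: real
  assumes v: "v ^ 2 = w" "fps_nth v 0 = 0" and K: "0 < K"
  defines "I \<equiv> \<lambda>v Y N. integral {0..} (\<lambda>p. p\<^sup>2 * exp (- K * p\<^sup>2) * fps_nth (Y * inverse (1 - fps_const p * v)) N)"
  defines "g \<equiv> Abs_fps (\<lambda>n. c * 2 * integral {0..} (\<lambda>p. p ^ (2 * n + 2) * exp (- K * p\<^sup>2)))"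
  shows "fps_nth (Y * (g oo w)) N = c * (I v Y N + (-1) ^ N * I (- fps_reflect v) (fps_reflect Y) N)"
proof -
  define m where "m = (\<lambda>k. integral {0..} (\<lambda>p. p ^ (k + 2) * exp (- K * p\<^sup>2)))"
  define a where "a = (\<lambda>k. fps_nth (Y * v ^ k) N)"
  have w0: "fps_nth w 0 = 0" unfolding v(1)[symmetric] using v(2) by (simp add: fps_nth_power_0)
  have I: "I v' Y' N = (\<Sum>k\<le>N. fps_nth (Y' * v' ^ k) N * m k)" if "fps_nth v' 0 = 0" for v' Y'
  proof -
    have "(\<lambda>p. p\<^sup>2 * exp (- K * p\<^sup>2) * fps_nth (Y' * inverse (1 - fps_const p * v')) N)
       = (\<lambda>p. \<Sum>k\<le>N. fps_nth (Y' * v' ^ k) N * (p ^ (k + 2) * exp (- K * p\<^sup>2)))"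
      unfolding kernel_nth[OF that] by (auto simp: sum_distrib_left power_add power2_eq_square mult_ac fun_eq_iff)
    moreover have "(\<lambda>p. p ^ (k + 2) * exp (- K * p\<^sup>2)) integrable_on {0..}" for k
      using absolutely_integrable_power_gauss[OF K, of "k + 2" 0] by (simp add: absolutely_integrable_on_def)
    ultimately show ?thesis
      unfolding I_def m_def by (simp add: integral_sum integrable_on_mult_right)
  qed
  have r: "fps_nth (fps_reflect Y * (- fps_reflect v) ^ k) N = (-1) ^ N * ((-1) ^ k * a k)" for k
  proof -
    have "fps_reflect Y * (- fps_reflect v) ^ k = fps_const ((-1) ^ k) * fps_reflect (Y * v ^ k)"
    proof -
      have "(- fps_reflect v) ^ k = fps_const ((-1) ^ k) * fps_reflect v ^ k"
        by (subst power_minus) (simp flip: fps_const_power fps_const_neg)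
      then show ?thesis by (simp add: fps_reflect_mult fps_reflect_power mult_ac)
    qed
    then show ?thesis by (simp add: a_def)
  qed
  have a0: "a k = 0" if "N < k" for k
  proof -
    have "fps_nth (v ^ k) i = 0" if "i \<le> N" for i
      using startsby_zero_power_prefix[OF v(2), of k] that \<open>N < k\<close> by simp
    then show ?thesis by (simp add: a_def fps_mult_nth)
  qed
  have "I v Y N + (-1) ^ N * I (- fps_reflect v) (fps_reflect Y) N = (\<Sum>k\<le>N. a k * m k) + (\<Sum>k\<le>N. (-1) ^ k * (a k * m k))"
  proof -
    have "I v Y N = (\<Sum>k\<le>N. a k * m k)" by (simp add: I[OF v(2)] a_def)
    moreover have "(-1) ^ N * I (- fps_reflect v) (fps_reflect Y) N = (\<Sum>k\<le>N. (-1) ^ k * (a k * m k))"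
    proof -
      have "fps_nth (- fps_reflect v) 0 = 0" using v(2) by simp
      from I[OF this, of "fps_reflect Y"] show ?thesis
        by (simp only: r) (simp add: sum_distrib_left mult.assoc flip: mult.assoc[of "(-1) ^ N" "(-1) ^ N"] power_add)
    qed
    ultimately show ?thesis by simp
  qed
  also have "\<dots> = 2 * (\<Sum>n\<le>N. a (2 * n) * m (2 * n))"
    by (rule sum_even_part) (simp add: a0)
  finally have S: "I v Y N + (-1) ^ N * I (- fps_reflect v) (fps_reflect Y) N = 2 * (\<Sum>n\<le>N. a (2 * n) * m (2 * n))" .
  have "fps_nth (Y * (g oo w)) N = (\<Sum>n\<le>N. fps_nth g n * fps_nth (Y * w ^ n) N)"
    by (rule fps_compose_mult_nth[OF w0])
  also have "\<dots> = (\<Sum>n\<le>N. c * 2 * (a (2 * n) * m (2 * n)))"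
  proof -
    have "v ^ (2 * n) = w ^ n" for n by (simp only: power_mult v(1))
    then show ?thesis by (simp add: g_def m_def a_def mult_ac)
  qed
  also have "\<dots> = c * (2 * (\<Sum>n\<le>N. a (2 * n) * m (2 * n)))"
    by (simp add: sum_distrib_left mult_ac)
  finally show ?thesis by (simp only: S)
qed

text \<open>Everything follows from L' = w' L. For the last claim the odd index n + 1 splits into i
  + 1 and n - i, one of which is odd; if i < n it is below q and its factor vanishes, so only the
  top term remains.\<close>

lemma log_fps_coeffs:
  fixes w L :: "real fps"
  assumes w: "fps_nth w 0 = 0" "fps_exp 1 oo w = L" and L1: "fps_nth L 1 = 0"
  shows "fps_nth w 1 = 0" "fps_nth w 2 = fps_nth L 2" "fps_nth w 3 = fps_nth L 3"
    "fps_nth w 4 = fps_nth L 4 - (fps_nth L 2)\<^sup>2 / 2"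
    and "(\<And>k. odd k \<Longrightarrow> k < q \<Longrightarrow> fps_nth L k = 0) \<Longrightarrow> odd j \<Longrightarrow> j \<le> q \<Longrightarrow> fps_nth w j = fps_nth L j"
proof -
  have L0: "fps_nth L 0 = 1" using w by (metis fps_compose_nth_0 fps_exp_nth power_0 fact_0 of_nat_1 div_by_1)
  have d: "fps_deriv L = fps_deriv w * L"
    using fps_compose_deriv[OF w(1), of "fps_exp 1"] w(2) by (simp add: mult.commute)
  have rec: "real (n + 1) * fps_nth L (n + 1) = (\<Sum>i\<le>n. real (i + 1) * fps_nth w (i + 1) * fps_nth L (n - i))" for n
    using arg_cong[OF d, of "\<lambda>f. fps_nth f n"]
    by (simp add: fps_mult_nth atMost_atLeast0)
  show w1: "fps_nth w 1 = 0" using rec[of 0] L0 L1 by simp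
  show w2: "fps_nth w 2 = fps_nth L 2" using rec[of 1] L0 L1 w1 by (simp add: numeral_2_eq_2)
  show w3: "fps_nth w 3 = fps_nth L 3"
    using rec[of 2] L0 L1 w1 w2 by (simp add: eval_nat_numeral)
  show "fps_nth w 4 = fps_nth L 4 - (fps_nth L 2)\<^sup>2 / 2"
    using rec[of 3] L0 L1 w1 w2 w3 by (simp add: eval_nat_numeral field_simps power2_eq_square)
  show "fps_nth w j = fps_nth L j" if L: "\<And>k. odd k \<Longrightarrow> k < q \<Longrightarrow> fps_nth L k = 0" and "odd j" "j \<le> q"
    using that(2,3)
  proof (induction j rule: less_induct)
    case (less j)
    then obtain n where j: "j = n + 1" "even n" by (metis oddE even_mult_iff even_numeral)
    have "real (n + 1) * fps_nth L (n + 1) = (\<Sum>i\<in>{n}. real (i + 1) * fps_nth w (i + 1) * fps_nth L (n - i))"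
      unfolding rec
    proof (rule sum.mono_neutral_right)
      show "\<forall>i\<in>{..n} - {n}. real (i + 1) * fps_nth w (i + 1) * fps_nth L (n - i) = 0"
      proof
        fix i assume i: "i \<in> {..n} - {n}"
        show "real (i + 1) * fps_nth w (i + 1) * fps_nth L (n - i) = 0"
        proof (cases "odd (i + 1)")
          case True
          then have "fps_nth w (i + 1) = fps_nth L (i + 1)" using less i j by (intro less.IH) auto
          moreover have "fps_nth L (i + 1) = 0" using True i j less.prems by (intro L) auto
          ultimately show ?thesis by simp
        next
          case False
          then have "odd (n - i)" using i j(2) by auto
          then have "fps_nth L (n - i) = 0" using i j less.prems by (intro L) auto
          then show ?thesis by simp
        qed
      qed
    qed auto
    then show ?case by (simp add: j L0)
  qed
qed

section \<open>Asymptotics of the coefficients\<close>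

lemma eventually_at_right_0_inverse:
  fixes P :: "real \<Rightarrow> bool"
  assumes "eventually P (at_right 0)"
  obtains U0 where "0 < U0" "\<forall>u\<ge>U0. P (1 / u)"
proof -
  have "eventually (\<lambda>u. P (inverse u)) at_top"
    using assms filterlim_inverse_at_right_top by (rule eventually_compose_filterlim)
  then obtain U1 where "\<forall>u\<ge>U1. P (inverse u)" by (auto simp: eventually_at_top_linorder)
  then show ?thesis
    by (intro that[of "max 1 U1"]) (auto simp: inverse_eq_divide)
qed

text \<open>The power (N/(2A))^(t/2) in the scale splits into N^(t/2) and the constant absorbed by
  c. The values t = 2 and t = 5 - 2m produce the two exponents of n in the theorem.\<close>

lemma asymp_finish:
  fixes G :: "nat \<Rightarrow> real"
  assumes A: "0 < A" and g: "g \<noteq> 0"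
    and lim: "(\<lambda>N. G N / laplace_scale A B t (real N) - g) \<in> O(\<lambda>N. real N powr (-1/2))"
    and \<beta>: "\<beta> = B / sqrt (2 * A)" and \<rho>: "\<rho> = 1 / (2 * A * exp 1)" and c: "c = g * (2 * A) powr (- t / 2)"
  defines "\<epsilon> \<equiv> \<lambda>N. G N / (g * laplace_scale A B t (real N)) - 1"
  shows "\<epsilon> \<in> O(\<lambda>N. real N powr (-1/2))"
    "eventually (\<lambda>N. G N = c * exp (\<beta> * sqrt (real N)) * \<rho> powr (real N / 2) * real N powr (real N / 2 + t / 2) * (1 + \<epsilon> N)) sequentially"
proof -
  have "(\<lambda>N. 1 / g * (G N / laplace_scale A B t (real N) - g)) \<in> O(\<lambda>N. real N powr (-1/2))"
    by (rule cmult_bigo[OF lim])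
  moreover have "\<epsilon> = (\<lambda>N. 1 / g * (G N / laplace_scale A B t (real N) - g))"
    using g by (simp add: \<epsilon>_def right_diff_distrib)
  ultimately show "\<epsilon> \<in> O(\<lambda>N. real N powr (-1/2))" by simp
  show "eventually (\<lambda>N. G N = c * exp (\<beta> * sqrt (real N)) * \<rho> powr (real N / 2) * real N powr (real N / 2 + t / 2) * (1 + \<epsilon> N)) sequentially"
    using eventually_gt_at_top[of 0]
  proof eventually_elim
    case (elim N)
    define n where "n = real N"
    have n: "0 < n" using elim by (simp add: n_def)
    have pos: "0 < laplace_scale A B t n" by (rule laplace_scale_pos[OF A n])
    have 1: "B * sqrt (n / (2 * A)) = \<beta> * sqrt n" by (simp add: \<beta> real_sqrt_divide)
    have 2: "(n / (2 * A * exp 1)) powr (n / 2) = \<rho> powr (n / 2) * n powr (n / 2)"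
    proof -
      have "n / (2 * A * exp 1) = \<rho> * n" by (simp add: \<rho>)
      moreover have "(\<rho> * n) powr (n / 2) = \<rho> powr (n / 2) * n powr (n / 2)"
        by (rule powr_mult)
      ultimately show ?thesis by simp
    qed
    have 3: "(n / (2 * A)) powr (t / 2) = n powr (t / 2) * (2 * A) powr (- t / 2)"
    proof -
      have "(2 * A) powr (- t / 2) = inverse ((2 * A) powr (t / 2))"
        by (simp flip: powr_minus)
      then show ?thesis by (simp only: powr_divide divide_inverse[of "n powr (t / 2)"])
    qed
    have "laplace_scale A B t n = exp (\<beta> * sqrt n) * (\<rho> powr (n / 2) * n powr (n / 2)) * (n powr (t / 2) * (2 * A) powr (- t / 2))"
      unfolding laplace_scale_def 1 2 3 ..
    also have "\<dots> = exp (\<beta> * sqrt n) * \<rho> powr (n / 2) * n powr (n / 2 + t / 2) * (2 * A) powr (- t / 2)"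
      by (simp add: powr_add)
    finally have "c * exp (\<beta> * sqrt n) * \<rho> powr (n / 2) * n powr (n / 2 + t / 2) = g * laplace_scale A B t n"
      by (simp add: c)
    moreover have "g * laplace_scale A B t n * (1 + \<epsilon> N) = G N"
      using g pos by (simp add: \<epsilon>_def n_def)
    ultimately show ?case by (simp add: n_def)
  qed
qed

lemma geometric_bound_negligible:
  fixes x :: "nat \<Rightarrow> real"
  assumes A: "0 < A" and D: "0 < D" and x: "\<And>N. \<bar>x N\<bar> \<le> C * D ^ N"
  shows "(\<lambda>N. x N / laplace_scale A B t (real N)) \<in> O(\<lambda>N. real N powr (-1/2))"
proof -
  have "(\<lambda>N. x N / laplace_scale A B t (real N)) \<in> O(\<lambda>N. D ^ N / laplace_scale A B t (real N))"
  proof (rule bigoI[where c = C])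
    show "eventually (\<lambda>N. norm (x N / laplace_scale A B t (real N)) \<le> C * norm (D ^ N / laplace_scale A B t (real N))) sequentially"
      using eventually_gt_at_top[of 0]
    proof eventually_elim
      case (elim N)
      then have "0 < laplace_scale A B t (real N)" by (intro laplace_scale_pos A) simp
      with x[of N] D show ?case by (simp add: abs_divide divide_right_mono)
    qed
  qed
  then show ?thesis by (rule landau_o.big_trans[OF _ power_negligible[OF A D]])
qed

text \<open>P and M come from the half-lines p > 0 and p < 0 with a common lower limit in u. Among
  the coefficients of w that enter, reflection changes only the sign of the cubic one, hence -B with
  the same A and \<kappa>. The error E is claimed for all scales, as it will be measured against
  several.\<close>

lemma fishburn_integral_form:
  fixes L :: "real fps" and m :: nat
  assumes L0: "fps_nth L 0 = 1" and rad: "fps_conv_radius L > 0" and L1: "fps_nth L 1 = 0" and L2: "0 < fps_nth L 2"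
  defines "a \<equiv> fps_nth L 2"
  defines "A \<equiv> pi\<^sup>2 / (6 * a)" and "B \<equiv> pi\<^sup>2 / 6 * fps_nth L 3 / a\<^sup>2"
    and "\<kappa> \<equiv> exp (pi\<^sup>2 / 6 * (fps_nth L 4 / a\<^sup>2 - 1 / 2 - (fps_nth L 3)\<^sup>2 / a ^ 3)) / sqrt a ^ 3"
  obtains P M E :: "nat \<Rightarrow> real"
  where "\<forall>N. fps_nth (fishburn_gf L) N = sqrt (2 * pi) * (P N + (-1) ^ N * M N) + E N"
    and "\<forall>b t. (\<lambda>N. E N / laplace_scale A b t (real N)) \<in> O(\<lambda>N. real N powr (-1/2))"
    and "(\<lambda>N. P N / laplace_scale A B 2 (real N) - \<kappa> * gauss_const A B) \<in> O(\<lambda>N. real N powr (-1/2))"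
    and "(\<lambda>N. M N / laplace_scale A (- B) 2 (real N) - \<kappa> * gauss_const A (- B)) \<in> O(\<lambda>N. real N powr (-1/2))"
    and "2 \<le> m \<longrightarrow> (\<forall>k. odd k \<longrightarrow> k < 2 * m + 1 \<longrightarrow> fps_nth L k = 0) \<longrightarrow>
      (\<lambda>N. (P N - M N) / laplace_scale A 0 (5 - 2 * real m) (real N)
        - \<kappa> * (pi\<^sup>2 / 6 * (2 * fps_nth L (2 * m + 1)) / a\<^sup>2) * gauss_const A 0) \<in> O(\<lambda>N. real N powr (-1/2))"
proof -
  define K where "K = pi\<^sup>2 / 6"
  have K: "0 < K" by (simp add: K_def)
  have a: "0 < a" using L2 by (simp add: a_def)
  have A: "0 < A" using a by (simp add: A_def)
  define w where "w = fps_ln 1 oo (L - 1)"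
  define Y where "Y = fps_exp (1 / 24) oo w"
  have w0: "fps_nth w 0 = 0" by (simp add: w_def)
  have wL: "fps_exp 1 oo w = L" unfolding w_def by (rule fps_exp_compose_ln[OF L0])
  note wc = log_fps_coeffs(1-4)[OF w0 wL L1] and wodd = log_fps_coeffs(5)[OF w0 wL L1]
  obtain r0 M0 where r0: "0 < r0" "fps_l1 r0 L M0" by (rule fps_l1_exists[OF rad])
  have "fps_l1 r0 (L + fps_const (- 1)) (M0 + \<bar>- 1\<bar>)"
    using r0 by (intro fps_l1_add fps_l1_const) auto
  moreover have "L + fps_const (- 1) = L - 1" by (simp flip: fps_const_neg)
  ultimately have Ll: "fps_l1 r0 (L - 1) (M0 + 1)" by simp
  have lnc: "\<bar>fps_nth (fps_ln (1 :: real)) k\<bar> \<le> 1" for k by (simp add: fps_ln_nth abs_mult)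
  have "fps_nth (L - 1) 0 = 0" using L0 by simp
  then obtain s1 where s1: "0 < s1" "s1 \<le> r0" "fps_l1 s1 w 2"
    unfolding w_def by (rule fps_l1_compose_exists[OF lnc _ r0(1) Ll]) blast
  have expc: "\<bar>fps_nth (fps_exp (1 / 24 :: real)) k\<bar> \<le> 1" for k
  proof -
    have "(1 / 24 :: real) ^ k \<le> 1" by (intro power_le_one) auto
    moreover have "(1 :: real) \<le> fact k" by (rule fact_ge_1)
    ultimately have "(1 / 24 :: real) ^ k \<le> fact k" by linarith
    then show ?thesis by (simp add: divide_le_eq)
  qed
  obtain s2 where s2: "0 < s2" "s2 \<le> s1" "fps_l1 s2 Y 2"
    unfolding Y_def by (rule fps_l1_compose_exists[OF expc w0 s1(1) s1(3)]) blast
  have w2: "0 < fps_nth w 2" using wc a by (simp add: a_def)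
  obtain v s3 Mv where v: "v ^ 2 = w" "fps_nth v 0 = 0" "fps_nth v 1 = sqrt (fps_nth w 2)" and s3: "0 < s3" "fps_l1 s3 v Mv"
    by (rule fps_sqrt_exists[OF w0 wc(1) w2 s1(1) s1(3)]) blast
  have v1: "fps_nth v 1 = sqrt a" using v(3) wc(2) by (simp add: a_def)
  have v1p: "0 < fps_nth v 1" using v1 a by simp
  define R where "R = min s2 s3"
  have R: "0 < R" "R \<le> s1" "R \<le> s2" "R \<le> s3" using s2 s3 by (auto simp: R_def)
  have l1: "fps_l1 R w 2" "fps_l1 R Y 2" "fps_l1 R v Mv"
    by (rule fps_l1_le[OF s1(3) R(1,2)], rule fps_l1_le[OF s2(3) R(1,3)], rule fps_l1_le[OF s3(2) R(1,4)])
  define w' where "w' = fps_reflect w"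
  define Y' where "Y' = fps_reflect Y"
  define v' where "v' = - fps_reflect v"
  have l1': "fps_l1 R w' 2" "fps_l1 R Y' 2" "fps_l1 R v' Mv"
    unfolding w'_def Y'_def v'_def by (intro fps_l1_uminus fps_l1_reflect l1)+
  have Y'_eq: "Y' = fps_exp (1 / 24) oo w'" by (simp add: Y'_def Y_def w'_def fps_reflect_compose)
  have v': "v' ^ 2 = w'" "fps_nth v' 0 = 0" "fps_nth v' 1 = sqrt a"
    using v v1 by (simp_all add: v'_def w'_def fps_reflect_power[symmetric])
  have v'1p: "0 < fps_nth v' 1" using v'(3) a by simp
  note rd = fps_l1_conv_radius[OF l1(1) R(1)] fps_l1_conv_radius[OF l1(2) R(1)] fps_l1_conv_radius[OF l1(3) R(1)]
  note rd' = fps_l1_conv_radius[OF l1'(1) R(1)] fps_l1_conv_radius[OF l1'(2) R(1)] fps_l1_conv_radius[OF l1'(3) R(1)]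
  define D where "D = K * (fps_nth w 4 / a\<^sup>2 - (fps_nth w 3)\<^sup>2 / a ^ 3)"
  have \<kappa>: "\<kappa> = exp D / sqrt a ^ 3"
  proof -
    \<comment> \<open>The term - L_2^2/2 in w_4 is the origin of the summand -1/2 in the exponents
      of the constants.\<close>
    have "fps_nth w 4 / a\<^sup>2 = fps_nth L 4 / a\<^sup>2 - 1 / 2"
      using a by (simp add: wc a_def[symmetric] diff_divide_distrib)
    then show ?thesis by (simp add: \<kappa>_def D_def K_def wc)
  qed
  have Aeq: "A = K / a" by (simp add: A_def K_def)
  have Beq: "B = K * fps_nth w 3 / a\<^sup>2" by (simp add: B_def K_def wc)
  define \<Phi> where "\<Phi> = (\<lambda>v Y u. exp (- K / (eval_fps v (1 / u))\<^sup>2) / eval_fps v (1 / u) ^ 3 * eval_fps Y (1 / u))"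
  define f where "f = (\<lambda>v Y N p. p\<^sup>2 * exp (- K * p\<^sup>2) * fps_nth (Y * inverse (1 - fps_const p * v)) N)"
  obtain U1 where U1: "0 < U1" "\<And>U. U1 \<le> U \<Longrightarrow> (\<forall>u\<ge>U. 0 < eval_fps v (1 / u)) \<and>
     (\<exists>C D. 0 \<le> C \<and> 0 < D \<and> (\<forall>N. f v Y N absolutely_integrable_on {0..} \<and> (\<lambda>u. \<Phi> v Y u * u ^ (N + 1) / u\<^sup>2) absolutely_integrable_on {U..} \<and>
        \<bar>integral {0..} (f v Y N) - integral {U..} (\<lambda>u. \<Phi> v Y u * u ^ (N + 1) / u\<^sup>2)\<bar> \<le> C * D ^ N))"
    using half_integral[OF v(2) v1p R(1) l1(3,2) K] unfolding f_def \<Phi>_def by (smt (verit))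
  obtain U2 where U2: "0 < U2" "\<And>U. U2 \<le> U \<Longrightarrow> (\<forall>u\<ge>U. 0 < eval_fps v' (1 / u)) \<and>
     (\<exists>C D. 0 \<le> C \<and> 0 < D \<and> (\<forall>N. f v' Y' N absolutely_integrable_on {0..} \<and> (\<lambda>u. \<Phi> v' Y' u * u ^ (N + 1) / u\<^sup>2) absolutely_integrable_on {U..} \<and>
        \<bar>integral {0..} (f v' Y' N) - integral {U..} (\<lambda>u. \<Phi> v' Y' u * u ^ (N + 1) / u\<^sup>2)\<bar> \<le> C * D ^ N))"
    using half_integral[OF v'(2) v'1p R(1) l1'(3,2) K] unfolding f_def \<Phi>_def by (smt (verit))
  have Y0: "fps_nth Y 0 = 1" "fps_nth Y' 0 = 1" by (simp_all add: Y_def Y'_def)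
  have conv: "1 / (1 / u) ^ 3 * exp (- A / (1 / u)\<^sup>2 + b / (1 / u)) = u powr 3 * exp (- A * u\<^sup>2 + b * u)"
    "1 / (1 / u)\<^sup>2 * exp (- A / (1 / u)\<^sup>2 + b / (1 / u)) = u powr (3 - 1) * exp (- A * u\<^sup>2 + b * u)" if "0 < u" for u b
    using that powr_realpow[OF that, of 3] powr_realpow[OF that, of 2] by (simp_all add: power_divide)
  have w'c: "fps_nth w' 2 = fps_nth w 2" "fps_nth w' 3 = - fps_nth w 3" "fps_nth w' 4 = fps_nth w 4" by (simp_all add: w'_def)
  have wa: "fps_nth w 2 = a" by (simp add: wc a_def)
  obtain C3 where C3: "0 \<le> C3" and ev3: "eventually (\<lambda>x. \<bar>exp (- K / (eval_fps v x)\<^sup>2) / eval_fps v x ^ 3 * eval_fps Y x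
        - exp (K * (fps_nth w 4 / (fps_nth w 2)\<^sup>2 - (fps_nth w 3)\<^sup>2 / fps_nth w 2 ^ 3)) / fps_nth v 1 ^ 3
          * (1 / x ^ 3 * exp (- (K / fps_nth w 2) / x\<^sup>2 + (K * fps_nth w 3 / (fps_nth w 2)\<^sup>2) / x))\<bar>
      \<le> C3 * (1 / x\<^sup>2 * exp (- (K / fps_nth w 2) / x\<^sup>2 + (K * fps_nth w 3 / (fps_nth w 2)\<^sup>2) / x))) (at_right 0)"
    by (rule theta_asymp[OF R(1) rd(3,1,2) v(1,2) v1p Y0(1), of K])
  have e3: "exp (K * (fps_nth w 4 / (fps_nth w 2)\<^sup>2 - (fps_nth w 3)\<^sup>2 / fps_nth w 2 ^ 3)) / fps_nth v 1 ^ 3 = \<kappa>"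
    "K / fps_nth w 2 = A" "K * fps_nth w 3 / (fps_nth w 2)\<^sup>2 = B"
    by (simp_all only: wa \<kappa> D_def v1 Aeq Beq)
  obtain C4 where C4: "0 \<le> C4" and ev4: "eventually (\<lambda>x. \<bar>exp (- K / (eval_fps v' x)\<^sup>2) / eval_fps v' x ^ 3 * eval_fps Y' x
        - exp (K * (fps_nth w' 4 / (fps_nth w' 2)\<^sup>2 - (fps_nth w' 3)\<^sup>2 / fps_nth w' 2 ^ 3)) / fps_nth v' 1 ^ 3
          * (1 / x ^ 3 * exp (- (K / fps_nth w' 2) / x\<^sup>2 + (K * fps_nth w' 3 / (fps_nth w' 2)\<^sup>2) / x))\<bar>
      \<le> C4 * (1 / x\<^sup>2 * exp (- (K / fps_nth w' 2) / x\<^sup>2 + (K * fps_nth w' 3 / (fps_nth w' 2)\<^sup>2) / x))) (at_right 0)"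
    by (rule theta_asymp[OF R(1) rd'(3,1,2) v'(1,2) v'1p Y0(2), of K])
  have e4: "exp (K * (fps_nth w' 4 / (fps_nth w' 2)\<^sup>2 - (fps_nth w' 3)\<^sup>2 / fps_nth w' 2 ^ 3)) / fps_nth v' 1 ^ 3 = \<kappa>"
    "K / fps_nth w' 2 = A" "K * fps_nth w' 3 / (fps_nth w' 2)\<^sup>2 = - B"
    by (simp_all only: wa w'c power2_minus \<kappa> D_def v'(3) Aeq Beq mult_minus_right minus_divide_left)
  obtain U3 where U3: "0 < U3" "\<forall>u\<ge>U3. \<bar>\<Phi> v Y u - \<kappa> * (1 / (1 / u) ^ 3 * exp (- A / (1 / u)\<^sup>2 + B / (1 / u)))\<bar>
      \<le> C3 * (1 / (1 / u)\<^sup>2 * exp (- A / (1 / u)\<^sup>2 + B / (1 / u)))"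
    using eventually_at_right_0_inverse[OF ev3[unfolded e3]] unfolding \<Phi>_def by blast
  obtain U4 where U4: "0 < U4" "\<forall>u\<ge>U4. \<bar>\<Phi> v' Y' u - \<kappa> * (1 / (1 / u) ^ 3 * exp (- A / (1 / u)\<^sup>2 + (- B) / (1 / u)))\<bar>
      \<le> C4 * (1 / (1 / u)\<^sup>2 * exp (- A / (1 / u)\<^sup>2 + (- B) / (1 / u)))"
    using eventually_at_right_0_inverse[OF ev4[unfolded e4]] unfolding \<Phi>_def by blast
  define q where "q = 2 * m + 1"
  define \<eta> where "\<eta> = K * (2 * fps_nth L q) / a\<^sup>2"
  define cond where "cond \<longleftrightarrow> 2 \<le> m \<and> (\<forall>k. odd k \<longrightarrow> k < q \<longrightarrow> fps_nth L k = 0)"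
  \<comment> \<open>The condition is kept inside, so that U5 exists in either case and may enter the
    common lower limit; when the condition fails, any positive values do.\<close>
  have "\<exists>U5 C5. 0 < U5 \<and> 0 \<le> C5 \<and> (cond \<longrightarrow> (\<forall>u\<ge>U5. \<bar>(\<Phi> v Y u - \<Phi> v' Y' u) - \<kappa> * \<eta> * ((1 / u) ^ (q - 4) / (1 / u) ^ 3 * exp (- A / (1 / u)\<^sup>2))\<bar>
      \<le> C5 * ((1 / u) ^ (q - 4) / (1 / u)\<^sup>2 * exp (- A / (1 / u)\<^sup>2))))"
  proof (cases cond)
    case True
    then have m: "2 \<le> m" and Lodd: "\<And>k. odd k \<Longrightarrow> k < q \<Longrightarrow> fps_nth L k = 0" by (auto simp: cond_def)
    have q5: "5 \<le> q" "odd q" using m by (auto simp: q_def)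
    have wodd0: "fps_nth w i = 0" if "odd i" "i < q" for i
      using wodd[OF Lodd, of i] Lodd[OF that] that by simp
    have ww': "fps_nth w i = fps_nth w' i" if "i < q" for i
      using wodd0[of i] that by (cases "even i") (auto simp: w'_def)
    have w3: "fps_nth w 3 = 0" using q5 by (intro wodd0) auto
    have wq: "fps_nth w q - fps_nth w' q = 2 * fps_nth L q"
      using wodd[OF Lodd, of q] q5 by (simp add: w'_def)
    obtain C5 where C5: "0 \<le> C5" and ev5: "eventually (\<lambda>x. \<bar>exp (- K / (eval_fps v x)\<^sup>2) / eval_fps v x ^ 3 * eval_fps (fps_exp (1 / 24) oo w) x
        - exp (- K / (eval_fps v' x)\<^sup>2) / eval_fps v' x ^ 3 * eval_fps (fps_exp (1 / 24) oo w') x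
        - exp (K * fps_nth w 4 / (fps_nth w 2)\<^sup>2) / fps_nth v 1 ^ 3 * (K * (fps_nth w q - fps_nth w' q) / (fps_nth w 2)\<^sup>2)
          * (x ^ (q - 4) / x ^ 3 * exp (- (K / fps_nth w 2) / x\<^sup>2))\<bar>
      \<le> C5 * (x ^ (q - 4) / x\<^sup>2 * exp (- (K / fps_nth w 2) / x\<^sup>2))) (at_right 0)"
      by (rule theta_diff_asymp[OF R(1) rd(3,1) rd(2)[unfolded Y_def] rd'(3,1) rd'(2)[unfolded Y'_eq] v(1,2) v1p v'(1,2) v'1p q5(1) ww' w3, of K])
    have e5: "exp (K * fps_nth w 4 / (fps_nth w 2)\<^sup>2) / fps_nth v 1 ^ 3 = \<kappa>" "K / fps_nth w 2 = A"
      "K * (fps_nth w q - fps_nth w' q) / (fps_nth w 2)\<^sup>2 = \<eta>"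
      by (simp_all add: wa \<kappa> D_def v1[unfolded One_nat_def] Aeq w3 wq \<eta>_def)
    obtain U5 where "0 < U5" "\<forall>u\<ge>U5. \<bar>\<Phi> v Y u - \<Phi> v' Y' u - \<kappa> * \<eta> * ((1 / u) ^ (q - 4) / (1 / u) ^ 3 * exp (- A / (1 / u)\<^sup>2))\<bar>
      \<le> C5 * ((1 / u) ^ (q - 4) / (1 / u)\<^sup>2 * exp (- A / (1 / u)\<^sup>2))"
      using eventually_at_right_0_inverse[OF ev5[unfolded e5, folded Y_def Y'_eq]] unfolding \<Phi>_def by blast
    with C5 show ?thesis by blast
  qed (auto intro: exI[of _ 1])
  then obtain U5 C5 where U5: "0 < U5" "0 \<le> C5" "cond \<Longrightarrow> \<forall>u\<ge>U5. \<bar>(\<Phi> v Y u - \<Phi> v' Y' u) - \<kappa> * \<eta> * ((1 / u) ^ (q - 4) / (1 / u) ^ 3 * exp (- A / (1 / u)\<^sup>2))\<bar>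
      \<le> C5 * ((1 / u) ^ (q - 4) / (1 / u)\<^sup>2 * exp (- A / (1 / u)\<^sup>2))" by blast
  \<comment> \<open>One lower limit for both half-lines, so that P - M is the integral of the
    difference of the integrands.\<close>
  define U where "U = Max {U1, U2, U3, U4, U5}"
  have Ule: "U1 \<le> U" "U2 \<le> U" "U3 \<le> U" "U4 \<le> U" "U5 \<le> U" by (simp_all add: U_def)
  have U: "0 < U" using Ule(1) U1(1) by linarith
  define P where "P = (\<lambda>N. integral {U..} (\<lambda>u. \<Phi> v Y u * u ^ (N + 1) / u\<^sup>2))"
  define M where "M = (\<lambda>N. integral {U..} (\<lambda>u. \<Phi> v' Y' u * u ^ (N + 1) / u\<^sup>2))"
  obtain Ca Da where ab: "0 < Da" "\<forall>N. (\<lambda>u. \<Phi> v Y u * u ^ (N + 1) / u\<^sup>2) absolutely_integrable_on {U..} \<and> \<bar>integral {0..} (f v Y N) - P N\<bar> \<le> Ca * Da ^ N"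
    using U1(2)[OF Ule(1)] unfolding P_def by blast
  obtain Cb Db where bb: "0 < Db" "\<forall>N. (\<lambda>u. \<Phi> v' Y' u * u ^ (N + 1) / u\<^sup>2) absolutely_integrable_on {U..} \<and> \<bar>integral {0..} (f v' Y' N) - M N\<bar> \<le> Cb * Db ^ N"
    using U2(2)[OF Ule(2)] unfolding M_def by blast
  have intP: "(\<lambda>u. \<Phi> v Y u * u ^ (N + 1) / u\<^sup>2) integrable_on {U..}" for N
    using ab(2) by (auto simp: absolutely_integrable_on_def)
  have intM: "(\<lambda>u. \<Phi> v' Y' u * u ^ (N + 1) / u\<^sup>2) integrable_on {U..}" for N
    using bb(2) by (auto simp: absolutely_integrable_on_def)
  define g where "g = Abs_fps (\<lambda>n. sqrt (2 * pi) * 2 * integral {0..} (\<lambda>p. p ^ (2 * n + 2) * exp (- K * p\<^sup>2)))"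
  define e where "e = glaisher_fps - g"
  obtain Cg where Cg: "\<forall>n. \<bar>fps_nth e n\<bar> \<le> Cg * (fact (2 * n + 1) / (24 ^ n * fact n))"
    unfolding e_def g_def K_def by (rule glaisher_split)
  \<comment> \<open>Two geometric errors from replacing the p-integrals, and the contribution of the
    remaining poles.\<close>
  define E where "E = (\<lambda>N. sqrt (2 * pi) * (integral {0..} (f v Y N) - P N) + sqrt (2 * pi) * ((-1) ^ N * (integral {0..} (f v' Y' N) - M N)) + fps_nth (Y * (e oo w)) N)"
  have F: "fps_nth (fishburn_gf L) N = sqrt (2 * pi) * (P N + (-1) ^ N * M N) + E N" for N
  proof -
    have "fishburn_gf L = Y * (glaisher_fps oo w)"
      using fishburn_gf_exp[OF w0] unfolding wL Y_def .
    also have "\<dots> = Y * (g oo w) + Y * (e oo w)"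
      by (simp add: e_def fps_compose_sub_distrib right_diff_distrib)
    finally have "fps_nth (fishburn_gf L) N = fps_nth (Y * (g oo w)) N + fps_nth (Y * (e oo w)) N" by simp
    also have "fps_nth (Y * (g oo w)) N = sqrt (2 * pi) * (integral {0..} (f v Y N) + (-1) ^ N * integral {0..} (f v' Y' N))"
      unfolding g_def f_def v'_def Y'_def by (rule moment_series_eq[OF v(1,2) K])
    finally show ?thesis by (simp add: E_def algebra_simps)
  qed
  have E: "(\<lambda>N. E N / laplace_scale A b t (real N)) \<in> O(\<lambda>N. real N powr (-1/2))" for b t
  proof -
    have 1: "(\<lambda>N. (integral {0..} (f v Y N) - P N) / laplace_scale A b t (real N)) \<in> O(\<lambda>N. real N powr (-1/2))"
      by (rule geometric_bound_negligible[OF A ab(1)]) (use ab(2) in blast)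
    have 2: "(\<lambda>N. ((-1) ^ N * (integral {0..} (f v' Y' N) - M N)) / laplace_scale A b t (real N)) \<in> O(\<lambda>N. real N powr (-1/2))"
    proof (rule geometric_bound_negligible[OF A bb(1), where C = Cb])
      show "\<bar>(-1) ^ N * (integral {0..} (f v' Y' N) - M N)\<bar> \<le> Cb * Db ^ N" for N
        using bb(2) by (simp add: abs_mult)
    qed
    have 3: "(\<lambda>N. fps_nth (Y * (e oo w)) N / laplace_scale A b t (real N)) \<in> O(\<lambda>N. real N powr (-1/2))"
      unfolding A_def by (rule error_negligible[OF w0 wc(1) wa a R(1) l1(1,2)]) (use Cg in blast)
    have "(\<lambda>N. sqrt (2 * pi) * ((integral {0..} (f v Y N) - P N) / laplace_scale A b t (real N))
      + sqrt (2 * pi) * (((-1) ^ N * (integral {0..} (f v' Y' N) - M N)) / laplace_scale A b t (real N))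
      + fps_nth (Y * (e oo w)) N / laplace_scale A b t (real N)) \<in> O(\<lambda>N. real N powr (-1/2))"
      by (intro sum_in_bigo(1) cmult_bigo 1 2 3)
    then show ?thesis by (simp add: E_def add_divide_distrib)
  qed
  have limP: "(\<lambda>N. P N / laplace_scale A B (3 - 1) (real N) - \<kappa> * gauss_const A B) \<in> O(\<lambda>N. real N powr (-1/2))"
    unfolding P_def
  proof (rule laplace_tail[OF A U C3 _ intP])
    fix u assume u: "U \<le> u"
    then have u0: "0 < u" "U3 \<le> u" using U Ule by linarith+
    show "\<bar>\<Phi> v Y u - \<kappa> * (u powr 3 * exp (- A * u\<^sup>2 + B * u))\<bar> \<le> C3 * (u powr (3 - 1) * exp (- A * u\<^sup>2 + B * u))"
      using U3(2)[rule_format, OF u0(2)] unfolding conv[OF u0(1)] .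
  qed
  have limM: "(\<lambda>N. M N / laplace_scale A (- B) (3 - 1) (real N) - \<kappa> * gauss_const A (- B)) \<in> O(\<lambda>N. real N powr (-1/2))"
    unfolding M_def
  proof (rule laplace_tail[OF A U C4 _ intM])
    fix u assume u: "U \<le> u"
    then have u0: "0 < u" "U4 \<le> u" using U Ule by linarith+
    show "\<bar>\<Phi> v' Y' u - \<kappa> * (u powr 3 * exp (- A * u\<^sup>2 + (- B) * u))\<bar> \<le> C4 * (u powr (3 - 1) * exp (- A * u\<^sup>2 + (- B) * u))"
      using U4(2)[rule_format, OF u0(2)] unfolding conv[OF u0(1)] .
  qed
  have limD: "(\<lambda>N. (P N - M N) / laplace_scale A 0 (5 - 2 * real m) (real N) - \<kappa> * \<eta> * gauss_const A 0) \<in> O(\<lambda>N. real N powr (-1/2))" if cond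
  proof -
    have q5: "5 \<le> q" using that by (auto simp: cond_def q_def)
    have "P N - M N = integral {U..} (\<lambda>u. (\<Phi> v Y u - \<Phi> v' Y' u) * u ^ (N + 1) / u\<^sup>2)" for N
    proof -
      have "P N - M N = integral {U..} (\<lambda>u. \<Phi> v Y u * u ^ (N + 1) / u\<^sup>2 - \<Phi> v' Y' u * u ^ (N + 1) / u\<^sup>2)"
        unfolding P_def M_def by (rule integral_diff[symmetric, OF intP intM])
      then show ?thesis by (simp only: left_diff_distrib diff_divide_distrib)
    qed
    \<comment> \<open>For x = 1/u the power x^(q-4)/x^3 is u^(7-q), so s = 7 - q in
      \<open>laplace_tail\<close>, and the scale has t = 6 - q = 5 - 2m.\<close>
    moreover have "(\<lambda>N. integral {U..} (\<lambda>u. (\<Phi> v Y u - \<Phi> v' Y' u) * u ^ (N + 1) / u\<^sup>2) / laplace_scale A 0 ((7 - real q) - 1) (real N)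
        - \<kappa> * \<eta> * gauss_const A 0) \<in> O(\<lambda>N. real N powr (-1/2))"
    proof (rule laplace_tail[OF A U U5(2)])
      fix u assume u: "U \<le> u"
      then have u0: "0 < u" "U5 \<le> u" using U Ule by linarith+
      have p: "(1 / u) ^ (q - 4) = u powr (4 - real q)"
      proof -
        have "u powr (4 - real q) = 1 / u powr (real (q - 4))"
          using q5 by (simp add: of_nat_diff powr_minus_divide[symmetric])
        also have "\<dots> = (1 / u) ^ (q - 4)" using u0(1) by (simp only: powr_realpow power_divide power_one)
        finally show ?thesis by simp
      qed
      have "u powr (7 - real q) = u powr (4 - real q) * u ^ 3"
        using powr_add[of u "4 - real q" 3] powr_realpow[OF u0(1), of 3] by simp
      then have c1: "(1 / u) ^ (q - 4) / (1 / u) ^ 3 * exp (- A / (1 / u)\<^sup>2) = u powr (7 - real q) * exp (- A * u\<^sup>2 + 0 * u)"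
        unfolding p by (simp add: power_divide)
      have "u powr (7 - real q - 1) = u powr (4 - real q) * u ^ 2"
        using powr_add[of u "4 - real q" 2] powr_realpow[OF u0(1), of 2] by simp
      then have c2: "(1 / u) ^ (q - 4) / (1 / u)\<^sup>2 * exp (- A / (1 / u)\<^sup>2) = u powr (7 - real q - 1) * exp (- A * u\<^sup>2 + 0 * u)"
        unfolding p by (simp add: power_divide)
      show "\<bar>(\<Phi> v Y u - \<Phi> v' Y' u) - \<kappa> * \<eta> * (u powr (7 - real q) * exp (- A * u\<^sup>2 + 0 * u))\<bar>
          \<le> C5 * (u powr (7 - real q - 1) * exp (- A * u\<^sup>2 + 0 * u))"
        using U5(3)[OF that, rule_format, OF u0(2)] unfolding c1 c2 .
    next
      fix N
      have "(\<lambda>u. \<Phi> v Y u * u ^ (N + 1) / u\<^sup>2 - \<Phi> v' Y' u * u ^ (N + 1) / u\<^sup>2) integrable_on {U..}"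
        by (rule integrable_diff[OF intP intM])
      then show "(\<lambda>u. (\<Phi> v Y u - \<Phi> v' Y' u) * u ^ (N + 1) / u\<^sup>2) integrable_on {U..}"
        by (simp only: left_diff_distrib diff_divide_distrib)
    qed
    moreover have "(7 - real q) - 1 = 5 - 2 * real m" by (simp add: q_def)
    ultimately show ?thesis by (simp only:)
  qed
  show ?thesis
  proof (rule that[of P M E])
    show "\<forall>N. fps_nth (fishburn_gf L) N = sqrt (2 * pi) * (P N + (-1) ^ N * M N) + E N" using F by blast
    show "\<forall>b t. (\<lambda>N. E N / laplace_scale A b t (real N)) \<in> O(\<lambda>N. real N powr (-1/2))" using E by blast
    show "(\<lambda>N. P N / laplace_scale A B 2 (real N) - \<kappa> * gauss_const A B) \<in> O(\<lambda>N. real N powr (-1/2))" using limP by simp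
    show "(\<lambda>N. M N / laplace_scale A (- B) 2 (real N) - \<kappa> * gauss_const A (- B)) \<in> O(\<lambda>N. real N powr (-1/2))" using limM by simp
    show "2 \<le> m \<longrightarrow> (\<forall>k. odd k \<longrightarrow> k < 2 * m + 1 \<longrightarrow> fps_nth L k = 0) \<longrightarrow>
      (\<lambda>N. (P N - M N) / laplace_scale A 0 (5 - 2 * real m) (real N)
        - \<kappa> * (pi\<^sup>2 / 6 * (2 * fps_nth L (2 * m + 1)) / a\<^sup>2) * gauss_const A 0) \<in> O(\<lambda>N. real N powr (-1/2))"
    proof (intro impI)
      assume "2 \<le> m" "\<forall>k. odd k \<longrightarrow> k < 2 * m + 1 \<longrightarrow> fps_nth L k = 0"
      then have cond by (simp only: cond_def q_def)
      from limD[OF this] show "(\<lambda>N. (P N - M N) / laplace_scale A 0 (5 - 2 * real m) (real N)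
        - \<kappa> * (pi\<^sup>2 / 6 * (2 * fps_nth L (2 * m + 1)) / a\<^sup>2) * gauss_const A 0) \<in> O(\<lambda>N. real N powr (-1/2))"
        unfolding \<eta>_def K_def q_def .
    qed
  qed
qed

section \<open>Evaluation of the constants and the parity cases\<close>

lemma gauss_prefactor:
  assumes a: "0 < a" and A: "A = pi\<^sup>2 / (6 * a)"
  shows "sqrt (2 * pi) * (E / sqrt a ^ 3) * gauss_const A B = sqrt 6 / a * E * exp (B\<^sup>2 / (8 * A))"
proof -
  have "pi / (2 * A) = 3 * a / pi" using a by (simp add: A power2_eq_square)
  then have "sqrt (2 * pi) * sqrt (pi / (2 * A)) = sqrt (6 * a)"
    by (simp flip: real_sqrt_mult)
  moreover have "sqrt a ^ 3 = a * sqrt a" using a by (simp add: power3_eq_cube)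
  moreover have "sqrt (6 * a) = sqrt 6 * sqrt a" by (rule real_sqrt_mult)
  moreover have "0 < sqrt a" using a by simp
  ultimately show ?thesis
    unfolding gauss_const_def by (simp add: field_simps)
qed

text \<open>The scales for -B and B differ by the factor exp(- 2 B sqrt(N/(2A))), smaller than any
  power of N; this disposes of the reflected half-line when B > 0.\<close>

lemma laplace_scale_uminus_bigo:
  assumes A: "0 < A" and B: "0 < B"
    and M: "(\<lambda>N. M N / laplace_scale A (- B) t (real N) - g) \<in> O(\<lambda>N. real N powr (-1/2))"
  shows "(\<lambda>N. M N / laplace_scale A B t (real N)) \<in> O(\<lambda>N. real N powr (-1/2))"
proof -
  define b where "b = 2 * B / sqrt (2 * A)"
  have b: "0 < b" using A B by (simp add: b_def)
  have r: "(\<lambda>N::nat. exp (- b * sqrt (real N))) \<in> O(\<lambda>N. real N powr (-1/2))"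
    using b by real_asymp
  have "(\<lambda>N. (M N / laplace_scale A (- B) t (real N) - g) + g) \<in> O(\<lambda>_. 1)"
    by (intro sum_in_bigo(1) landau_o.big_trans[OF M powr_minus_half_bigo_1]) simp
  then have "(\<lambda>N. M N / laplace_scale A (- B) t (real N) * exp (- b * sqrt (real N))) \<in> O(\<lambda>N. 1 * real N powr (-1/2))"
    by (intro landau_o.big_mult r) simp
  moreover have "laplace_scale A (- B) t (real N) = laplace_scale A B t (real N) * exp (- b * sqrt (real N))" for N
  proof -
    have 1: "- B * sqrt (real N / (2 * A)) = B * sqrt (real N / (2 * A)) + (- b * sqrt (real N))"
      by (simp add: b_def real_sqrt_divide)
    show ?thesis unfolding laplace_scale_def 1 exp_add by (simp only: mult_ac)
  qed
  ultimately show ?thesis by simp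
qed

theorem theorem8p10:
  fixes l :: "nat \<Rightarrow> nat" and m :: nat
    and \<beta> \<rho> c c' c\<^sub>m :: real
  assumes "l 0 = 1"
    and "fps_conv_radius (multiset_gf l) > 0"
    and "m \<ge> 1"
    and "\<And>k. 1 \<le> k \<Longrightarrow> k \<le> m \<Longrightarrow> l (2 * k - 1) = 0"
    and "l 2 > 0"
    and "l (2 * m + 1) > 0"
    and "\<beta> = real (l 3) * pi / (2 * sqrt 3 * real (l 2) powr (3/2))"
    and "\<rho> = 3 * real (l 2) / (exp 1 * pi ^ 2)"
    and "c = 3 * sqrt 6 / pi ^ 2 *
           exp (pi ^ 2 / 6 * (real (l 4) / real (l 2) ^ 2 - 1/2
                              - 7 * real (l 3) ^ 2 / (8 * real (l 2) ^ 3)))"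
    and "c' = 6 * sqrt 6 / pi ^ 2 *
           exp (pi ^ 2 / 6 * (real (l 4) / real (l 2) ^ 2 - 1/2))"
    and "c\<^sub>m = sqrt 2 * pi powi (2 * int m - 3) / 3 powi (int m - 2) *
           (real (l (2 * m + 1)) / real (l 2) powr (real m + 1/2)) *
           exp (pi ^ 2 / 6 * (real (l 4) / real (l 2) ^ 2 - 1/2))"
  shows
    "(m = 1 \<longrightarrow>
       (\<exists>\<epsilon> :: nat \<Rightarrow> real. \<epsilon> \<in> O(\<lambda>n. real n powr (-1/2)) \<and>
         (\<forall>\<^sub>F n in sequentially.
            fps_nth (fishburn_gf (multiset_gf l)) n =
              c * exp (\<beta> * sqrt (real n)) * \<rho> powr (real n / 2)
                * real n powr (real n / 2 + 1) * (1 + \<epsilon> n)))) \<and>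
     (m \<ge> 2 \<longrightarrow>
       (\<exists>\<epsilon> :: nat \<Rightarrow> real. \<epsilon> \<in> O(\<lambda>n. real n powr (-1/2)) \<and>
         (\<forall>\<^sub>F n in sequentially.
            fps_nth (fishburn_gf (multiset_gf l)) n =
              (if even n
               then c' * exp (\<beta> * sqrt (real n)) * \<rho> powr (real n / 2)
                      * real n powr (real n / 2 + 1) * (1 + \<epsilon> n)
               else c\<^sub>m * exp (\<beta> * sqrt (real n)) * \<rho> powr (real n / 2)
                      * real n powr (real n / 2 - real m + 5/2) * (1 + \<epsilon> n)))))"
proof -
  define L where "L = multiset_gf l"
  have Ln: "fps_nth L k = real (l k)" for k by (simp add: L_def multiset_gf_def)
  define a where "a = real (l 2)"
  have a: "0 < a" using assms(5) by (simp add: a_def)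
  have La: "fps_nth L 2 = a" by (simp add: Ln a_def)
  define A where "A = pi\<^sup>2 / (6 * a)"
  have A: "0 < A" using a by (simp add: A_def)
  define B where "B = pi\<^sup>2 / 6 * real (l 3) / a\<^sup>2"
  define \<kappa> where "\<kappa> = exp (pi\<^sup>2 / 6 * (real (l 4) / a\<^sup>2 - 1 / 2 - (real (l 3))\<^sup>2 / a ^ 3)) / sqrt a ^ 3"
  have \<kappa>: "0 < \<kappa>" using a by (simp add: \<kappa>_def)
  have gc: "0 < gauss_const A b" for b using A by (simp add: gauss_const_def)
  have lodd: "l k = 0" if "odd k" "k < 2 * m + 1" for k
  proof -
    from that(1) obtain j where j: "k = 2 * j + 1" by (elim oddE)
    then show ?thesis using assms(4)[of "j + 1"] that(2) by simp
  qed
  have l1: "l 1 = 0" using assms(3) by (intro lodd) auto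
  have L': "fps_nth L 0 = 1" "fps_conv_radius L > 0" "fps_nth L 1 = 0" "0 < fps_nth L 2"
    using assms(1,2,5) l1 by (simp_all only: Ln) (simp_all add: L_def)
  obtain P M E :: "nat \<Rightarrow> real" where F: "\<forall>N. fps_nth (fishburn_gf L) N = sqrt (2 * pi) * (P N + (-1) ^ N * M N) + E N"
    and E: "\<forall>b t. (\<lambda>N. E N / laplace_scale A b t (real N)) \<in> O(\<lambda>N. real N powr (-1/2))"
    and P: "(\<lambda>N. P N / laplace_scale A B 2 (real N) - \<kappa> * gauss_const A B) \<in> O(\<lambda>N. real N powr (-1/2))"
    and M: "(\<lambda>N. M N / laplace_scale A (- B) 2 (real N) - \<kappa> * gauss_const A (- B)) \<in> O(\<lambda>N. real N powr (-1/2))"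
    and PM: "2 \<le> m \<longrightarrow> (\<forall>k. odd k \<longrightarrow> k < 2 * m + 1 \<longrightarrow> fps_nth L k = 0) \<longrightarrow>
      (\<lambda>N. (P N - M N) / laplace_scale A 0 (5 - 2 * real m) (real N)
        - \<kappa> * (pi\<^sup>2 / 6 * (2 * fps_nth L (2 * m + 1)) / a\<^sup>2) * gauss_const A 0) \<in> O(\<lambda>N. real N powr (-1/2))"
    using fishburn_integral_form[OF L', of m] unfolding La Ln[of 3] Ln[of 4] A_def[symmetric] B_def[symmetric] \<kappa>_def[symmetric]
    by blast
  have \<beta>: "\<beta> = B / sqrt (2 * A)"
  proof -
    have "sqrt (2 * A) = pi / (sqrt 3 * sqrt a)"
      using a by (simp add: A_def real_sqrt_divide real_sqrt_mult)
    moreover have "a powr (3 / 2) = a * sqrt a"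
    proof -
      have "a powr (3 / 2) = a powr (1 + 1 / 2)" by simp
      also have "\<dots> = a * sqrt a" using a by (simp only: powr_add powr_half_sqrt less_imp_le powr_one)
      finally show ?thesis .
    qed
    moreover have "sqrt a * sqrt a = a" "sqrt 3 * sqrt 3 = 3" using a by simp_all
    then have "pi\<^sup>2 / 6 * real (l 3) / a\<^sup>2 / (pi / (sqrt 3 * sqrt a)) = real (l 3) * pi / (2 * sqrt 3 * (a * sqrt a))"
      using a by (simp add: divide_simps power2_eq_square)
    ultimately show ?thesis by (simp add: assms(7) B_def a_def)
  qed
  have \<rho>: "\<rho> = 1 / (2 * A * exp 1)"
    using a by (simp add: assms(8) A_def a_def[symmetric])
  have A2: "(2 * A) powr (- 2 / 2) = 3 * a / pi\<^sup>2" using A a by (simp add: powr_minus A_def)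
  show ?thesis unfolding L_def[symmetric]
  proof (intro conjI impI)
    assume m: "m = 1"
    \<comment> \<open>For m = 1 the positive coefficient \<open>l (2 * m + 1)\<close> is
      \<open>l 3\<close>, so the half-line p > 0 dominates.\<close>
    have B: "0 < B" using assms(6) a m by (simp add: B_def)
    define G where "G = fps_nth (fishburn_gf L)"
    define g where "g = sqrt (2 * pi) * \<kappa> * gauss_const A B"
    have "(\<lambda>N. sqrt (2 * pi) * (P N / laplace_scale A B 2 (real N) - \<kappa> * gauss_const A B)
        + sqrt (2 * pi) * ((-1) ^ N * M N / laplace_scale A B 2 (real N)) + E N / laplace_scale A B 2 (real N)) \<in> O(\<lambda>N. real N powr (-1/2))"
    proof (intro sum_in_bigo(1) cmult_bigo P E[rule_format])
      have "(\<lambda>N. (-1) ^ N * (M N / laplace_scale A B 2 (real N))) \<in> O(\<lambda>N. 1 * real N powr (-1/2))"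
        by (intro landau_o.big_mult laplace_scale_uminus_bigo[OF A B M]) (auto intro!: bigoI[where c = 1])
      then show "(\<lambda>N. (-1) ^ N * M N / laplace_scale A B 2 (real N)) \<in> O(\<lambda>N. real N powr (-1/2))" by simp
    qed
    then have 1: "(\<lambda>N. G N / laplace_scale A B 2 (real N) - g) \<in> O(\<lambda>N. real N powr (-1/2))"
      by (simp add: G_def F g_def ring_distribs add_divide_distrib mult.assoc diff_add_eq)
    have 2: "g \<noteq> 0" using \<kappa> gc[of B] by (simp add: g_def)
    \<comment> \<open>Laplace's method contributes 1/8 and the local expansion -1 to the coefficient
      of (l 3)^2/a^3 in the exponent; together they give -7/8.\<close>
    have 3: "c = g * (2 * A) powr (- 2 / 2)"
    proof -
      have "B\<^sup>2 / (8 * A) = pi\<^sup>2 / 6 * ((real (l 3))\<^sup>2 / (8 * a ^ 3))"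
        using a by (simp add: B_def A_def power_mult_distrib divide_simps power2_eq_square power3_eq_cube)
      then have "exp (pi\<^sup>2 / 6 * (real (l 4) / a\<^sup>2 - 1 / 2 - (real (l 3))\<^sup>2 / a ^ 3)) * exp (B\<^sup>2 / (8 * A))
          = exp (pi\<^sup>2 / 6 * (real (l 4) / a\<^sup>2 - 1/2 - 7 * (real (l 3))\<^sup>2 / (8 * a ^ 3)))"
        by (simp add: field_simps flip: exp_add)
      then show ?thesis
        unfolding g_def \<kappa>_def gauss_prefactor[OF a A_def] A2 assms(9) a_def[symmetric] using a by simp
    qed
    have two_neq0: "(2 :: real) \<noteq> 0" by simp
    note fin = asymp_finish[OF A 2 1 \<beta> \<rho> 3]
    show "\<exists>\<epsilon> :: nat \<Rightarrow> real. \<epsilon> \<in> O(\<lambda>n. real n powr (-1/2)) \<and>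
         (\<forall>\<^sub>F n in sequentially. fps_nth (fishburn_gf L) n =
              c * exp (\<beta> * sqrt (real n)) * \<rho> powr (real n / 2) * real n powr (real n / 2 + 1) * (1 + \<epsilon> n))"
    proof (intro exI conjI)
      show "(\<lambda>N. G N / (g * laplace_scale A B 2 (real N)) - 1) \<in> O(\<lambda>n. real n powr (-1/2))"
        by (rule fin(1))
      show "\<forall>\<^sub>F n in sequentially. fps_nth (fishburn_gf L) n =
              c * exp (\<beta> * sqrt (real n)) * \<rho> powr (real n / 2) * real n powr (real n / 2 + 1)
              * (1 + (G n / (g * laplace_scale A B 2 (real n)) - 1))"
        using fin(2) unfolding G_def by (simp only: div_self[OF two_neq0])
    qed
  next
    assume m: "m \<ge> 2"
    have "l 3 = 0" using m by (intro lodd) auto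
    then have B: "B = 0" by (simp add: B_def)
    define D where "D = pi\<^sup>2 / 6 * (real (l 4) / a\<^sup>2 - 1 / 2)"
    have \<kappa>': "\<kappa> = exp D / sqrt a ^ 3" using \<open>l 3 = 0\<close> by (simp add: \<kappa>_def D_def)
    define \<eta> where "\<eta> = pi\<^sup>2 / 6 * (2 * real (l (2 * m + 1))) / a\<^sup>2"
    have \<eta>: "0 < \<eta>" using a assms(6) by (simp add: \<eta>_def)
    define g where "g = sqrt (2 * pi) * \<kappa> * gauss_const A 0"
    have g: "0 < g" using \<kappa> gc[of 0] by (simp add: g_def)
    have g': "g = sqrt 6 / a * exp D" unfolding g_def \<kappa>' gauss_prefactor[OF a A_def] by simp
    define t where "t = 5 - 2 * real m"
    have Lodd: "\<forall>k. odd k \<longrightarrow> k < 2 * m + 1 \<longrightarrow> fps_nth L k = 0" using lodd by (simp add: Ln)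
    define G1 where "G1 = (\<lambda>N. sqrt (2 * pi) * (P N + M N) + E N)"
    define G2 where "G2 = (\<lambda>N. sqrt (2 * pi) * (P N - M N) + E N)"
    have "(\<lambda>N. sqrt (2 * pi) * (P N / laplace_scale A 0 2 (real N) - \<kappa> * gauss_const A 0)
        + sqrt (2 * pi) * (M N / laplace_scale A 0 2 (real N) - \<kappa> * gauss_const A 0) + E N / laplace_scale A 0 2 (real N)) \<in> O(\<lambda>N. real N powr (-1/2))"
      using P M by (intro sum_in_bigo(1) cmult_bigo E[rule_format]) (simp_all add: B)
    \<comment> \<open>With B = 0 both half-lines contribute g; the doubling turns 3 sqrt 6 into the
      6 sqrt 6 of c'.\<close>
    then have G1: "(\<lambda>N. G1 N / laplace_scale A B 2 (real N) - 2 * g) \<in> O(\<lambda>N. real N powr (-1/2))"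
      by (simp add: G1_def g_def B ring_distribs add_divide_distrib mult.assoc algebra_simps)
    have c': "c' = 2 * g * (2 * A) powr (- 2 / 2)"
      using a unfolding A2 g' assms(10) a_def[symmetric] D_def by simp
    note fin1 = asymp_finish[OF A _ G1 \<beta> \<rho> c']
    \<comment> \<open>For odd n the common leading part is never estimated: P - M is compared
      directly with the smaller scale.\<close>
    have "(\<lambda>N. sqrt (2 * pi) * ((P N - M N) / laplace_scale A 0 t (real N) - \<kappa> * \<eta> * gauss_const A 0)
        + E N / laplace_scale A 0 t (real N)) \<in> O(\<lambda>N. real N powr (-1/2))"
      using PM m Lodd by (intro sum_in_bigo(1) cmult_bigo E[rule_format]) (simp add: \<eta>_def Ln t_def)
    then have G2: "(\<lambda>N. G2 N / laplace_scale A B t (real N) - g * \<eta>) \<in> O(\<lambda>N. real N powr (-1/2))"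
      by (simp add: G2_def g_def B ring_distribs add_divide_distrib diff_divide_distrib mult.assoc algebra_simps)
    have cm: "c\<^sub>m = g * \<eta> * (2 * A) powr (- t / 2)"
    proof -
      have 1: "(2 * A) powr (- t / 2) = pi powr (2 * real m - 5) / 3 powr (real m - 5 / 2) / a powr (real m - 5 / 2)"
      proof -
        have "2 * A = pi powr 2 / (3 * a)" by (simp add: A_def)
        moreover have "- t / 2 = real m - 5 / 2" by (simp add: t_def)
        moreover have "2 * (real m - 5 / 2) = 2 * real m - 5" by simp
        ultimately show ?thesis using a by (simp add: powr_divide powr_mult powr_powr del: powr_numeral)
      qed
      have 2: "pi powi (2 * int m - 3) = pi powr (2 * real m - 5) * pi\<^sup>2"
      proof -
        have "pi powi (2 * int m - 3) = pi powr (real_of_int (2 * int m - 3))"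
          by (rule powr_real_of_int'[symmetric]) simp_all
        also have "\<dots> = pi powr ((2 * real m - 5) + 2)" by (rule arg_cong[where f = "(powr) pi"]) simp
        also have "\<dots> = pi powr (2 * real m - 5) * pi\<^sup>2" by (subst powr_add) (simp add: powr_numeral)
        finally show ?thesis .
      qed
      have 3: "(3 :: real) powi (int m - 2) = 3 powr (real m - 5 / 2) * sqrt 3"
      proof -
        have "(3 :: real) powi (int m - 2) = 3 powr (real_of_int (int m - 2))"
          by (rule powr_real_of_int'[symmetric]) simp_all
        also have "\<dots> = 3 powr ((real m - 5 / 2) + 1 / 2)" by (rule arg_cong[where f = "(powr) 3"]) simp
        also have "\<dots> = 3 powr (real m - 5 / 2) * sqrt 3" by (subst powr_add) (simp add: powr_half_sqrt)
        finally show ?thesis .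
      qed
      have 4: "a powr (real m + 1 / 2) = a powr (real m - 5 / 2) * a ^ 3"
      proof -
        have "a powr (real m + 1 / 2) = a powr ((real m - 5 / 2) + 3)" by (rule arg_cong[where f = "(powr) a"]) simp
        also have "\<dots> = a powr (real m - 5 / 2) * a ^ 3" using a by (subst powr_add) (simp add: powr_numeral)
        finally show ?thesis .
      qed
      have 5: "sqrt 6 = sqrt 2 * sqrt 3" by (simp flip: real_sqrt_mult)
      define q where "q = sqrt 3"
      have q: "0 < q" "q * q = 3" by (simp_all add: q_def)
      \<comment> \<open>All powers are now reduced to the exponents 2m - 5 and m - 5/2, so the claim
        is an identity of rational expressions in x, y, z and the remaining constants.\<close>
      define x y z where "x = pi powr (2 * real m - 5)" and "y = 3 powr (real m - 5 / 2)" and "z = a powr (real m - 5 / 2)"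
      have xyz: "0 < y" "0 < z" using a by (simp_all add: y_def z_def)
      show ?thesis
        unfolding assms(11) a_def[symmetric] D_def[symmetric] g' \<eta>_def 1 2 3 4 5 x_def[symmetric] y_def[symmetric] z_def[symmetric] q_def[symmetric]
        using a xyz q(1) by (simp add: divide_simps q(2) power2_eq_square power3_eq_cube)
    qed
    note fin2 = asymp_finish[OF A _ G2 \<beta> \<rho> cm]
    define \<epsilon>1 where "\<epsilon>1 = (\<lambda>N. G1 N / (2 * g * laplace_scale A B 2 (real N)) - 1)"
    define \<epsilon>2 where "\<epsilon>2 = (\<lambda>N. G2 N / (g * \<eta> * laplace_scale A B t (real N)) - 1)"
    \<comment> \<open>One error function for both parities; it is bounded by |\<epsilon>1| +
      |\<epsilon>2|, and each of these is O(n^(-1/2)) over all n.\<close>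
    define \<epsilon> where "\<epsilon> = (\<lambda>N. if even N then \<epsilon>1 N else \<epsilon>2 N)"
    have nz: "2 * g \<noteq> 0" "g * \<eta> \<noteq> 0" using g \<eta> by auto
    have "(\<lambda>N. \<bar>\<epsilon>1 N\<bar> + \<bar>\<epsilon>2 N\<bar>) \<in> O(\<lambda>N. real N powr (-1/2))"
      using fin1(1)[OF nz(1)] fin2(1)[OF nz(2)] unfolding \<epsilon>1_def \<epsilon>2_def by (intro sum_in_bigo(1)) simp_all
    then have "\<epsilon> \<in> O(\<lambda>N. real N powr (-1/2))"
      by (rule landau_o.big_trans[rotated]) (auto intro!: bigoI[where c = 1] simp: \<epsilon>_def)
    moreover have "\<forall>\<^sub>F n in sequentially. fps_nth (fishburn_gf L) n =
              (if even n
               then c' * exp (\<beta> * sqrt (real n)) * \<rho> powr (real n / 2)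
                      * real n powr (real n / 2 + 1) * (1 + \<epsilon> n)
               else c\<^sub>m * exp (\<beta> * sqrt (real n)) * \<rho> powr (real n / 2)
                      * real n powr (real n / 2 - real m + 5/2) * (1 + \<epsilon> n))"
      using fin1(2)[OF nz(1)] fin2(2)[OF nz(2)]
    proof eventually_elim
      case (elim n)
      have t: "real n / 2 + t / 2 = real n / 2 - real m + 5/2" by (simp add: t_def field_simps)
      show ?case
      proof (cases "even n")
        case True
        then have "fps_nth (fishburn_gf L) n = G1 n" by (simp add: F G1_def)
        with True elim(1) show ?thesis by (simp add: \<epsilon>_def \<epsilon>1_def)
      next
        case False
        then have "fps_nth (fishburn_gf L) n = G2 n" by (simp add: F G2_def)
        with False elim(2) show ?thesis unfolding t by (simp add: \<epsilon>_def \<epsilon>2_def)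
      qed
    qed
    ultimately show "\<exists>\<epsilon> :: nat \<Rightarrow> real. \<epsilon> \<in> O(\<lambda>n. real n powr (-1/2)) \<and>
         (\<forall>\<^sub>F n in sequentially.
            fps_nth (fishburn_gf L) n =
              (if even n
               then c' * exp (\<beta> * sqrt (real n)) * \<rho> powr (real n / 2)
                      * real n powr (real n / 2 + 1) * (1 + \<epsilon> n)
               else c\<^sub>m * exp (\<beta> * sqrt (real n)) * \<rho> powr (real n / 2)
                      * real n powr (real n / 2 - real m + 5/2) * (1 + \<epsilon> n)))" by blast
  qed
qed

end
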